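(* Let $K \subset \mathbb{C}$ be a nonempty compact connected set and let $\epsilon > 0$. Then there is a conformally balanced finite plane tree $T$ that is within Hausdorff distance $\epsilon$ of $K$.
   Context: A finite plane tree is a compact connected set $T \subset \mathbb{C}$ that does not separate the plane and is the union of finitely many closed Jordan arcs, any two of which are either disjoint or have exactly one endpoint in common; the edges are the interiors of these arcs and the vertices are their endpoints. Let $\mathbb{D}^* = \{|z| > 1\} \cup \{\infty\}$, $\mathbb{T} = \{|z| = 1\}$, and let $R_{m}$ denote the set of $m$-th roots of unity. For a finite plane tree $T$, $\Omega = \hat{\mathbb{C}} \setminus T$ is simply connected, and any conformal map $f : \mathbb{D}^* \to \Omega$ with $f(\infty) = \infty$ extends continuously to $\mathbb{T}$. A finite plane tree $T$ with $n$ edges is conformally balanced if there is such a conformal map $f$ such that each component of $\mathbb{T} \setminus R_{2n}$ is mapped by $f$ one-to-one onto an edge of $T$, and whenever $I, J$ are two distinct components of $\mathbb{T} \setminus R_{2n}$ mapped onto the same edge, the map $I \to J$ sending $x \in I$ to the unique $y \in J$ with $f(y) = f(x)$ is length preserving and orientation reversing (with respect to arclength and the orientation of $\mathbb{T}$). The Hausdorff distance between compact sets $A, B$ is the infimum of $\epsilon > 0$ such that each is contained in the $\epsilon$-neighborhood of the other. *)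

theory Defs
  imports "HOL-Analysis.Analysis"
begin

definition nbhd :: "real \<Rightarrow> complex set \<Rightarrow> complex set" where
  "nbhd e A = {x. \<exists>a\<in>A. dist x a < e}"

definition hausdorff_distance :: "complex set \<Rightarrow> complex set \<Rightarrow> real" where
  "hausdorff_distance A B = Inf {e. e > 0 \<and> A \<subseteq> nbhd e B \<and> B \<subseteq> nbhd e A}"

text \<open>A finite plane tree, presented by the finite set E of closed Jordan arcs
  (parametrised by arcs [0,1] -> C) whose union is the tree.\<close>
definition tree_set :: "(real \<Rightarrow> complex) set \<Rightarrow> complex set" where
  "tree_set E = (\<Union>g\<in>E. path_image g)"

definition finite_plane_tree :: "(real \<Rightarrow> complex) set \<Rightarrow> bool" where
  "finite_plane_tree E \<longleftrightarrow>
     finite E \<and> (\<forall>g\<in>E. arc g) \<and>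
     compact (tree_set E) \<and> connected (tree_set E) \<and> connected (- tree_set E) \<and>
     (\<forall>g\<in>E. \<forall>h\<in>E. g \<noteq> h \<longrightarrow>
        path_image g \<inter> path_image h = {} \<or>
        (\<exists>p. path_image g \<inter> path_image h = {p} \<and>
             p \<in> {pathstart g, pathfinish g} \<and> p \<in> {pathstart h, pathfinish h}))"

definition tree_edges :: "(real \<Rightarrow> complex) set \<Rightarrow> complex set set" where
  "tree_edges E = (\<lambda>g. path_image g - {pathstart g, pathfinish g}) ` E"

text \<open>The k-th component of the unit circle minus the 2n-th roots of unity
  (k < 2n): the open arc of angles between pi k/n and pi (k+1)/n.\<close>
definition circ_arc :: "nat \<Rightarrow> nat \<Rightarrow> complex set" where
  "circ_arc n k = (\<lambda>t. cis t) ` {pi * k / n <..< pi * (k + 1) / n}"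

text \<open>f is a conformal map from the exterior of the closed unit disc onto the
  complement of the tree (on the Riemann sphere, with f(infinity) = infinity),
  extended continuously to the unit circle.\<close>
definition exterior_riemann_map :: "complex set \<Rightarrow> (complex \<Rightarrow> complex) \<Rightarrow> bool" where
  "exterior_riemann_map T f \<longleftrightarrow>
     f holomorphic_on {z. 1 < norm z} \<and>
     bij_betw f {z. 1 < norm z} (- T) \<and>
     filterlim f at_infinity at_infinity \<and>
     continuous_on {z. 1 \<le> norm z} f"

definition conformally_balanced :: "(real \<Rightarrow> complex) set \<Rightarrow> bool" where
  "conformally_balanced E \<longleftrightarrow>
     (let n = card E in
      \<exists>f. exterior_riemann_map (tree_set E) f \<and>
        (\<forall>k<2*n. inj_on f (circ_arc n k) \<and> f ` circ_arc n k \<in> tree_edges E) \<and>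
        (\<forall>j<2*n. \<forall>k<2*n. j \<noteq> k \<and> f ` circ_arc n j = f ` circ_arc n k \<longrightarrow>
           (\<forall>t. 0 < t \<and> t < pi / n \<longrightarrow>
              f (cis (pi * j / n + t)) = f (cis (pi * (k + 1) / n - t)))))"

end

theory Submission
  imports Defs
    "HOL-Complex_Analysis.Complex_Analysis"
    "HOL-Computational_Algebra.Fundamental_Theorem_Algebra"
begin

text \<open>
  A conformally balanced tree is the preimage of \<open>[-1, 1]\<close> under a Shabat polynomial, i.e. a complex
  polynomial with critical values in \<open>{-1, 1}\<close>. Given \<open>K\<close>, Faber polynomials of a compact set without
  loops close to \<open>K\<close> yield a polynomial \<open>q\<close> with \<open>{|q| \<le> 1}\<close> close to \<open>K\<close> and all critical values in the
  open unit disc. If the critical points are simple, then the critical values can be moved independently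
  by small perturbations of \<open>q\<close>, so they can be placed in the dense set of points \<open>v\<close> such that
  \<open>2 v\<^sup>N - 1 = cos (\<pi> k / m)\<close> for suitable \<open>N\<close>, \<open>m\<close>, \<open>k\<close>. With the Chebyshev polynomial \<open>C\<^sub>m\<close>, the composition
  \<open>C\<^sub>m (2 q\<^sup>N - 1)\<close> is then a Shabat polynomial. Its tree is the preimage under \<open>q\<close> of the star formed by
  the radii to the \<open>N\<close>-th roots of unity, which for large \<open>N\<close> is Hausdorff close to \<open>{|q| \<le> 1}\<close>.
\<close>

subsection \<open>Preimages under complex polynomials\<close>

text \<open>On \<open>|z| >= 1\<close> the exterior map \<open>f\<close> for a Shabat polynomial
  \<open>p\<close> of degree \<open>n\<close> has to satisfy
  \<open>p (f z) = (z^n + z^(-n)) / 2\<close>. In the coordinate \<open>log z\<close> the right side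
  is \<open>cosh (n z)\<close>, which avoids \<open>[-1, 1]\<close> on the right half-plane; off
  \<open>[-1, 1]\<close> the polynomial \<open>p\<close> is a covering, so \<open>f\<close> is found
  by lifting. Comparing the \<open>n\<close> shifts of the lift with the \<open>n\<close> roots of
  \<open>p = const\<close> gives periodicity, injectivity and surjectivity. On the circle
  \<open>p o f\<close> is the cosine of \<open>n\<close> times the angle, which forces the
  reflections that a balanced tree needs. In the exterior coordinate \<open>s\<close> of the
  punctured disc, the \<open>n\<close>-th Faber polynomial is \<open>s^(-n)\<close> up to an
  exponentially smaller error. As \<open>s^(-n)\<close> has no critical points, those of the Faber
  polynomial lie close to the compact set; this is what puts the critical values inside the disc,
  the only place where points of the star can approximate them. Perturbations have degree below that
  of \<open>q\<close>, so that the leading term and the behaviour at infinity stay the same.\<close>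

lemma finite_positive_lower_bound:
  fixes f :: "'a \<Rightarrow> real"
  assumes "finite I" "\<And>x. x \<in> I \<Longrightarrow> 0 < f x"
  obtains m where "m > 0" "\<And>x. x \<in> I \<Longrightarrow> m \<le> f x"
proof
  show "Min (insert 1 (f ` I)) > 0" using assms by auto
  show "Min (insert 1 (f ` I)) \<le> f x" if "x \<in> I" for x using assms that by (intro Min_le) auto
qed

lemma finite_separated:
  fixes I :: "'a::metric_space set"
  assumes "finite I"
  obtains m where "m > 0" "\<And>x y. \<lbrakk>x \<in> I; y \<in> I; x \<noteq> y\<rbrakk> \<Longrightarrow> m \<le> dist x y"
proof -
  have "finite (I \<times> I - Id)" using assms by simp
  then obtain m where "m > 0" "\<And>x. x \<in> I \<times> I - Id \<Longrightarrow> m \<le> dist (fst x) (snd x)"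
    by (rule finite_positive_lower_bound[of _ "\<lambda>x. dist (fst x) (snd x)"]) auto
  then show ?thesis using that[of m] by force
qed

lemma compact_poly_norm_less_one:
  fixes q :: "complex poly"
  assumes "compact A" "\<And>z. z \<in> A \<Longrightarrow> norm (poly q z) < 1"
  obtains m where "m > 0" "\<And>z. z \<in> A \<Longrightarrow> norm (poly q z) \<le> 1 - m"
proof (cases "A = {}")
  case False
  have "continuous_on A (\<lambda>z. norm (poly q z))" by (intro continuous_intros)
  then obtain w where "w \<in> A" "\<And>z. z \<in> A \<Longrightarrow> norm (poly q z) \<le> norm (poly q w)"
    using continuous_attains_sup[OF assms(1) False] by blast
  then show ?thesis using assms(2) that[of "1 - norm (poly q w)"] by simp
qed (use that[of 1] in auto)

text \<open>In the factorisation of \<open>p - y\<close> every factor is at least the distance from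
  \<open>z\<close> to the nearest root \<open>x\<close>. The bound involves only the leading
  coefficient and the degree, so it is uniform in \<open>z\<close> and \<open>y\<close> and is
  shared by polynomials with the same leading term.\<close>

lemma poly_root_near:
  fixes p :: "complex poly"
  assumes "degree p > 0"
  obtains x where "poly p x = y" "norm (lead_coeff p) * norm (z - x) ^ degree p \<le> norm (poly p z - y)"
proof -
  define q where "q = p + [:-y:]"
  have dq: "degree q = degree p"
    unfolding q_def using assms by (simp add: degree_add_eq_left)
  have lq: "lead_coeff q = lead_coeff p"
    unfolding dq unfolding q_def using assms by (cases "degree p") auto
  obtain r where r: "smult (lead_coeff q) (\<Prod>i<degree q. [:-r i, 1:]) = q"
    using complex_poly_decompose' by blast
  have "poly (smult (lead_coeff q) (\<Prod>i<degree q. [:-r i, 1:])) w = lead_coeff q * (\<Prod>i<degree q. (w - r i))" for w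
    by (simp add: poly_prod)
  then have "poly q w = lead_coeff p * (\<Prod>i<degree p. (w - r i))" for w
    by (metis r lq dq)
  then have qw: "poly p w - y = lead_coeff p * (\<Prod>i<degree p. (w - r i))" for w
    by (simp add: q_def)
  define i where "i = arg_min_on (\<lambda>i. norm (z - r i)) {..<degree p}"
  have i: "i \<in> {..<degree p}"
    unfolding i_def using assms by (intro arg_min_if_finite) auto
  have le: "norm (z - r i) \<le> norm (z - r j)" if "j < degree p" for j
    unfolding i_def using that assms by (intro arg_min_least) auto
  have "norm (z - r i) ^ degree p \<le> (\<Prod>j<degree p. norm (z - r j))"
    using prod_mono[of "{..<degree p}" "\<lambda>_. norm (z - r i)" "\<lambda>j. norm (z - r j)"] le by auto
  then have "norm (lead_coeff p) * norm (z - r i) ^ degree p \<le> norm (poly p z - y)"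
    by (simp add: qw norm_mult prod_norm mult_left_mono)
  moreover have "poly p (r i) = y"
    proof -
    have "(\<Prod>j<degree p. r i - r j) = 0" by (rule prod_zero) (use i in auto)
    then show ?thesis by (metis qw mult_zero_right right_minus_eq)
  qed
  ultimately show ?thesis using that by blast
qed

lemma poly_root_within:
  fixes p :: "complex poly"
  assumes "degree p > 0" "e > 0"
  obtains d where "d > 0" "\<And>z y. norm (poly p z - y) < d \<Longrightarrow> \<exists>x. poly p x = y \<and> norm (z - x) < e"
proof
  have l: "norm (lead_coeff p) > 0" using assms by auto
  show "0 < norm (lead_coeff p) * e ^ degree p" using l assms by simp
  fix z y assume a: "norm (poly p z - y) < norm (lead_coeff p) * e ^ degree p"
  obtain x where x: "poly p x = y" "norm (lead_coeff p) * norm (z - x) ^ degree p \<le> norm (poly p z - y)"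
    using poly_root_near assms by blast
  then have "norm (z - x) ^ degree p < e ^ degree p"
    using a l by (smt (verit) mult_left_less_imp_less norm_ge_zero mult_less_cancel_left_pos)
  then show "\<exists>x. poly p x = y \<and> norm (z - x) < e"
    using x assms by (metis less_le_not_le power_less_imp_less_base)
qed

text \<open>Every point of \<open>S\<close> lies near one of at most \<open>n\<close> roots of
  \<open>p = y\<close>, so a connected \<open>S\<close> cannot spread far. This turns control of
  \<open>p\<close> along a lift into control of the lift, without a choice of branches.\<close>

lemma connected_poly_small:
  fixes p :: "complex poly"
  assumes "degree p > 0" "e > 0"
  obtains d where "d > 0"
    "\<And>S y a b. \<lbrakk>connected S; \<And>z. z \<in> S \<Longrightarrow> norm (poly p z - y) < d; a \<in> S; b \<in> S\<rbrakk> \<Longrightarrow> dist a b < e"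
proof -
  define n where "n = degree p"
  have n: "n > 0" using assms n_def by simp
  have "e / (2 * n) > 0" using n assms by simp
  then obtain d where d: "d > 0" "\<And>z y. norm (poly p z - y) < d \<Longrightarrow> \<exists>x. poly p x = y \<and> norm (z - x) < e / (2 * n)"
    using poly_root_within[OF assms(1)] by metis
  have "dist a b < e" if S: "connected S" "\<And>z. z \<in> S \<Longrightarrow> norm (poly p z - y) < d" "a \<in> S" "b \<in> S" for S y a b
  proof (rule ccontr)
    assume "\<not> dist a b < e"
    then have ab: "e \<le> dist a b" by simp
    have conn: "connected ((\<lambda>z. dist a z) ` S)"
      by (intro connected_continuous_image continuous_intros S)
    \<comment> \<open>By the intermediate value theorem \<open>S\<close> contains
      \<open>n + 1\<close> points at the distances \<open>0, e/n, ..., e\<close> from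
      \<open>a\<close>. Two of them must share a nearby root, although they are at least
      \<open>e/n\<close> apart.\<close>
    have "\<exists>s\<in>S. dist a s = k * e / n" if "k \<in> {..n}" for k
    proof -
      have "k * e / n \<le> e" using that n assms by (simp add: field_simps)
      then have "k * e / n \<in> (\<lambda>z. dist a z) ` S"
        using connectedD_interval[OF conn, of "dist a a" "dist a b" "k * e / n"] ab S assms by auto
      then show ?thesis by (metis imageE)
    qed
    then obtain s where s: "\<And>k. k \<le> n \<Longrightarrow> s k \<in> S \<and> dist a (s k) = k * e / n"
      by (metis atMost_iff)
    have "\<exists>x. poly p x = y \<and> norm (s k - x) < e / (2 * n)" if "k \<le> n" for k
      using d(2) S(2) s that by blast
    then obtain x where x: "\<And>k. k \<le> n \<Longrightarrow> poly p (x k) = y \<and> norm (s k - x k) < e / (2 * n)"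
      by metis
    define q where "q = p + [:-y:]"
    have dq: "degree q = n"
      unfolding q_def n_def using assms by (simp add: degree_add_eq_left)
    then have q0: "q \<noteq> 0" using n by auto
    have "x ` {..n} \<subseteq> {z. poly q z = 0}" using x by (auto simp: q_def)
    then have "card (x ` {..n}) \<le> card {z. poly q z = 0}"
      using poly_roots_finite[OF q0] card_mono by blast
    also have "\<dots> \<le> n" using card_poly_roots_bound[OF q0] dq by simp
    finally have "card (x ` {..n}) < card {..n}" by simp
    then obtain k l where kl: "k \<le> n" "l \<le> n" "k \<noteq> l" "x k = x l"
      using pigeonhole[of x "{..n}"] unfolding inj_on_def by auto
    have "dist (s k) (s l) < e / n"
      using x[OF kl(1)] x[OF kl(2)] kl(4) norm_triangle_ineq4[of "s k - x k" "s l - x k"]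
      by (simp add: dist_norm field_simps)
    moreover have "\<bar>dist a (s k) - dist a (s l)\<bar> \<le> dist (s k) (s l)"
      using dist_triangle[of a "s k" "s l"] dist_triangle[of a "s l" "s k"] by (simp add: dist_commute)
    moreover have "\<bar>dist a (s k) - dist a (s l)\<bar> = \<bar>real k - real l\<bar> * (e / n)"
    proof -
      have "dist a (s k) - dist a (s l) = (real k - real l) * (e / n)"
        using s[OF kl(1)] s[OF kl(2)] by (simp add: left_diff_distrib diff_divide_distrib)
      then show ?thesis using assms n by (simp add: abs_mult)
    qed
    moreover have "\<bar>real k - real l\<bar> \<ge> 1" using kl by linarith
    ultimately show False
      using \<open>e / (2 * n) > 0\<close> assms n mult_right_mono[of 1 "\<bar>real k - real l\<bar>" "e/n"] by (simp )
  qed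
  then show ?thesis using that d by blast
qed

definition seg :: "complex set" where "seg = complex_of_real ` {-1..1}"

lemma closed_seg: "closed seg"
  unfolding seg_def by (intro compact_imp_closed compact_continuous_image continuous_intros) auto

lemma holomorphic_on_poly: "poly p holomorphic_on A"
  by (intro holomorphic_intros)

text \<open>Over \<open>y\<close> outside \<open>S\<close> all roots are simple, so \<open>p\<close>
  is injective on small discs around them. It is a covering because no further preimages come in
  from elsewhere: by \<open>poly_root_within\<close>, every point with value near \<open>y\<close>
  is near a root of \<open>p = y\<close>.\<close>

lemma poly_covering:
  fixes p :: "complex poly"
  assumes d: "degree p > 0"
    and crit: "\<And>z. poly (pderiv p) z = 0 \<Longrightarrow> poly p z \<in> S" and S: "closed S"
  shows "covering_space (- (poly p -` S)) (poly p) (- S)"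
proof
  show "continuous_on (- (poly p -` S)) (poly p)" by (intro continuous_intros)
  show "poly p ` (- (poly p -` S)) = - S"
  proof -
    have "\<exists>x. poly p x = y" for y using poly_root_near[OF d] by metis
    then show ?thesis by (auto simp: image_iff Bex_def) metis
  qed
  fix y assume y: "y \<in> - S"
  define R where "R = {x. poly p x = y}"
  have finR: "finite R"
  proof -
    have "p + [:-y:] \<noteq> 0" using d by (metis degree_add_eq_left degree_pCons_0 degree_0 less_numeral_extra(3))
    then have "finite {x. poly (p + [:-y:]) x = 0}" by (rule poly_roots_finite)
    moreover have "{x. poly (p + [:-y:]) x = 0} = R" by (auto simp: R_def)
    ultimately show ?thesis by simp
  qed
  have nz: "deriv (poly p) x \<noteq> 0" if "x \<in> R" for x
    using crit[of x] y that DERIV_imp_deriv[OF poly_DERIV, of p x] by (auto simp: R_def)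
  have "\<exists>r>0. inj_on (poly p) (ball x r)" if "x \<in> R" for x
    using has_complex_derivative_locally_injective[of "poly p" UNIV x] nz[OF that]
    by (metis UNIV_I holomorphic_on_poly open_UNIV)
  then obtain r where r: "\<And>x. x \<in> R \<Longrightarrow> r x > 0 \<and> inj_on (poly p) (ball x (r x))" by metis
  obtain s0 where s0: "s0 > 0" "\<And>x x'. \<lbrakk>x \<in> R; x' \<in> R; x \<noteq> x'\<rbrakk> \<Longrightarrow> s0 \<le> dist x x'"
    by (rule finite_separated[OF finR]) blast
  define e where "e = Min (insert (s0/2) (r ` R))"
  have e: "e > 0" unfolding e_def using finR r s0 by auto
  have er: "e \<le> r x" if "x \<in> R" for x unfolding e_def using finR that by auto
  have es: "e \<le> s0/2" unfolding e_def using finR by (intro Min_le) auto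
  have opB: "open (poly p ` ball x e)" if "x \<in> R" for x
  proof (rule open_mapping_thm3)
    show "inj_on (poly p) (ball x e)" using r[OF that] er[OF that] by (meson inj_on_subset subset_ball)
  qed (auto intro: holomorphic_on_poly)
  obtain dd where dd: "dd > 0" "\<And>z y. norm (poly p z - y) < dd \<Longrightarrow> \<exists>x. poly p x = y \<and> norm (z - x) < e"
    using poly_root_within[OF d e] by metis
  \<comment> \<open>The ball keeps all preimages of \<open>T\<close> in the discs, and the
    intersection of the images makes every disc reach all of \<open>T\<close>.\<close>
  define T where "T = (- S) \<inter> ball y dd \<inter> (\<Inter>x\<in>R. poly p ` ball x e)"
  have oT: "open T" unfolding T_def using S finR opB by (intro open_Int open_INT) (auto)
  have yT: "y \<in> T" unfolding T_def using y dd e by (force simp: R_def)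
  define W where "W x = ball x e \<inter> poly p -` T" for x
  have oW: "open (W x)" for x
    unfolding W_def by (intro open_Int open_ball open_vimage oT continuous_intros)
  have un: "\<Union>(W ` R) = - (poly p -` S) \<inter> poly p -` T"
  proof -
    have "z \<in> \<Union>(W ` R)" if "poly p z \<in> T" for z
    proof -
      have "norm (poly p z - y) < dd" using that by (auto simp: T_def dist_norm norm_minus_commute)
      then obtain x where "poly p x = y" "norm (z - x) < e" using dd by blast
      then show ?thesis using that by (force simp: W_def R_def dist_norm norm_minus_commute)
    qed
    moreover have "poly p z \<notin> S" if "poly p z \<in> T" for z using that by (auto simp: T_def)
    ultimately show ?thesis by (auto simp: W_def)
  qed
  have hom: "\<exists>q. homeomorphism (W x) T (poly p) q" if x: "x \<in> R" for x
  proof -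
    have inj: "inj_on (poly p) (W x)"
      using r[OF x] er[OF x] by (metis Int_lower1 W_def inj_on_subset subset_ball)
    have im: "poly p ` W x = T"
    proof -
      have "T \<subseteq> poly p ` ball x e" using x by (auto simp: T_def)
      then show ?thesis unfolding W_def by blast
    qed
    obtain q where "homeomorphism (W x) (poly p ` W x) (poly p) q"
      by (rule invariance_of_domain_homeomorphism[where f="poly p", OF oW])
         (use inj in \<open>auto intro!: holomorphic_on_imp_continuous_on holomorphic_on_poly\<close>)
    then show ?thesis using im by auto
  qed
  have "pairwise disjnt (W ` R)"
  proof (clarsimp simp: pairwise_def)
    fix x x' assume x: "x \<in> R" "x' \<in> R" "W x \<noteq> W x'"
    then have "s0 \<le> dist x x'" using s0 by metis
    then have "e + e \<le> dist x x'" using es by linarith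
    then have "ball x e \<inter> ball x' e = {}"
      by (metis disjoint_ballI)
    then show "disjnt (W x) (W x')" by (auto simp: W_def disjnt_def)
  qed
  moreover have "openin (top_of_set (- S)) T"
    using oT by (simp add: T_def open_subset subset_iff)
  moreover have "openin (top_of_set (- (poly p -` S))) u" if "u \<in> W ` R" for u
    using oW that by (intro open_subset) (auto simp: W_def T_def)
  ultimately show "\<exists>T. y \<in> T \<and> openin (top_of_set (- S)) T \<and>
         (\<exists>v. \<Union> v = - (poly p -` S) \<inter> poly p -` T \<and> (\<forall>u\<in>v. openin (top_of_set (- (poly p -` S))) u) \<and>
              pairwise disjnt v \<and> (\<forall>u\<in>v. \<exists>q. homeomorphism u T (poly p) q))"
    using yT un hom by (intro exI[of _ T] conjI exI[of _ "W ` R"]) auto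
qed

subsection \<open>The Riemann map of the complement of a Shabat tree\<close>

lemma one_in_seg: "1 \<in> seg" "- 1 \<in> seg"
  unfolding seg_def by (rule image_eqI[of _ _ 1], simp, simp) (rule image_eqI[of _ _ "-1"], simp, simp)

text \<open>\<open>cosh z = cos (i z)\<close>, and the cosine takes values in \<open>[-1, 1]\<close>
  only at real arguments.\<close>

lemma cosh_in_seg: assumes "cosh z \<in> seg" shows "Re z = 0"
proof -
  obtain t where t: "t \<in> {-1..1}" "cosh z = complex_of_real t" using assms by (auto simp: seg_def)
  have "cos (\<i> * z) = cos (complex_of_real (arccos t))"
    using t by (simp add: cosh_conv_cos cos_of_real)
  then obtain k where "\<i> * z = of_real (arccos t) + of_real (2 * k * pi) \<or> \<i> * z = - of_real (arccos t) + of_real (2 * k * pi)"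
    unfolding complex_cos_eq by auto
  then have "Im (\<i> * z) = 0" by (auto simp: complex_eq_iff)
  then show ?thesis by simp
qed

text \<open>The other family of solutions starts from \<open>- w\<close>, which lies in the left
  half-plane.\<close>

lemma cosh_eq_cosh:
  fixes z w :: complex
  assumes "cosh z = cosh w" "Re z > 0" "Re w > 0"
  obtains k :: int where "z = w + 2 * pi * k * \<i>"
proof -
  have "cos (\<i> * z) = cos (\<i> * w)" using assms by (simp add: cosh_conv_cos)
  then obtain x where x: "x \<in> \<int>" "\<i> * z = \<i> * w + of_real (2 * x * pi) \<or> \<i> * z = - (\<i> * w) + of_real (2 * x * pi)"
    unfolding complex_cos_eq by auto
  then obtain k where k: "x = of_int k" by (auto elim: Ints_cases)
  have "z = - \<i> * (\<i> * z)" "w = - \<i> * (\<i> * w)" by simp_all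
  moreover from x(2) have "\<i> * z = \<i> * w + of_real (2 * x * pi)"
    using assms(2,3) by (auto simp: complex_eq_iff)
  ultimately have "z = - \<i> * (\<i> * w + of_real (2 * x * pi))" by simp
  then have "z = w + 2 * pi * of_int (-k) * \<i>" using k by (simp add: algebra_simps)
  then show ?thesis using that by blast
qed

text \<open>Preimages come in pairs \<open>z\<close>, \<open>- z\<close>. One of them has positive
  real part unless both are imaginary, where \<open>cosh\<close> takes values in
  \<open>[-1, 1]\<close>.\<close>

lemma cosh_surj:
  assumes "y \<notin> seg" obtains z where "Re z > 0" "cosh z = y"
proof -
  define w where "w = Arccos y"
  have w: "cos w = y" by (simp add: w_def)
  have 1: "cosh (\<i> * w) = y" "cosh (- (\<i> * w)) = y"
    using w by (auto simp: cosh_conv_cos simp flip: mult.assoc)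
  have "Re (\<i> * w) \<noteq> 0"
  proof
    assume "Re (\<i> * w) = 0"
    then have "w = of_real (Re w)" by (auto simp: complex_eq_iff)
    then have "y = of_real (cos (Re w))" using w by (metis cos_of_real)
    then show False using assms by (auto simp: seg_def)
  qed
  then have "Re (\<i> * w) > 0 \<or> Re (- (\<i> * w)) > 0" by auto
  then show ?thesis using 1 that by blast
qed

lemma poly_over_power_at_infinity:
  fixes p :: "complex poly"
  shows "((\<lambda>z. poly p z / z ^ degree p) \<longlongrightarrow> lead_coeff p) at_infinity"
proof -
  have "((\<lambda>z. coeff p i * z ^ i / z ^ degree p) \<longlongrightarrow> (if i = degree p then lead_coeff p else 0)) at_infinity"
    if i: "i \<le> degree p" for i
  proof (cases "i = degree p")
    case True
    have "eventually (\<lambda>z. coeff p i * z ^ i / z ^ degree p = lead_coeff p) at_infinity"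
      using eventually_not_equal_at_infinity[of 0] by eventually_elim (simp add: True)
    then show ?thesis unfolding if_P[OF True] by (rule tendsto_eventually)
  next
    case False
    then have lt: "i < degree p" using i by simp
    have "((\<lambda>z::complex. inverse z ^ (degree p - i)) \<longlongrightarrow> 0 ^ (degree p - i)) at_infinity"
      by (intro tendsto_power tendsto_inverse_0)
    then have "((\<lambda>z::complex. coeff p i * inverse z ^ (degree p - i)) \<longlongrightarrow> coeff p i * 0) at_infinity"
      using lt by (intro tendsto_mult tendsto_const) (simp add: power_0_left)
    moreover have "eventually (\<lambda>z. coeff p i * inverse z ^ (degree p - i) = coeff p i * z ^ i / z ^ degree p) at_infinity"
      using eventually_not_equal_at_infinity[of 0]
    proof eventually_elim
      case (elim z)
      have "z ^ degree p = z ^ i * z ^ (degree p - i)" using lt by (simp flip: power_add)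
      then show ?case using elim by (simp add: field_simps)
    qed
    ultimately show ?thesis using False by (auto intro: Lim_transform_eventually)
  qed
  then have "((\<lambda>z. \<Sum>i\<le>degree p. coeff p i * z ^ i / z ^ degree p) \<longlongrightarrow>
     (\<Sum>i\<le>degree p. if i = degree p then lead_coeff p else 0)) at_infinity"
    by (intro tendsto_sum) auto
  then show ?thesis by (simp add: poly_altdef sum_divide_distrib)
qed

text \<open>\<open>Re z\<close> tends to infinity, uniformly in \<open>Im z\<close>: the
  neighbourhoods of infinity seen through \<open>exp\<close>.\<close>

abbreviation at_right_inf :: "complex filter" where "at_right_inf \<equiv> filtercomap Re at_top"

lemma exp_tendsto_at_right_inf: "((\<lambda>z::complex. exp (- (of_nat n * z))) \<longlongrightarrow> 0) at_right_inf" if "n > 0"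
proof -
  have "filterlim (\<lambda>z. real n * Re z) at_top at_right_inf"
    using that by (intro filterlim_tendsto_pos_mult_at_top[OF tendsto_const] filterlim_filtercomap) auto
  then have "((\<lambda>z. exp (- (real n * Re z))) \<longlongrightarrow> 0) at_right_inf"
    by (intro filterlim_compose[OF exp_at_bot] filterlim_compose[OF filterlim_uminus_at_bot_at_top])
  then show ?thesis by (subst tendsto_norm_zero_iff[symmetric]) (simp add: norm_exp_eq_Re)
qed

lemma cosh_asymp: "((\<lambda>z::complex. cosh (of_nat n * z) * exp (- (of_nat n * z))) \<longlongrightarrow> 1/2) at_right_inf" if "n > 0"
proof -
  have "((\<lambda>z::complex. (1 + exp (- (of_nat n * z)) * exp (- (of_nat n * z))) / 2) \<longlongrightarrow> (1 + 0 * 0) / 2) at_right_inf"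
    by (intro tendsto_intros exp_tendsto_at_right_inf that) auto
  moreover have "(1 + exp (- (of_nat n * z)) * exp (- (of_nat n * z))) / 2 = cosh (of_nat n * z) * exp (- (of_nat n * z))" for z :: complex
    by (simp add: cosh_field_def field_simps flip: exp_add)
  ultimately show ?thesis by simp
qed

lemma poly_at_infinityD:
  fixes p :: "complex poly"
  assumes "filterlim (\<lambda>x. poly p (g x)) at_infinity F"
  shows "filterlim g at_infinity F"
proof -
  have "eventually (\<lambda>x. norm (g x) > B) F" for B
  proof -
    have "compact (poly p ` cball 0 B)"
      by (intro compact_continuous_image continuous_intros compact_cball)
    then obtain M where M: "\<And>z. norm z \<le> B \<Longrightarrow> norm (poly p z) \<le> M"
      using compact_imp_bounded bounded_iff by (metis image_eqI mem_cball_0)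
    have "eventually (\<lambda>x. norm (poly p (g x)) > M) F"
      using assms by (auto simp: filterlim_at_infinity_conv_norm_at_top filterlim_at_top_dense)
    then show ?thesis by eventually_elim (meson M linorder_not_less)
  qed
  then show ?thesis by (auto simp: filterlim_at_infinity_conv_norm_at_top filterlim_at_top_dense)
qed

text \<open>Near \<open>f z\<close> the polynomial has a holomorphic inverse \<open>q\<close>, and
  by continuity \<open>f\<close> is locally \<open>q\<close> applied to
  \<open>poly p (f z)\<close>.\<close>

lemma holomorphic_poly_lift:
  assumes S: "open S" and cont: "continuous_on S f" and hol: "(\<lambda>z. poly p (f z)) holomorphic_on S"
    and nz: "\<And>z. z \<in> S \<Longrightarrow> poly (pderiv p) (f z) \<noteq> 0"
  shows "f holomorphic_on S"
proof -
  have "f field_differentiable at z" if z: "z \<in> S" for z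
  proof -
    have "deriv (poly p) (f z) \<noteq> 0" using nz[OF z] DERIV_imp_deriv[OF poly_DERIV, of p "f z"] by simp
    then obtain r where r: "r > 0" "inj_on (poly p) (ball (f z) r)"
      using has_complex_derivative_locally_injective[OF holomorphic_on_poly UNIV_I open_UNIV] by blast
    obtain q where q: "q holomorphic_on (poly p ` ball (f z) r)" "\<And>w. w \<in> ball (f z) r \<Longrightarrow> q (poly p w) = w"
      by (rule holomorphic_has_inverse[OF holomorphic_on_poly open_ball r(2)]) blast
    define V where "V = S \<inter> f -` ball (f z) r"
    have oV: "open V" unfolding V_def using cont S by (intro continuous_open_preimage) auto
    have "(\<lambda>w. q (poly p (f w))) holomorphic_on V"
      by (rule holomorphic_on_compose_gen[OF holomorphic_on_subset[OF hol] q(1), unfolded o_def]) (auto simp: V_def)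
    then have "f holomorphic_on V"
      by (rule holomorphic_transform) (auto simp: V_def q(2))
    moreover have "z \<in> V" using z r by (simp add: V_def)
    ultimately show ?thesis using oV holomorphic_on_imp_differentiable_at by blast
  qed
  then show ?thesis by (auto simp: holomorphic_on_def intro: field_differentiable_at_within)
qed

locale shabat =
  fixes p :: "complex poly"
  assumes deg: "degree p > 0"
    and crit: "\<And>z. poly (pderiv p) z = 0 \<Longrightarrow> poly p z = 1 \<or> poly p z = -1"
begin

abbreviation n where "n \<equiv> degree p"

abbreviation H :: "complex set" where "H \<equiv> {z. 0 < Re z}"

lemma covering: "covering_space (- (poly p -` seg)) (poly p) (- seg)"
proof (rule poly_covering[OF deg _ closed_seg])
  fix z assume "poly (pderiv p) z = 0"
  then have "poly p z = of_real 1 \<or> poly p z = of_real (-1)" using crit by simp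
  then show "poly p z \<in> seg" using one_in_seg by auto
qed

lemma cosh_notin_seg: "Re z > 0 \<Longrightarrow> cosh (of_nat n * z) \<notin> seg"
  using cosh_in_seg[of "of_nat n * z"] deg by auto

text \<open>The half-plane \<open>H\<close> is simply connected and covers the exterior of the unit
  disc by \<open>exp\<close>. On it \<open>cosh (n z)\<close> avoids \<open>seg\<close>, off which
  \<open>p\<close> is a covering.\<close>

lemma lift_exists:
  obtains g where "continuous_on H g" "\<And>z. Re z > 0 \<Longrightarrow> poly p (g z) = cosh (of_nat n * z)"
proof -
  have cv: "convex H" using convex_halfspace_Re_gt by blast
  have oH: "open H" using open_halfspace_Re_gt by blast
  obtain g where "continuous_on H g" "g \<in> H \<rightarrow> - (poly p -` seg)" "\<And>z. z \<in> H \<Longrightarrow> poly p (g z) = cosh (of_nat n * z)"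
  proof (rule covering_space_lift[OF covering, of H "\<lambda>z. cosh (of_nat n * z)"])
    show "simply_connected H" using cv convex_imp_simply_connected by blast
    show "locally path_connected H" using oH open_imp_locally_path_connected by blast
    show "continuous_on H (\<lambda>z. cosh (of_nat n * z))" by (intro continuous_intros)
    show "(\<lambda>z. cosh (of_nat n * z)) \<in> H \<rightarrow> - seg" using cosh_notin_seg by auto
  qed blast
  then show ?thesis using that by auto
qed

end

locale shabat_lift = shabat +
  fixes g :: "complex \<Rightarrow> complex"
  assumes contg: "continuous_on H g" and pg: "\<And>z. Re z > 0 \<Longrightarrow> poly p (g z) = cosh (of_nat n * z)"
begin

text \<open>As \<open>cosh\<close> has period \<open>2 pi i\<close>, a shift by
  \<open>2 pi i k / n\<close> is another lift of the same function. \<open>G n\<close> is the shift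
  by the full period of \<open>exp\<close>.\<close>

definition G :: "int \<Rightarrow> complex \<Rightarrow> complex" where "G k z = g (z + 2 * pi * k * \<i> / n)"

lemma contG: "continuous_on H (G k)"
  unfolding G_def by (rule continuous_on_compose2[OF contg]) (auto intro!: continuous_intros)

lemma exp_2pi_int: "exp (of_int (2 * k) * (of_real pi * \<i>)) = 1"
  unfolding exp_eq_1 by auto

lemma pG: "Re z > 0 \<Longrightarrow> poly p (G k z) = cosh (of_nat n * z)"
proof -
  assume z: "Re z > 0"
  have "poly p (G k z) = cosh (of_nat n * (z + 2 * pi * k * \<i> / n))"
    unfolding G_def using z by (intro pg) auto
  also have "of_nat n * (z + 2 * pi * k * \<i> / n) = of_nat n * z + of_int (2 * k) * (of_real pi * \<i>)"
    using deg by (simp add: field_simps)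
  also have "cosh \<dots> = cosh (of_nat n * z)"
    unfolding cosh_field_def by (simp add: exp_add exp_minus exp_diff exp_2pi_int del: of_int_mult)
  finally show ?thesis .
qed

lemma G_notin: "Re z > 0 \<Longrightarrow> poly p (G k z) \<notin> seg"
  using pG cosh_notin_seg by simp

lemma ev_right: "eventually (\<lambda>z. Re z > M) at_right_inf"
  unfolding eventually_filtercomap
  by (intro exI[of _ "\<lambda>x. x > M"]) (simp add: eventually_gt_at_top)

lemma poly_g_at_infinity: "filterlim g at_infinity at_right_inf"
proof (rule poly_at_infinityD[of p])
  have "filterlim (\<lambda>z. cosh (of_nat n * z) * exp (- (of_nat n * z)) / exp (- (of_nat n * z))) at_infinity at_right_inf"
    by (rule filterlim_divide_at_infinity[OF cosh_asymp[OF deg]])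
       (auto simp: filterlim_at exp_tendsto_at_right_inf[OF deg])
  then have "filterlim (\<lambda>z. cosh (of_nat n * z)) at_infinity at_right_inf" by simp
  moreover have "eventually (\<lambda>z. cosh (of_nat n * z) = poly p (g z)) at_right_inf"
    using ev_right[of 0] by eventually_elim (simp add: pg)
  ultimately show "filterlim (\<lambda>x. poly p (g x)) at_infinity at_right_inf"
    by (simp add: filterlim_cong)
qed

lemma right_inf_nontrivial: "at_right_inf \<noteq> bot"
  by (rule filtercomap_neq_bot_surj) (auto intro!: surjI[of Re complex_of_real])

text \<open>Since \<open>p w\<close> is asymptotic to \<open>lead_coeff p * w ^ n\<close> and
  \<open>cosh (n z)\<close> to \<open>exp (n z) / 2\<close>, the lift grows like a constant times
  \<open>exp z\<close>. At this stage only the \<open>n\<close>-th power of the constant is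
  determined.\<close>

lemma power_limit: "((\<lambda>z. (g z * exp (- z)) ^ n) \<longlongrightarrow> 1 / (2 * lead_coeff p)) at_right_inf"
proof -
  have l: "lead_coeff p \<noteq> 0" using deg by auto
  have "((\<lambda>z. poly p (g z) / g z ^ n) \<longlongrightarrow> lead_coeff p) at_right_inf"
    using poly_over_power_at_infinity poly_g_at_infinity by (rule filterlim_compose)
  then have "((\<lambda>z. (cosh (of_nat n * z) * exp (- (of_nat n * z))) / (poly p (g z) / g z ^ n)) \<longlongrightarrow> (1/2) / lead_coeff p) at_right_inf"
    by (intro tendsto_divide cosh_asymp deg l)
  moreover have "eventually (\<lambda>z. (cosh (of_nat n * z) * exp (- (of_nat n * z))) / (poly p (g z) / g z ^ n) = (g z * exp (- z)) ^ n) at_right_inf"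
    using ev_right[of 0]
  proof eventually_elim
    case (elim z)
    have "cosh (of_nat n * z) \<noteq> 0"
      using cosh_notin_seg[OF elim] by (force simp: seg_def intro: image_eqI[of _ _ 0])
    moreover have "exp (- (of_nat n * z)) = exp (- z) ^ n" by (simp flip: exp_of_nat_mult)
    ultimately show ?case using pg[OF elim] by (simp add: power_mult_distrib)
  qed
  ultimately have "((\<lambda>z. (g z * exp (- z)) ^ n) \<longlongrightarrow> (1/2) / lead_coeff p) at_right_inf"
    by (rule Lim_transform_eventually)
  then show ?thesis by simp
qed

text \<open>Far to the right the values of \<open>h\<close> are close to the finitely many
  \<open>n\<close>-th roots of \<open>c\<close>, and on a connected half-plane they cannot jump
  between them. \<open>connected_poly_small\<close> for the monomial \<open>w ^ n\<close> makes this
  quantitative.\<close>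

lemma limit_exists:
  obtains b where "b \<noteq> 0" "((\<lambda>z. g z * exp (- z)) \<longlongrightarrow> b) at_right_inf"
proof -
  define h where "h z = g z * exp (- z)" for z
  define c where "c = 1 / (2 * lead_coeff p)"
  have l: "c \<noteq> 0" using deg by (auto simp: c_def)
  have lim: "((\<lambda>z. h z ^ n) \<longlongrightarrow> c) at_right_inf" using power_limit by (simp add: h_def c_def)
  have cont: "continuous_on H h" unfolding h_def by (intro continuous_intros contg)
  have small: "\<exists>M>0. \<forall>z w. Re z > M \<longrightarrow> Re w > M \<longrightarrow> dist (h z) (h w) < e" if "e > 0" for e
  proof -
    have "degree (monom (1::complex) n) > 0" using deg by (simp add: degree_monom_eq)
    then obtain d where d: "d > 0"
      "\<And>S y a b. \<lbrakk>connected S; \<And>z. z \<in> S \<Longrightarrow> norm (poly (monom (1::complex) n) z - y) < d; a \<in> S; b \<in> S\<rbrakk> \<Longrightarrow> dist a b < e"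
      using connected_poly_small[of "monom 1 n" e] \<open>e > 0\<close> by metis
    have "eventually (\<lambda>z. dist (h z ^ n) c < d) at_right_inf"
      using lim d(1) by (rule tendstoD)
    then obtain M where M: "\<And>z. Re z \<ge> M \<Longrightarrow> dist (h z ^ n) c < d"
      unfolding eventually_filtercomap eventually_at_top_linorder by metis
    define M' where "M' = max M 1"
    have "connected (h ` {z. Re z > M'})"
      by (rule connected_continuous_image[OF continuous_on_subset[OF cont]
           convex_connected[OF convex_halfspace_Re_gt]]) (auto simp: M'_def)
    then have "dist (h z) (h w) < e" if "Re z > M'" "Re w > M'" for z w
      by (rule d(2)[of _ c]) (use M that in \<open>auto simp: poly_monom dist_norm M'_def\<close>)
    moreover have "M' > 0" by (simp add: M'_def)
    ultimately show ?thesis by blast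
  qed
  \<comment> \<open>Sampling at the integers finds the candidate limit; \<open>small\<close> then
    carries the convergence over to the whole half-plane.\<close>
  have "Cauchy (\<lambda>k. h (of_nat k))"
  proof (rule metric_CauchyI)
    fix e :: real assume "e > 0"
    then obtain M where M: "\<forall>z w. Re z > M \<longrightarrow> Re w > M \<longrightarrow> dist (h z) (h w) < e" using small by blast
    obtain N :: nat where N: "real N > M" using reals_Archimedean2 by blast
    show "\<exists>N. \<forall>k\<ge>N. \<forall>l\<ge>N. dist (h (of_nat k)) (h (of_nat l)) < e"
      by (rule exI[of _ N]) (use M N in auto)
  qed
  then obtain b where b: "(\<lambda>k. h (of_nat k)) \<longlonglongrightarrow> b"
    using Cauchy_convergent convergentD by blast
  have lim_h: "(h \<longlongrightarrow> b) at_right_inf"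
  proof (rule tendstoI)
    fix e :: real assume "e > 0"
    then obtain M where M: "\<forall>z w. Re z > M \<longrightarrow> Re w > M \<longrightarrow> dist (h z) (h w) < e / 2"
      using small[of "e/2"] by auto
    have "eventually (\<lambda>k. dist (h (of_nat k)) b < e / 2) sequentially"
      using b \<open>e > 0\<close> by (intro tendstoD) auto
    moreover have "eventually (\<lambda>k. real k > M) sequentially"
      by (simp add: eventually_gt_at_top filterlim_at_top_dense[THEN iffD1, OF filterlim_real_sequentially])
    ultimately obtain k where k: "dist (h (of_nat k)) b < e / 2" "real k > M"
      by (metis (mono_tags, lifting) eventually_conj eventually_happens' trivial_limit_sequentially)
    show "eventually (\<lambda>z. dist (h z) b < e) at_right_inf"
      using ev_right[of M]
    proof eventually_elim
      case (elim z)
      then have "dist (h z) (h (of_nat k)) < e / 2" using M k by simp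
      then show ?case using k dist_triangle[of "h z" b "h (of_nat k)"] by simp
    qed
  qed
  then have "((\<lambda>z. h z ^ n) \<longlongrightarrow> b ^ n) at_right_inf" by (rule tendsto_power)
  then have "b ^ n = c" using lim right_inf_nontrivial tendsto_unique by blast
  then have "b \<noteq> 0" using l deg by auto
  then show ?thesis using that lim_h by (simp add: h_def[abs_def])
qed

text \<open>A shift multiplies the leading constant of the lift by the root of unity
  \<open>exp (2 pi i k / n)\<close>, by which the lifts can be told apart.\<close>

lemma G_limit:
  assumes "((\<lambda>z. g z * exp (- z)) \<longlongrightarrow> b) at_right_inf"
  shows "((\<lambda>z. G k z * exp (- z)) \<longlongrightarrow> b * exp (2 * pi * k * \<i> / n)) at_right_inf"
proof -
  define c where "c = 2 * pi * k * \<i> / n"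
  have "filterlim (\<lambda>z. z + c) at_right_inf at_right_inf"
  proof -
    have "Re c = 0" unfolding c_def by (simp add: Re_divide_of_nat)
    then show ?thesis by (simp add: filterlim_filtercomap_iff o_def filterlim_filtercomap)
  qed
  from filterlim_compose[OF assms this]
  have "((\<lambda>z. g (z + c) * exp (- (z + c)) * exp c) \<longlongrightarrow> b * exp c) at_right_inf"
    by (intro tendsto_mult tendsto_const)
  moreover have "g (z + c) * exp (- (z + c)) * exp c = G k z * exp (- z)" for z
    by (simp add: G_def c_def mult.assoc flip: exp_add)
  ultimately show ?thesis by (simp only: c_def[symmetric])
qed

text \<open>Lifts that agree at one point agree on all of \<open>H\<close>, hence have the same
  leading constant.\<close>

lemma G_agree:
  assumes "Re z > 0" "G k z = G l z"
  shows "int n dvd k - l"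
proof -
  obtain b where b: "b \<noteq> 0" "((\<lambda>z. g z * exp (- z)) \<longlongrightarrow> b) at_right_inf" by (rule limit_exists)
  have eq: "G k w = G l w" if "Re w > 0" for w
    by (rule covering_space_lift_unique[OF covering, of "G k" z "G l" H "\<lambda>z. cosh (of_nat n * z)" w])
       (use assms that contG pG G_notin cosh_notin_seg in
         \<open>auto intro!: continuous_intros convex_connected convex_halfspace_Re_gt\<close>)
  have "eventually (\<lambda>z. G k z * exp (- z) = G l z * exp (- z)) at_right_inf"
    using ev_right[of 0] by eventually_elim (simp add: eq)
  then have "((\<lambda>z. G l z * exp (- z)) \<longlongrightarrow> b * exp (2 * pi * k * \<i> / n)) at_right_inf"
    using G_limit[OF b(2)] by (rule Lim_transform_eventually[rotated])
  then have "b * exp (2 * pi * k * \<i> / n) = b * exp (2 * pi * l * \<i> / n)"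
    using G_limit[OF b(2)] right_inf_nontrivial tendsto_unique by blast
  then have "exp (2 * pi * k * \<i> / n) = exp (2 * pi * l * \<i> / n)" using b by simp
  then obtain j :: int where j: "2 * pi * k * \<i> / n = 2 * pi * l * \<i> / n + (of_int (2 * j) * pi) * \<i>"
    unfolding exp_eq by blast
  then have "Im (2 * pi * k * \<i> / n) = Im (2 * pi * l * \<i> / n + (of_int (2 * j) * pi) * \<i>)" by simp
  then have "2 * pi * k / n = 2 * pi * l / n + 2 * j * pi" by simp
  then have "2 * pi * real_of_int k = 2 * pi * (real_of_int l + j * real n)"
    using deg by (simp add: field_simps)
  then have "real_of_int k = real_of_int l + j * real n"
    using pi_neq_zero by (metis mult_cancel_left mult_eq_0_iff zero_neq_numeral)
  then have "k = l + j * int n" by (metis of_int_add of_int_mult of_int_of_nat_eq of_int_eq_iff)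
  then show ?thesis by simp
qed

text \<open>By \<open>G_agree\<close> the \<open>n\<close> shifts are \<open>n\<close> distinct
  roots of a polynomial of degree \<open>n\<close>, hence all of them.\<close>

lemma G_roots:
  assumes "Re z > 0" "poly p w = cosh (of_nat n * z)"
  obtains k :: int where "0 \<le> k" "k < int n" "w = G k z"
proof -
  define q where "q = p + [:- cosh (of_nat n * z):]"
  have dq: "degree q = n" unfolding q_def using deg by (simp add: degree_add_eq_left)
  then have q0: "q \<noteq> 0" using deg by auto
  have inj: "inj_on (\<lambda>k. G k z) {0..<int n}"
  proof (rule inj_onI)
    fix k l assume "k \<in> {0..<int n}" "l \<in> {0..<int n}" "G k z = G l z"
    then show "k = l" using G_agree[OF assms(1), of k l]
      by (metis atLeastLessThan_iff mod_eq_dvd_iff mod_pos_pos_trivial)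
  qed
  have fin: "finite {w. poly q w = 0}" using q0 by (rule poly_roots_finite)
  have sub: "(\<lambda>k. G k z) ` {0..<int n} \<subseteq> {w. poly q w = 0}"
    using pG[OF assms(1)] by (auto simp: q_def)
  have "card ((\<lambda>k. G k z) ` {0..<int n}) = n" by (simp add: card_image inj)
  moreover have "card {w. poly q w = 0} \<le> n" using card_poly_roots_bound[OF q0] dq by simp
  ultimately have "(\<lambda>k. G k z) ` {0..<int n} = {w. poly q w = 0}"
    using card_seteq[OF fin sub] by simp
  moreover have "w \<in> {w. poly q w = 0}" using assms by (simp add: q_def)
  ultimately have "w \<in> (\<lambda>k. G k z) ` {0..<int n}" by blast
  then show ?thesis using that by auto
qed

lemma G_0 [simp]: "G 0 = g" by (simp add: G_def[abs_def])

text \<open>At \<open>z\<close> the shift by the full period agrees with one of the shifts with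
  index \<open>k\<close> below \<open>n\<close>, and \<open>G_agree\<close> leaves only
  \<open>k = 0\<close>. This lets the lift descend along \<open>exp\<close>.\<close>

lemma period1:
  assumes "Re z > 0" shows "g (z + 2 * pi * \<i>) = g z"
proof -
  obtain k :: int where k: "0 \<le> k" "k < int n" "G (int n) z = G k z"
    using G_roots[OF assms pG[OF assms]] by metis
  then have "int n dvd int n - k" using G_agree assms by blast
  then have "int n \<le> int n - k" using k by (intro zdvd_imp_le) auto
  then have "k = 0" using k by simp
  then show ?thesis using k(3) deg by (simp add: G_def mult.assoc)
qed

end

lemma closure_right_half: "closure {z. 0 < Re z} = {z. 0 \<le> Re z}"
  using closure_halfspace_gt[of "1::complex" 0] by (simp add: inner_complex_def)

context shabat_lift begin

text \<open>Along a short segment \<open>cosh (n z)\<close> varies little, so the image of the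
  segment under \<open>g\<close> is a connected set on which \<open>p\<close> is nearly constant,
  and is small. Uniformity up to the imaginary axis provides the boundary values there.\<close>

lemma g_uniformly_continuous: "uniformly_continuous_on {z. 0 < Re z \<and> Re z < 2} g"
proof (unfold uniformly_continuous_on_def, intro allI impI)
  fix e :: real assume "e > 0"
  then obtain d where d: "d > 0"
    "\<And>S y a b. \<lbrakk>connected S; \<And>z. z \<in> S \<Longrightarrow> norm (poly p z - y) < d; a \<in> S; b \<in> S\<rbrakk> \<Longrightarrow> dist a b < e"
    using connected_poly_small[OF deg, of e] by metis
  define A where "A = {z. 0 < Re z \<and> Re z < 2}"
  have cA: "convex A"
    unfolding A_def Collect_conj_eq by (intro convex_Int convex_halfspace_Re_gt convex_halfspace_Re_lt)
  \<comment> \<open>A bound for the derivative \<open>n sinh (n u)\<close> on the strip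
    \<open>0 < Re u < 2\<close>.\<close>
  define B where "B = n * exp (2 * n) + 1"
  have B: "B > 0" unfolding B_def by (intro add_nonneg_pos) auto
  have lip: "norm (cosh (of_nat n * z) - cosh (of_nat n * w)) \<le> B * norm (z - w)" if "z \<in> A" "w \<in> A" for z w
  proof (rule field_differentiable_bound[OF cA _ _ that])
    fix u assume u: "u \<in> A"
    show "((\<lambda>z. cosh (of_nat n * z)) has_field_derivative (sinh (of_nat n * u) * of_nat n)) (at u within A)"
      by (auto intro!: derivative_eq_intros)
    have "norm (sinh (of_nat n * u)) \<le> (norm (exp (of_nat n * u)) + norm (exp (- (of_nat n * u)))) / 2"
      using norm_triangle_ineq4[of "exp (of_nat n * u)" "exp (- (of_nat n * u))"]
      unfolding sinh_field_def by (simp add: norm_divide)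
    also have "\<dots> \<le> (exp (2 * n) + exp (2 * n)) / 2"
    proof -
      have "real n * Re u \<le> 2 * n" "- (real n * Re u) \<le> 2 * n"
        using u mult_left_mono[of "Re u" 2 "real n"] by (auto simp: A_def intro: order_trans[of _ 0])
      then show ?thesis by (intro divide_right_mono add_mono) (auto simp: norm_exp_eq_Re)
    qed
    finally have "norm (sinh (of_nat n * u)) \<le> exp (2 * n)" by simp
    then have "norm (sinh (of_nat n * u)) * n \<le> exp (2 * n) * n" by (rule mult_right_mono) simp
    then show "norm (sinh (of_nat n * u) * of_nat n) \<le> B" by (simp add: norm_mult B_def mult.commute)
  qed
  show "\<exists>d>0. \<forall>z\<in>{z. 0 < Re z \<and> Re z < 2}. \<forall>w\<in>{z. 0 < Re z \<and> Re z < 2}. dist w z < d \<longrightarrow> dist (g w) (g z) < e"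
    unfolding A_def[symmetric]
  proof (intro exI[of _ "d / B"] conjI ballI impI)
    show "d / B > 0" using d B by simp
    fix z w assume zw: "z \<in> A" "w \<in> A" "dist w z < d / B"
    have sub: "closed_segment z w \<subseteq> A" using cA zw convex_contains_segment by blast
    show "dist (g w) (g z) < e"
    proof (rule d(2)[of "g ` closed_segment z w" "cosh (of_nat n * z)"])
      show "connected (g ` closed_segment z w)"
        by (rule connected_continuous_image[OF continuous_on_subset[OF contg]])
           (use sub in \<open>auto simp: A_def\<close>)
      fix y assume "y \<in> g ` closed_segment z w"
      then obtain u where u: "u \<in> closed_segment z w" "y = g u" by blast
      then have uA: "u \<in> A" using sub by blast
      then have "norm (poly p y - cosh (of_nat n * z)) \<le> B * norm (u - z)"
        using lip[OF uA zw(1)] pg u by (simp add: A_def)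
      also have "\<dots> \<le> B * norm (w - z)"
        using segment_bound(1)[OF u(1)] B by (intro mult_left_mono) auto
      also have "\<dots> < B * (d / B)" using zw B by (intro mult_strict_left_mono) (auto simp: dist_norm)
      finally show "norm (poly p y - cosh (of_nat n * z)) < d" using B by simp
    qed auto
  qed
qed

text \<open>The strip takes care of the boundary behaviour, and further right \<open>h\<close> is
  \<open>g\<close>. The period and the functional equation pass to the imaginary axis by density of
  \<open>H\<close>.\<close>

lemma extension:
  obtains h where "continuous_on {z. 0 \<le> Re z} h" "\<And>z. Re z > 0 \<Longrightarrow> h z = g z"
    "\<And>z. Re z \<ge> 0 \<Longrightarrow> h (z + 2 * pi * \<i>) = h z"
    "\<And>z. Re z \<ge> 0 \<Longrightarrow> poly p (h z) = cosh (of_nat n * z)"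
proof -
  define A where "A = {z. 0 < Re z \<and> Re z < 2}"
  have "uniformly_continuous_on A g" unfolding A_def by (rule g_uniformly_continuous)
  then obtain h0 where h0: "uniformly_continuous_on (closure A) h0" "\<And>z. z \<in> A \<Longrightarrow> g z = h0 z"
    by (rule uniformly_continuous_on_extension_on_closure) (rule that)
  have clos: "z \<in> closure A" if "0 \<le> Re z" "Re z < 2" for z
  proof (cases "Re z = 0")
    case True
    have "(\<lambda>k. z + of_real (inverse (real (Suc k)))) \<longlonglongrightarrow> z + of_real 0"
      by (intro tendsto_intros LIMSEQ_inverse_real_of_nat)
    moreover have "z + of_real (inverse (real (Suc k))) \<in> A" for k
    proof -
      have "inverse (real (Suc k)) \<le> 1" by (simp add: field_simps)
      then have "inverse (real (Suc k)) < 2" by linarith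
      moreover have "inverse (real (Suc k)) > 0" by simp
      ultimately show ?thesis using True unfolding A_def
        by (simp only: mem_Collect_eq plus_complex.sel Re_complex_of_real add_0_left simp_thms)
    qed
    ultimately show ?thesis unfolding closure_sequential by (intro exI[of _ "\<lambda>k. z + of_real (inverse (real (Suc k)))"]) simp
  next
    case False
    then show ?thesis using that closure_subset[of A] by (auto simp: A_def)
  qed
  define h where "h z = (if Re z > 0 then g z else h0 z)" for z
  have hh0: "h z = h0 z" if "0 \<le> Re z" "Re z < 2" for z
    using that h0(2)[of z] by (auto simp: h_def A_def)
  have cont: "continuous_on {z. 0 \<le> Re z} h"
  proof (rule continuous_on_eq_continuous_within[THEN iffD2], intro ballI)
    fix z :: complex assume z: "z \<in> {z. 0 \<le> Re z}"
    show "continuous (at z within {z. 0 \<le> Re z}) h"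
    proof (cases "Re z > 0")
      case True
      have oH: "open H" using open_halfspace_Re_gt by blast
      have "continuous_on H h" using contg by (rule continuous_on_eq) (simp add: h_def)
      then have "isCont h z" using True oH continuous_on_eq_continuous_at by blast
      then show ?thesis by (rule continuous_at_imp_continuous_at_within)
    next
      case False
      have "continuous_on {z. 0 \<le> Re z \<and> Re z < 2} h0"
        using clos by (intro continuous_on_subset[OF uniformly_continuous_imp_continuous[OF h0(1)]]) auto
      then have "continuous_on {z. 0 \<le> Re z \<and> Re z < 2} h"
        by (rule continuous_on_eq) (simp add: hh0)
      then have "continuous (at z within {z. 0 \<le> Re z \<and> Re z < 2}) h"
        using False z by (auto simp: continuous_on_eq_continuous_within)
      moreover have "at z within {z. 0 \<le> Re z \<and> Re z < 2} = at z within {z. 0 \<le> Re z}"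
        by (rule at_within_nhd[of _ "{z. Re z < 2}"]) (use False z open_halfspace_Re_lt in auto)
      ultimately show ?thesis by (simp add: continuous_within)
    qed
  qed
  have cl: "{z. 0 \<le> Re z} \<subseteq> closure H"
    by (simp add: closure_right_half)
  have per: "h (z + 2 * pi * \<i>) - h z = 0" if "Re z \<ge> 0" for z
  proof (rule continuous_constant_on_closure[of H "\<lambda>z. h (z + 2 * pi * \<i>) - h z"])
    show "continuous_on (closure H) (\<lambda>z. h (z + 2 * pi * \<i>) - h z)"
      by (auto simp: closure_right_half intro!: continuous_intros cont continuous_on_compose2[OF cont])
    show "h (z + 2 * pi * \<i>) - h z = 0" if "z \<in> H" for z using that period1 by (simp add: h_def)
    show "z \<in> closure H" using that cl by auto
  qed
  have eq: "poly p (h z) - cosh (of_nat n * z) = 0" if "Re z \<ge> 0" for z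
  proof (rule continuous_constant_on_closure[of H "\<lambda>z. poly p (h z) - cosh (of_nat n * z)"])
    show "continuous_on (closure H) (\<lambda>z. poly p (h z) - cosh (of_nat n * z))"
      by (auto simp: closure_right_half intro!: continuous_intros cont)
    show "poly p (h z) - cosh (of_nat n * z) = 0" if "z \<in> H" for z using that pg by (simp add: h_def)
    show "z \<in> closure H" using that cl by auto
  qed
  show ?thesis by (rule that[OF cont]) (use per eq in \<open>auto simp: h_def\<close>)
qed

text \<open>The map is \<open>h\<close> in the coordinate \<open>Ln z\<close>; the period makes the
  branch of the logarithm immaterial. Injectivity comes from \<open>G_agree\<close>, surjectivity
  from \<open>G_roots\<close>, and holomorphy from \<open>p o f\<close> being rational.\<close>

lemma riemann_map:
  obtains f where "f holomorphic_on {z. 1 < norm z}" "bij_betw f {z. 1 < norm z} (- (poly p -` seg))"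
    "filterlim f at_infinity at_infinity" "continuous_on {z. 1 \<le> norm z} f"
    "\<And>z. norm z \<ge> 1 \<Longrightarrow> poly p (f z) = (z ^ n + inverse z ^ n) / 2"
proof -
  obtain h where h: "continuous_on {z. 0 \<le> Re z} h" "\<And>z. Re z > 0 \<Longrightarrow> h z = g z"
    "\<And>z. Re z \<ge> 0 \<Longrightarrow> h (z + 2 * pi * \<i>) = h z"
    "\<And>z. Re z \<ge> 0 \<Longrightarrow> poly p (h z) = cosh (of_nat n * z)" using extension by blast
  have hper: "h (z + 2 * pi * of_int m * \<i>) = h z" if "Re z \<ge> 0" for z m
  proof (induction m rule: int_induct[of _ 0])
    case (step1 i)
    then show ?case using h(3)[of "z + 2 * pi * of_int i * \<i>"] that by (simp add: algebra_simps)
  next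
    case (step2 i)
    then show ?case using h(3)[of "z + 2 * pi * of_int (i - 1) * \<i>"] that by (simp add: algebra_simps)
  qed simp
  define f where "f z = h (Ln z)" for z
  have f_exp: "f (exp z) = h z" if "Re z \<ge> 0" for z
  proof -
    have "exp (Ln (exp z)) = exp z" by simp
    then obtain m :: int where "Ln (exp z) = z + (of_int (2 * m) * pi) * \<i>"
      unfolding exp_eq by blast
    then have "Ln (exp z) = z + 2 * pi * of_int m * \<i>" by (simp add: algebra_simps)
    then show ?thesis using hper[OF that, of m] by (simp add: f_def)
  qed
  \<comment> \<open>Near \<open>w\<close> this expression has no branch cut, so it gives continuity
    of \<open>f\<close> across the cut of \<open>Ln\<close>.\<close>
  have local_form: "f z = h (Ln (z / w) + Ln w)" if "norm z \<ge> 1" "norm w \<ge> 1" for z w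
  proof -
    have nz: "z \<noteq> 0" "w \<noteq> 0" using that by auto
    then have "exp (Ln (z / w) + Ln w) = z" by (simp add: exp_add)
    moreover have "Re (Ln (z / w) + Ln w) = ln (norm z)"
      using nz by (simp add: Re_Ln norm_divide ln_div)
    ultimately show ?thesis using f_exp[of "Ln (z / w) + Ln w"] that by simp
  qed
  have Re_form: "Re (Ln (z / w) + Ln w) = ln (norm z)" if "z \<noteq> 0" "w \<noteq> 0" for z w
    using that by (simp add: Re_Ln norm_divide ln_div)
  have cont: "continuous_on {z. 1 \<le> norm z} f"
  proof (rule continuous_on_eq_continuous_within[THEN iffD2], intro ballI)
    fix w :: complex assume w: "w \<in> {z. 1 \<le> norm z}"
    define D where "D = {z. 1 \<le> norm z} \<inter> {z. z / w \<notin> \<real>\<^sub>\<le>\<^sub>0}"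
    have w0: "w \<noteq> 0" using w by auto
    have op: "open {z. z / w \<notin> \<real>\<^sub>\<le>\<^sub>0}"
    proof -
      have "{z. z / w \<notin> \<real>\<^sub>\<le>\<^sub>0} = (\<lambda>z. z / w) -` (- \<real>\<^sub>\<le>\<^sub>0)" by auto
      moreover have "open \<dots>" using w0 by (intro open_vimage continuous_intros) (auto simp: closed_nonpos_Reals_complex)
      ultimately show ?thesis by simp
    qed
    have "continuous_on D (\<lambda>z. h (Ln (z / w) + Ln w))"
    proof (rule continuous_on_compose2[OF h(1)])
      show "continuous_on D (\<lambda>z. Ln (z / w) + Ln w)"
        using w0 by (intro continuous_intros) (auto simp: D_def)
      show "(\<lambda>z. Ln (z / w) + Ln w) ` D \<subseteq> {z. 0 \<le> Re z}"
      proof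
        fix u assume "u \<in> (\<lambda>z. Ln (z / w) + Ln w) ` D"
        then obtain z where z: "z \<in> D" "u = Ln (z / w) + Ln w" by blast
        then have "z \<noteq> 0" by (auto simp: D_def)
        then have "Re u = ln (norm z)" unfolding z(2) using w0 by (rule Re_form)
        moreover have "ln (norm z) \<ge> 0" using z by (intro ln_ge_zero) (simp add: D_def)
        ultimately show "u \<in> {z. 0 \<le> Re z}" by simp
      qed
    qed
    then have "continuous_on D f"
      by (rule continuous_on_eq) (use local_form w in \<open>auto simp: D_def\<close>)
    moreover have "w \<in> D" using w w0 by (simp add: D_def)
    ultimately have "continuous (at w within D) f" by (simp add: continuous_on_eq_continuous_within)
    moreover have "at w within D = at w within {z. 1 \<le> norm z}"
      by (rule at_within_nhd[of _ "{z. z / w \<notin> \<real>\<^sub>\<le>\<^sub>0}"]) (use op w0 in \<open>auto simp: D_def\<close>)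
    ultimately show "continuous (at w within {z. 1 \<le> norm z}) f" by (simp add: continuous_within)
  qed
  have pf: "poly p (f z) = (z ^ n + inverse z ^ n) / 2" if "norm z \<ge> 1" for z
  proof -
    have z0: "z \<noteq> 0" using that by auto
    have "poly p (f z) = cosh (of_nat n * Ln z)"
      unfolding f_def using z0 that by (intro h(4)) simp
    also have "\<dots> = (z ^ n + inverse (z ^ n)) / 2"
      using z0 by (simp add: cosh_field_def exp_of_nat_mult exp_minus)
    finally show ?thesis by (simp add: power_inverse)
  qed
  have fg: "f z = g (Ln z)" "Re (Ln z) > 0" if "norm z > 1" for z
  proof -
    have "z \<noteq> 0" using that by auto
    then show "Re (Ln z) > 0" using that by simp
    then show "f z = g (Ln z)" by (simp add: f_def h(2))
  qed
  have hol: "f holomorphic_on {z. 1 < norm z}"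
  proof (rule holomorphic_poly_lift[of _ _ p])
    show "open {z::complex. 1 < norm z}" by (intro open_Collect_less continuous_intros)
    show "continuous_on {z. 1 < norm z} f" by (rule continuous_on_subset[OF cont]) auto
    have "(\<lambda>z. (z ^ n + inverse z ^ n) / 2) holomorphic_on {z. 1 < norm z}"
      by (intro holomorphic_intros) auto
    then show "(\<lambda>z. poly p (f z)) holomorphic_on {z. 1 < norm z}"
      by (rule holomorphic_transform) (simp add: pf)
    show "poly (pderiv p) (f z) \<noteq> 0" if "z \<in> {z. 1 < norm z}" for z
      using that fg[of z] G_notin[of "Ln z" 0] crit[of "f z"] one_in_seg by auto
  qed
  have bij: "bij_betw f {z. 1 < norm z} (- (poly p -` seg))"
  proof (rule bij_betw_imageI)
    show "inj_on f {z. 1 < norm z}"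
    proof (rule inj_onI)
      fix z w assume z: "z \<in> {z. 1 < norm z}" and w: "w \<in> {z. 1 < norm z}" and eq: "f z = f w"
      have z0: "z \<noteq> 0" "w \<noteq> 0" using z w by auto
      have Re: "Re (Ln z) > 0" "Re (Ln w) > 0" using fg z w by auto
      have gg: "g (Ln z) = g (Ln w)" using eq fg z w by simp
      then have "cosh (of_nat n * Ln z) = cosh (of_nat n * Ln w)" using pg Re by metis
      then obtain k :: int where "of_nat n * Ln z = of_nat n * Ln w + 2 * pi * k * \<i>"
        using Re deg by (elim cosh_eq_cosh) auto
      \<comment> \<open>Equal values of \<open>p o f\<close> only make the logarithms differ by
        \<open>2 pi i k / n\<close>; equality of \<open>f\<close> itself then forces
        \<open>n\<close> to divide \<open>k\<close>.\<close>
      then have k: "Ln z = Ln w + 2 * pi * k * \<i> / n" using deg by (simp add: field_simps)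
      then have "G k (Ln w) = G 0 (Ln w)" using gg by (simp add: G_def)
      then have "int n dvd k" using G_agree[OF Re(2), of k 0] by simp
      then obtain m where "k = int n * m" by blast
      then have "Ln z = Ln w + (of_int (2 * m) * pi) * \<i>" using k deg by (simp add: field_simps)
      then have "exp (Ln z) = exp (Ln w)" unfolding exp_eq by blast
      then show "z = w" using z0 by simp
    qed
    show "f ` {z. 1 < norm z} = - (poly p -` seg)"
    proof (intro equalityI subsetI)
      fix y assume "y \<in> f ` {z. 1 < norm z}"
      then show "y \<in> - (poly p -` seg)" using fg G_notin[of _ 0] by auto
    next
      fix y assume "y \<in> - (poly p -` seg)"
      then obtain v where v: "Re v > 0" "cosh v = poly p y" using cosh_surj by (metis ComplD vimageI)
      define z where "z = v / n"
      have z: "Re z > 0" "poly p y = cosh (of_nat n * z)" using v deg by (simp_all add: z_def Re_divide_of_nat)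
      then obtain k :: int where k: "y = G k z" using G_roots by metis
      define w where "w = z + 2 * pi * k * \<i> / n"
      have "Re w > 0" using z by (simp add: w_def Re_divide_of_nat)
      then have "y = f (exp w)" "norm (exp w) > 1" using k f_exp[of w] h(2)[of w] by (auto simp: G_def w_def norm_exp_eq_Re)
      then show "y \<in> f ` {z. 1 < norm z}" by blast
    qed
  qed
  have lim: "filterlim f at_infinity at_infinity"
  proof -
    have "filterlim (\<lambda>z. Re (Ln z)) at_top at_infinity"
    proof -
      have "filterlim (\<lambda>z::complex. ln (norm z)) at_top at_infinity"
        by (intro filterlim_compose[OF ln_at_top] filterlim_norm_at_top)
      moreover have "eventually (\<lambda>z. ln (norm z) = Re (Ln z)) at_infinity"
        using eventually_not_equal_at_infinity[of 0] by eventually_elim simp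
      ultimately show ?thesis by (simp add: filterlim_cong)
    qed
    then have "filterlim (\<lambda>z. g (Ln z)) at_infinity at_infinity"
      by (intro filterlim_compose[OF poly_g_at_infinity]) (simp add: filterlim_filtercomap_iff o_def)
    moreover have "eventually (\<lambda>z. g (Ln z) = f z) at_infinity"
      unfolding eventually_at_infinity using fg by (intro exI[of _ 2]) auto
    ultimately show ?thesis by (simp add: filterlim_cong)
  qed
  show ?thesis by (rule that[OF hol bij lim cont pf])
qed

end

subsection \<open>Shabat trees are conformally balanced\<close>

text \<open>The equation leaves \<open>a = b\<close> or \<open>a * b = 1\<close>, and the second
  contradicts the norms.\<close>

lemma joukowski_inj:
  fixes a b :: complex
  assumes "a + inverse a = b + inverse b" "norm a > 1" "norm b > 1"
  shows "a = b"
proof -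
  have nz: "a \<noteq> 0" "b \<noteq> 0" using assms by auto
  then have "(a - b) * (a * b - 1) = 0" using assms(1) by (simp add: field_simps)
  moreover have "a * b \<noteq> 1"
  proof
    assume "a * b = 1"
    then have "norm a * norm b = 1" by (metis norm_mult norm_one)
    then show False using assms by (metis less_1_mult less_irrefl)
  qed
  ultimately show ?thesis by simp
qed

lemma cis_eq_cis: "cis a = cis b \<longleftrightarrow> (\<exists>m::int. a = b + 2 * pi * m)"
proof -
  have "cis a = cis b \<longleftrightarrow> exp (\<i> * a) = exp (\<i> * b)" by (simp add: cis_conv_exp)
  also have "\<dots> \<longleftrightarrow> (\<exists>m::int. \<i> * a = \<i> * b + (of_int (2 * m) * pi) * \<i>)" by (simp add: exp_eq)
  also have "\<dots> \<longleftrightarrow> (\<exists>m::int. a = b + 2 * pi * m)"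
  proof (intro ex_cong1)
    fix m :: int
    have "\<i> * a = \<i> * b + (of_int (2 * m) * pi) * \<i> \<longleftrightarrow> a = b + of_int (2 * m) * pi"
      by (simp add: complex_eq_iff)
    then show "\<i> * a = \<i> * b + (of_int (2 * m) * pi) * \<i> \<longleftrightarrow> a = b + 2 * pi * m"
      by (simp add: mult_ac)
  qed
  finally show ?thesis .
qed

lemma shift_interval: "{a<..<a + b} = (\<lambda>t. a + t) ` {0<..<b}" for a b :: real
proof (intro equalityI subsetI)
  fix x assume "x \<in> {a<..<a + b}"
  then show "x \<in> (\<lambda>t. a + t) ` {0<..<b}" by (intro image_eqI[of _ _ "x - a"]) auto
qed auto

lemma reflect_interval: "(\<lambda>t. b - t) ` {0<..<b} = {0<..<b}" for b :: real
proof (intro equalityI subsetI)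
  fix x assume "x \<in> {0<..<b}"
  then show "x \<in> (\<lambda>t. b - t) ` {0<..<b}" by (intro image_eqI[of _ _ "b - x"]) auto
qed auto

lemma scale_interval: "0 < c \<Longrightarrow> (\<lambda>t. c * t) ` {0<..<1} = {0<..<c}" for c :: real
proof (intro equalityI subsetI)
  fix x assume "0 < c" "x \<in> {0<..<c}"
  then show "x \<in> (\<lambda>t. c * t) ` {0<..<1}" by (intro image_eqI[of _ _ "x / c"]) auto
qed auto

locale shabat_map = shabat +
  fixes f :: "complex \<Rightarrow> complex"
  assumes hol: "f holomorphic_on {z. 1 < norm z}"
    and bij: "bij_betw f {z. 1 < norm z} (- (poly p -` seg))"
    and lim: "filterlim f at_infinity at_infinity"
    and cont: "continuous_on {z. 1 \<le> norm z} f"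
    and pf: "\<And>z. norm z \<ge> 1 \<Longrightarrow> poly p (f z) = (z ^ n + inverse z ^ n) / 2"
begin

lemma n_pos: "real n > 0" using deg by simp

lemma pf_cis: fixes t :: real shows "poly p (f (cis t)) = of_real (cos (n * t))"
proof -
  have "poly p (f (cis t)) = (cis (n * t) + cis (- (n * t))) / 2"
    using pf[of "cis t"] by (simp only: norm_cis order_refl cis_inverse Complex.DeMoivre mult_minus_right)
  then show ?thesis by (simp add: complex_eq_iff)
qed

lemma cont_at:
  assumes "norm z = 1" shows "((\<lambda>s. f (of_real s * z)) \<longlongrightarrow> f z) (at_right 1)"
proof -
  have "continuous_on {1..} (\<lambda>s. f (of_real s * z))"
    by (rule continuous_on_compose2[OF cont]) (use assms in \<open>auto intro!: continuous_intros simp: norm_mult\<close>)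
  then have "((\<lambda>s. f (of_real s * z)) \<longlongrightarrow> f (of_real 1 * z)) (at 1 within {1..})"
    unfolding continuous_on_def by (rule bspec) simp
  then have "((\<lambda>s. f (of_real s * z)) \<longlongrightarrow> f (of_real 1 * z)) (at_right 1)"
    by (rule tendsto_within_subset) auto
  then show ?thesis by simp
qed

text \<open>The point \<open>f z\<close> is a radial limit of values of \<open>f\<close> outside the
  circle, which lie off the tree. As every point of the tree comes from the circle, the tree has
  empty interior.\<close>

lemma dense_complement:
  assumes "norm z = 1" "open U" "f z \<in> U"
  obtains w where "w \<in> U" "poly p w \<notin> seg"
proof -
  have "eventually (\<lambda>s. f (of_real s * z) \<in> U) (at_right 1)"
    using cont_at[OF assms(1)] assms(2,3) by (rule topological_tendstoD)
  moreover have "eventually (\<lambda>s::real. s > 1) (at_right 1)" by (simp add: eventually_at_right_less)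
  ultimately obtain s where s: "s > 1" "f (of_real s * z) \<in> U"
    by (metis (mono_tags, lifting) eventually_conj eventually_happens' trivial_limit_at_right_real)
  have "of_real s * z \<in> {z. 1 < norm z}" using s assms by (simp add: norm_mult)
  then have "f (of_real s * z) \<in> - (poly p -` seg)" using bij by (meson bij_betwE)
  then show ?thesis using that s by auto
qed

text \<open>This forces the identification of the two arcs over an edge to reverse orientation.\<close>

lemma same_side:
  fixes a b :: real
  assumes eq: "f (cis a) = f (cis b)" and s: "sin (n * a) * sin (n * b) > 0"
  shows "cis a = cis b"
proof -
  have "cos (n * a) = cos (n * b)" using pf_cis eq by (metis of_real_eq_iff)
  \<comment> \<open>Equal cosines leave the sines equal up to sign, and \<open>s\<close> decides the
    sign.\<close>
  moreover have "sin (n * a) = sin (n * b)"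
  proof -
    have "(sin (n * a))\<^sup>2 = (sin (n * b))\<^sup>2" using calculation by (simp add: sin_squared_eq)
    then have "sin (n * a) = sin (n * b) \<or> sin (n * a) = - sin (n * b)" by (simp add: power2_eq_iff)
    then show ?thesis using s by (auto simp: mult_less_0_iff not_less zero_less_mult_iff)
  qed
  ultimately have cn: "cis a ^ n = cis b ^ n" by (simp only: Complex.DeMoivre complex_eq_iff cis.sel)
  have "poly (pderiv p) (f (cis a)) \<noteq> 0"
  proof
    assume "poly (pderiv p) (f (cis a)) = 0"
    then have "poly p (f (cis a)) = 1 \<or> poly p (f (cis a)) = - 1" by (rule crit)
    then have "complex_of_real (cos (n * a)) = of_real 1 \<or> complex_of_real (cos (n * a)) = of_real (- 1)"
      unfolding pf_cis by simp
    then have "cos (n * a) = 1 \<or> cos (n * a) = - 1" unfolding of_real_eq_iff .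
    then have "(cos (n * a))\<^sup>2 = 1" by auto
    then have "sin (n * a) = 0" by (simp add: cos_squared_eq)
    then show False using s by simp
  qed
  then have "deriv (poly p) (f (cis a)) \<noteq> 0" using DERIV_imp_deriv[OF poly_DERIV, of p "f (cis a)"] by simp
  then obtain r where r: "r > 0" "inj_on (poly p) (ball (f (cis a)) r)"
    using has_complex_derivative_locally_injective[OF holomorphic_on_poly UNIV_I open_UNIV] by blast
  have "eventually (\<lambda>s. f (of_real s * cis a) \<in> ball (f (cis a)) r) (at_right 1)"
    using cont_at[of "cis a"] by (rule topological_tendstoD) (use r in auto)
  moreover have "eventually (\<lambda>s. f (of_real s * cis b) \<in> ball (f (cis a)) r) (at_right 1)"
    using cont_at[of "cis b"] by (rule topological_tendstoD) (use r eq in auto)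
  moreover have "eventually (\<lambda>s::real. s > 1) (at_right 1)" by (simp add: eventually_at_right_less)
  ultimately have "eventually (\<lambda>s. s > 1 \<and> f (of_real s * cis a) \<in> ball (f (cis a)) r \<and> f (of_real s * cis b) \<in> ball (f (cis a)) r) (at_right 1)"
    by eventually_elim auto
  then obtain s :: real where s: "s > 1" "f (of_real s * cis a) \<in> ball (f (cis a)) r" "f (of_real s * cis b) \<in> ball (f (cis a)) r"
    by (metis (mono_tags, lifting) eventually_happens' trivial_limit_at_right_real)
  have ns: "norm (of_real s * cis a) > 1" "norm (of_real s * cis b) > 1" using s by (simp_all add: norm_mult)
  \<comment> \<open>Pushed outward by the same factor, the two points still have equal
    \<open>n\<close>-th powers, so \<open>p\<close> agrees at their images. Both images lie where
    \<open>p\<close> is injective, and \<open>f\<close> is injective outside the circle.\<close>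
  have "(of_real s * cis a) ^ n = (of_real s * cis b) ^ n" by (simp add: power_mult_distrib cn)
  then have "poly p (f (of_real s * cis a)) = poly p (f (of_real s * cis b))"
    using ns by (simp only: pf less_imp_le power_inverse)
  then have "f (of_real s * cis a) = f (of_real s * cis b)" using r(2) s by (auto dest: inj_onD)
  then have "of_real s * cis a = of_real s * cis b"
    using bij ns by (auto simp: bij_betw_def dest: inj_onD)
  then show ?thesis using s by simp
qed

text \<open>Since \<open>p y\<close> determines \<open>cis a\<close> only up to conjugation, the
  side is selected by approaching \<open>cos a\<close> along the Joukowski images of
  \<open>r k * cis a\<close>. Roots \<open>x k\<close> near \<open>y\<close> are values
  \<open>f (z k)\<close> with \<open>z k ^ n = r k * cis a\<close>, and a limit of a subsequence of
  the \<open>z k\<close> is the boundary point.\<close>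

lemma boundary_point:
  fixes a :: real
  assumes y: "poly p y = of_real (cos a)"
  obtains t :: real where "f (cis t) = y" "cis (n * t) = cis a"
proof -
  define r where "r k = 1 + inverse (real (Suc k))" for k
  have r1: "r k > 1" for k by (simp add: r_def)
  have rlim: "r \<longlonglongrightarrow> 1"
    using tendsto_add[OF tendsto_const[of 1] LIMSEQ_inverse_real_of_nat] by (simp add: r_def[abs_def])
  define u where "u k = of_real (r k) * cis a" for k
  define w where "w k = (u k + inverse (u k)) / 2" for k
  have nu: "norm (u k) = r k" for k using r1[of k] by (simp add: u_def norm_mult)
  have ulim: "u \<longlonglongrightarrow> cis a" unfolding u_def using tendsto_mult[OF tendsto_of_real[OF rlim] tendsto_const] by simp
  have "w \<longlonglongrightarrow> (cis a + inverse (cis a)) / 2" unfolding w_def by (intro tendsto_intros ulim) auto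
  moreover have "(cis a + inverse (cis a)) / 2 = poly p y" by (simp add: y complex_eq_iff)
  ultimately have wlim: "w \<longlonglongrightarrow> poly p y" by simp
  have "\<exists>x. poly p x = w k \<and> norm (lead_coeff p) * norm (y - x) ^ n \<le> norm (poly p y - w k)" for k
    using poly_root_near[OF deg] by metis
  then obtain x where x: "\<And>k. poly p (x k) = w k" "\<And>k. norm (lead_coeff p) * norm (y - x k) ^ n \<le> norm (poly p y - w k)"
    by metis
  have xlim: "x \<longlonglongrightarrow> y"
  proof (rule LIMSEQ_I)
    fix e :: real assume e: "e > 0"
    have l: "norm (lead_coeff p) > 0" using deg by auto
    then have "norm (lead_coeff p) * e ^ n > 0" using e by simp
    then obtain N where N: "\<And>k. k \<ge> N \<Longrightarrow> norm (w k - poly p y) < norm (lead_coeff p) * e ^ n"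
      using wlim LIMSEQ_iff by metis
    have "norm (x k - y) < e" if "k \<ge> N" for k
    proof -
      have "norm (lead_coeff p) * norm (y - x k) ^ n < norm (lead_coeff p) * e ^ n"
        using x(2)[of k] N[OF that] by (simp add: norm_minus_commute)
      then have "norm (y - x k) ^ n < e ^ n" using l by (simp add: mult_less_cancel_left_pos)
      then show ?thesis using e by (metis norm_minus_commute less_imp_le power_less_imp_less_base)
    qed
    then show "\<exists>N. \<forall>k\<ge>N. norm (x k - y) < e" by blast
  qed
  have "\<exists>z. norm z > 1 \<and> f z = x k \<and> z ^ n = u k" for k
  proof -
    have notseg: "w k \<notin> seg"
    proof -
      define c where "c = of_real (ln (r k)) + \<i> * of_real a"
      have "exp c = u k" using r1[of k] by (simp add: c_def u_def exp_add exp_of_real cis_conv_exp)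
      then have "w k = cosh c" by (simp add: w_def cosh_field_def exp_minus)
      moreover have "Re c \<noteq> 0" using r1[of k] by (simp add: c_def)
      ultimately show ?thesis using cosh_in_seg by metis
    qed
    then have "x k \<in> f ` {z. 1 < norm z}" using bij x(1) by (auto simp: bij_betw_def)
    then obtain z where z: "norm z > 1" "f z = x k" by auto
    have "(z ^ n + inverse (z ^ n)) / 2 = (u k + inverse (u k)) / 2"
      using pf[of z] z x(1)[of k] by (simp add: w_def power_inverse)
    then have "z ^ n + inverse (z ^ n) = u k + inverse (u k)" by (metis divide_cancel_right zero_neq_numeral)
    moreover have "norm (z ^ n) > 1" using z(1) deg by (simp add: norm_power one_less_power)
    moreover have "norm (u k) > 1" using nu r1 by simp
    ultimately have "z ^ n = u k" by (rule joukowski_inj)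
    then show ?thesis using z by blast
  qed
  then obtain z where z: "\<And>k. norm (z k) > 1" "\<And>k. f (z k) = x k" "\<And>k. z k ^ n = u k" by metis
  have zb: "norm (z k) \<le> 2" for k
  proof -
    have "norm (z k) \<le> norm (z k) ^ n" using z(1)[of k] deg by (intro self_le_power) auto
    also have "\<dots> = r k" using z(3)[of k] nu by (metis norm_power)
    also have "r k \<le> 2" by (simp add: r_def field_simps)
    finally show ?thesis .
  qed
  have "compact (cball 0 2 \<inter> {z::complex. 1 \<le> norm z})"
    by (intro compact_Int_closed compact_cball closed_Collect_le continuous_intros)
  moreover have "\<forall>k. z k \<in> cball 0 2 \<inter> {z. 1 \<le> norm z}" using z(1) zb by (auto simp: less_imp_le)
  ultimately obtain zz \<sigma> where zz: "zz \<in> cball 0 2 \<inter> {z. 1 \<le> norm z}" "strict_mono \<sigma>" "(z \<circ> \<sigma>) \<longlonglongrightarrow> zz"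
    unfolding compact_def by metis
  have "(\<lambda>k. z (\<sigma> k) ^ n) \<longlonglongrightarrow> zz ^ n" using zz(3) by (intro tendsto_power) (simp add: o_def)
  moreover have "(\<lambda>k. z (\<sigma> k) ^ n) \<longlonglongrightarrow> cis a"
    using LIMSEQ_subseq_LIMSEQ[OF ulim zz(2)] by (simp add: z(3) o_def)
  ultimately have zn: "zz ^ n = cis a" using LIMSEQ_unique by blast
  then have "norm zz ^ n = 1" by (metis norm_power norm_cis)
  then have "norm zz = 1" using deg by (metis power_eq_1_iff less_numeral_extra(3) real_norm_def abs_norm_cancel)
  then obtain t where t: "zz = cis t" by (metis complex_norm_eq_1_exp cis_conv_exp)
  have "(\<lambda>k. f ((z \<circ> \<sigma>) k)) \<longlonglongrightarrow> f zz"
    by (rule continuous_on_tendsto_compose[OF cont zz(3)]) (use zz z(1) in \<open>auto simp: less_imp_le\<close>)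
  moreover have "(\<lambda>k. f ((z \<circ> \<sigma>) k)) = x \<circ> \<sigma>" by (auto simp: z(2))
  moreover have "(x \<circ> \<sigma>) \<longlonglongrightarrow> y" using xlim zz(2) by (rule LIMSEQ_subseq_LIMSEQ)
  ultimately have "f zz = y" using LIMSEQ_unique by metis
  moreover have "cis (n * t) = cis a" using zn t by (simp only: Complex.DeMoivre)
  ultimately show ?thesis using that[of t] t by simp
qed

text \<open>The angles run from \<open>2 pi j / n\<close> to \<open>pi (2 j + 1) / n\<close>,
  through the even arcs, where \<open>sin (n * angle)\<close> is nonnegative; \<open>p\<close> falls
  from \<open>1\<close> to \<open>-1\<close>. Each edge of the tree is thus parametrised once, from
  one of its two sides.\<close>

definition edge :: "nat \<Rightarrow> real \<Rightarrow> complex" where "edge j t = f (cis (pi * (2 * real j + t) / n))"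

lemma poly_edge: "poly p (edge j t) = of_real (cos (pi * t))"
proof -
  have "real n * (pi * (2 * real j + t) / n) = pi * t + 2 * real j * pi" using n_pos by (simp add: field_simps)
  then have "cos (real n * (pi * (2 * real j + t) / n)) = cos (pi * t)" by (simp only: cos_add) simp
  then show ?thesis unfolding edge_def pf_cis by (simp only:)
qed

lemma edge_eqD:
  assumes "edge i s = edge j t" "0 \<le> s" "s \<le> 1" "0 \<le> t" "t \<le> 1" shows "s = t"
proof -
  have "cos (pi * s) = cos (pi * t)" using poly_edge assms(1) by (metis of_real_eq_iff)
  moreover have "pi * s \<le> pi" "pi * t \<le> pi"
    using assms mult_left_mono[of s 1 pi] mult_left_mono[of t 1 pi] by simp_all
  ultimately have "pi * s = pi * t" using assms by (rule_tac cos_inj_pi) simp_all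
  then show ?thesis by simp
qed

text \<open>In the interior of the even arcs \<open>sin (n * angle)\<close> is positive, so
  \<open>same_side\<close> applies.\<close>

lemma edge_interior_inj:
  assumes "edge i s = edge j t" "0 < s" "s < 1" "0 < t" "t < 1" "i < n" "j < n" shows "i = j"
proof -
  have st: "s = t" using edge_eqD[of i s j t] assms by simp
  have *: "sin (real n * (pi * (2 * real i + t) / n)) > 0" for i
  proof -
    have "real n * (pi * (2 * real i + t) / n) = pi * t + 2 * real i * pi" using n_pos by (simp add: field_simps)
    then have "sin (real n * (pi * (2 * real i + t) / n)) = sin (pi * t)" by (simp only: sin_add) simp
    moreover have "sin (pi * t) > 0" using assms by (intro sin_gt_zero) auto
    ultimately show ?thesis by simp
  qed
  have "cis (pi * (2 * real i + t) / n) = cis (pi * (2 * real j + t) / n)"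
    using assms(1) unfolding st edge_def by (rule same_side) (intro mult_pos_pos *)
  then obtain m :: int where m: "pi * (2 * real i + t) / n = pi * (2 * real j + t) / n + 2 * pi * m"
    unfolding cis_eq_cis by blast
  then have "pi * (2 * real i + t) = pi * (2 * real j + t + 2 * n * m)" using n_pos by (simp add: field_simps)
  then have "real i = real j + n * m" by simp
  then have "int i = int j + n * m" by (metis of_int_add of_int_of_nat_eq of_int_eq_iff)
  then have "int i mod n = int j mod n" by simp
  then show ?thesis using assms by simp
qed

lemma arc_edge: "arc (edge j)"
proof -
  have "continuous_on {0..1} (edge j)" unfolding edge_def
    by (rule continuous_on_compose2[OF cont]) (use n_pos in \<open>auto intro!: continuous_intros\<close>)
  moreover have "inj_on (edge j) {0..1}" by (rule inj_onI) (metis edge_eqD atLeastAtMost_iff)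
  ultimately show ?thesis by (simp add: arc_def path_def)
qed

definition edges where "edges = edge ` {..<n}"

lemma inj_edge: "inj_on edge {..<n}"
proof (rule inj_onI)
  fix i j assume "i \<in> {..<n}" "j \<in> {..<n}" "edge i = edge j"
  then show "i = j" using edge_interior_inj[of i "1/2" j "1/2"] by simp
qed

lemma card_edges: "card edges = n" unfolding edges_def by (simp add: card_image inj_edge)

lemma seg_cos:
  assumes "w \<in> seg" obtains a where "0 \<le> a" "a \<le> pi" "w = of_real (cos a)"
  using assms unfolding seg_def by (metis (no_types, lifting) arccos_lbound arccos_ubound cos_arccos atLeastAtMost_iff imageE)

lemma f_sphere: "f ` sphere 0 1 = poly p -` seg"
proof (intro equalityI subsetI)
  fix y assume "y \<in> f ` sphere 0 1"
  then obtain z where "norm z = 1" "y = f z" by auto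
  then obtain t where "y = f (cis t)" by (metis complex_norm_eq_1_exp cis_conv_exp)
  then show "y \<in> poly p -` seg" using pf_cis by (auto simp: seg_def)
next
  fix y assume "y \<in> poly p -` seg"
  then obtain a where "poly p y = of_real (cos a)" by (metis seg_cos vimageD)
  then obtain t where "f (cis t) = y" by (rule boundary_point)
  then show "y \<in> f ` sphere 0 1" by force
qed

text \<open>The point given by \<open>boundary_point\<close> has
  \<open>t = pi (2 m + a / pi) / n\<close> for an integer \<open>m\<close>; reducing
  \<open>m\<close> modulo \<open>n\<close> changes the angle by full turns.\<close>

lemma edge_hits:
  assumes "poly p y = of_real (cos a)"
  obtains j where "j < n" "edge j (a / pi) = y"
proof -
  obtain t :: real where t: "f (cis t) = y" "cis (n * t) = cis a" using boundary_point[OF assms] .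
  then obtain m :: int where m: "n * t = a + 2 * pi * m" unfolding cis_eq_cis by blast
  define j where "j = nat (m mod int n)"
  have j: "j < n" "int j = m mod int n" using deg by (auto simp: j_def nat_less_iff)
  have "m = m div int n * int n + int j" by (simp add: j)
  then have "real_of_int m = real_of_int (m div int n) * n + j" by (metis of_int_add of_int_mult of_int_of_nat_eq)
  then have "n * t = pi * (2 * real j + a / pi) + n * (2 * pi * (m div int n))" unfolding m by (simp add: algebra_simps)
  then have "t = pi * (2 * real j + a / pi) / n + 2 * pi * (m div int n)" using n_pos by (simp add: field_simps)
  then have "cis t = cis (pi * (2 * real j + a / pi) / n)" unfolding cis_eq_cis by blast
  then show ?thesis using that[OF j(1)] t by (simp add: edge_def)
qed

lemma tree_set_edges: "tree_set edges = poly p -` seg"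
proof (intro equalityI subsetI)
  fix y assume "y \<in> tree_set edges"
  then show "y \<in> poly p -` seg" by (auto simp: tree_set_def edges_def path_image_def poly_edge seg_def)
next
  fix y assume "y \<in> poly p -` seg"
  then obtain a where a: "0 \<le> a" "a \<le> pi" "poly p y = of_real (cos a)" by (metis seg_cos vimageD)
  then obtain j where j: "j < n" "edge j (a / pi) = y" using edge_hits by metis
  moreover have "a / pi \<in> {0..1}" using a by simp
  ultimately have "y \<in> path_image (edge j)" unfolding path_image_def by blast
  then show "y \<in> tree_set edges" using j by (auto simp: tree_set_def edges_def)
qed

lemma connected_tree: "connected (tree_set edges)" "connected (- tree_set edges)"
proof -
  have "connected (f ` sphere 0 1)"
    by (rule connected_continuous_image[OF continuous_on_subset[OF cont]]) (auto simp: connected_sphere)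
  then show "connected (tree_set edges)" by (simp add: tree_set_edges f_sphere)
  have "connected {z::complex. 1 < norm z}"
  proof -
    have "{z::complex. 1 < norm z} = - cball 0 1" by auto
    then show ?thesis using connected_complement_bounded_convex[of "cball (0::complex) 1"] by simp
  qed
  then have "connected (f ` {z. 1 < norm z})"
    by (rule connected_continuous_image[OF continuous_on_subset[OF cont], rotated]) auto
  then show "connected (- tree_set edges)" using bij by (simp add: tree_set_edges bij_betw_def)
qed

text \<open>Two edges with both ends in common would form a Jordan curve inside the tree. The
  connected complement of the tree would then meet both sides of it: the outside because the tree is
  bounded, the inside by \<open>dense_complement\<close>.\<close>

lemma no_double_edge:
  assumes "i < n" "j < n" "i \<noteq> j" "edge i 0 = edge j 0" shows "edge i 1 \<noteq> edge j 1"
proof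
  assume 1: "edge i 1 = edge j 1"
  define c where "c = edge i +++ reversepath (edge j)"
  have ps: "pathstart (edge i) = pathstart (edge j)" "pathfinish (edge i) = pathfinish (edge j)"
    using assms 1 by (simp_all add: pathstart_def pathfinish_def)
  have pim: "path_image c = path_image (edge i) \<union> path_image (edge j)"
    unfolding c_def using ps by (simp add: path_image_join)
  have sc: "simple_path c" unfolding c_def
  proof (rule simple_path_join_loop)
    show "path_image (edge i) \<inter> path_image (reversepath (edge j)) \<subseteq> {pathstart (edge i), pathstart (reversepath (edge j))}"
    proof
      fix y assume "y \<in> path_image (edge i) \<inter> path_image (reversepath (edge j))"
      then have "y \<in> path_image (edge i)" "y \<in> path_image (edge j)" by simp_all
      moreover obtain s where "y = edge i s" "0 \<le> s" "s \<le> 1"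
        using calculation(1) by (auto simp: path_image_def)
      moreover obtain t where "y = edge j t" "0 \<le> t" "t \<le> 1"
        using calculation(2) by (auto simp: path_image_def)
      ultimately have st: "y = edge i s" "y = edge j t" "0 \<le> s" "s \<le> 1" "0 \<le> t" "t \<le> 1" by auto
      then have "s = t" using edge_eqD by metis
      then have "s = 0 \<or> s = 1" using edge_interior_inj[of i s j t] st assms by force
      then have "y = pathstart (edge i) \<or> y = pathfinish (edge j)"
        using st ps by (auto simp: pathstart_def pathfinish_def)
      then show "y \<in> {pathstart (edge i), pathstart (reversepath (edge j))}" by simp
    qed
  qed (use arc_edge ps in \<open>auto simp: arc_reversepath\<close>)
  have cl: "pathfinish c = pathstart c"
    unfolding c_def using ps by simp
  note J = Jordan_inside_outside[OF sc cl]
  have sub: "path_image c \<subseteq> tree_set edges" unfolding pim using assms by (auto simp: tree_set_def edges_def)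
  have bd: "bounded (tree_set edges)"
    unfolding tree_set_def edges_def using arc_edge by (auto intro!: bounded_UN simp: bounded_path_image arc_imp_path)
  have 2: "inside (path_image c) \<inter> - tree_set edges \<noteq> {}"
  proof -
    obtain y where y: "y \<in> inside (path_image c)" using J by blast
    show ?thesis
    proof (cases "y \<in> tree_set edges")
      case True
      then have "y \<in> f ` sphere 0 1" by (simp add: f_sphere tree_set_edges)
      then obtain z where z: "norm z = 1" "f z = y" by auto
      then obtain w where "w \<in> inside (path_image c)" "poly p w \<notin> seg" using dense_complement J y by metis
      then show ?thesis by (auto simp: tree_set_edges)
    qed (use y in blast)
  qed
  have 3: "outside (path_image c) \<inter> - tree_set edges \<noteq> {}"
  proof
    assume "outside (path_image c) \<inter> - tree_set edges = {}"
    then have "outside (path_image c) \<subseteq> tree_set edges" by blast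
    then show False using J bd bounded_subset by blast
  qed
  have "- tree_set edges \<subseteq> inside (path_image c) \<union> outside (path_image c)"
    using sub by (simp add: inside_Un_outside)
  moreover have "inside (path_image c) \<inter> outside (path_image c) = {}" by (rule inside_Int_outside)
  ultimately show False using connectedD[OF connected_tree(2), of "inside (path_image c)" "outside (path_image c)"] J 2 3 by blast
qed

lemma finite_plane_tree_edges: "finite_plane_tree edges"
proof -
  have "\<forall>g\<in>edges. \<forall>h\<in>edges. g \<noteq> h \<longrightarrow>
        path_image g \<inter> path_image h = {} \<or>
        (\<exists>p. path_image g \<inter> path_image h = {p} \<and>
             p \<in> {pathstart g, pathfinish g} \<and> p \<in> {pathstart h, pathfinish h})"
  proof (intro ballI impI)
    fix g h assume "g \<in> edges" "h \<in> edges" "g \<noteq> h"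
    then obtain i j where ij: "i < n" "j < n" "i \<noteq> j" "g = edge i" "h = edge j" by (auto simp: edges_def)
    \<comment> \<open>Common points are common ends, met at the same parameter. Two different ones
      would be both ends, against \<open>no_double_edge\<close>.\<close>
    have sub: "s = t \<and> (s = 0 \<or> s = 1)" if "edge i s = edge j t" "0 \<le> s" "s \<le> 1" "0 \<le> t" "t \<le> 1" for s t
      using edge_eqD[OF that] edge_interior_inj[of i s j t] that ij by force
    show "path_image g \<inter> path_image h = {} \<or>
        (\<exists>p. path_image g \<inter> path_image h = {p} \<and>
             p \<in> {pathstart g, pathfinish g} \<and> p \<in> {pathstart h, pathfinish h})"
    proof (cases "path_image g \<inter> path_image h = {}")
      case False
      then obtain s t where "edge i s = edge j t" "0 \<le> s" "s \<le> 1" "0 \<le> t" "t \<le> 1"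
        using ij by (auto simp: path_image_def)
      then obtain s where s: "s = 0 \<or> s = 1" "edge i s = edge j s" using sub by metis
      have "path_image g \<inter> path_image h \<subseteq> {edge i s}"
      proof
        fix y assume "y \<in> path_image g \<inter> path_image h"
        then obtain s' t' where "y = edge i s'" "edge i s' = edge j t'" "0 \<le> s'" "s' \<le> 1" "0 \<le> t'" "t' \<le> 1"
          using ij by (auto simp: path_image_def)
        then obtain u where u: "u = 0 \<or> u = 1" "edge i u = edge j u" "y = edge i u" using sub by metis
        then have "u = s" using s no_double_edge[OF ij(1-3)] by metis
        then show "y \<in> {edge i s}" using u by simp
      qed
      moreover have "edge i s \<in> path_image g \<inter> path_image h"
        using s ij unfolding path_image_def by (metis IntI atLeastAtMost_iff imageI order_refl zero_le_one)
      ultimately have "path_image g \<inter> path_image h = {edge i s}" by blast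
      moreover have "edge i s \<in> {pathstart g, pathfinish g}" "edge i s \<in> {pathstart h, pathfinish h}"
        using s ij by (auto simp: pathstart_def pathfinish_def)
      ultimately show ?thesis by blast
    qed simp
  qed
  moreover have "compact (tree_set edges)"
    unfolding tree_set_def edges_def using arc_edge by (auto intro!: compact_UN simp: compact_path_image arc_imp_path)
  ultimately show ?thesis
    unfolding finite_plane_tree_def using connected_tree arc_edge by (auto simp: edges_def)
qed

lemma circ_arc_alt: "circ_arc n k = (\<lambda>t. cis (pi * k / n + t)) ` {0<..<pi / n}"
proof -
  have "{pi * k / n <..< pi * (k + 1) / n} = (\<lambda>t. pi * k / n + t) ` {0<..<pi / n}"
    using shift_interval[of "pi * k / n" "pi / n"] by (simp add: add_divide_distrib algebra_simps)
  then show ?thesis unfolding circ_arc_def by (simp only: image_image)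
qed

lemma even_arc: "f ` circ_arc n (2 * j) = path_image (edge j) - {pathstart (edge j), pathfinish (edge j)}"
proof -
  have "f ` circ_arc n (2 * j) = edge j ` {0<..<1}"
  proof -
    have "(\<lambda>t. (pi / n) * t) ` {0<..<1} = {0<..<pi / n}"
      using n_pos by (intro scale_interval) simp
    then have "f ` circ_arc n (2 * j) = (\<lambda>t. f (cis (pi * real (2 * j) / n + (pi / n) * t))) ` {0<..<1}"
      unfolding circ_arc_alt by (metis (mono_tags, lifting) image_cong image_image)
    moreover have "pi * real (2 * j) / n + (pi / n) * t = pi * (2 * real j + t) / n" for t
      by (simp add: add_divide_distrib algebra_simps)
    ultimately show ?thesis unfolding edge_def by simp
  qed
  also have "\<dots> = path_image (edge j) - {pathstart (edge j), pathfinish (edge j)}"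
  proof -
    have "{0<..<1::real} = {0..1} - {0,1}" by auto
    moreover have "edge j ` ({0..1} - {0,1}) = edge j ` {0..1} - edge j ` {0,1}"
      using arc_edge[of j] by (intro inj_on_image_set_diff[of _ "{0..1}"]) (auto simp: arc_def)
    ultimately show ?thesis by (simp add: path_image_def pathstart_def pathfinish_def)
  qed
  finally show ?thesis .
qed

lemma circ_arc_rev: "circ_arc n k = (\<lambda>t. cis (pi * (real k + 1) / n - t)) ` {0<..<pi / n}"
proof -
  have "(\<lambda>t. pi / n - t) ` {0<..<pi / n} = {0<..<pi / n}" by (rule reflect_interval)
  then have "circ_arc n k = (\<lambda>t. cis (pi * k / n + (pi / n - t))) ` {0<..<pi / n}"
    unfolding circ_arc_alt by (metis (mono_tags, lifting) image_cong image_image)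
  then show ?thesis by (simp add: algebra_simps add_divide_distrib)
qed

lemma cos_arc: fixes t :: real shows "cos (n * (pi * k / n + t)) = (-1) ^ k * cos (n * t)"
  and sin_arc: "sin (n * (pi * k / n + t)) = (-1) ^ k * sin (n * t)"
proof -
  have "n * (pi * k / n + t) = n * t + k * pi" using n_pos by (simp add: field_simps)
  then show "cos (n * (pi * k / n + t)) = (-1) ^ k * cos (n * t)" "sin (n * (pi * k / n + t)) = (-1) ^ k * sin (n * t)"
    by (simp_all add: cos_add sin_add)
qed

text \<open>The edges were defined by the even arcs only. Traversed backwards, an odd arc has the
  same values of \<open>p\<close> as an even one, namely \<open>cos (n t)\<close>. For the even arc
  whose image agrees at the midpoint, unique lifting makes the two paths equal.\<close>

lemma odd_arc:
  assumes "odd k" obtains j where "j < n" "f ` circ_arc n k = f ` circ_arc n (2 * j)"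
proof -
  define I where "I = {0<..<pi / n}"
  define a where "a t = f (cis (pi * (real k + 1) / n - t))" for t :: real
  define t0 :: real where "t0 = pi / (2 * n)"
  have t0: "t0 \<in> I" using n_pos by (simp add: t0_def I_def field_simps)
  have pa: "poly p (a t) = of_real (cos (n * t))" for t :: real
  proof -
    have "real n * (pi * (real k + 1) / n - t) = real (Suc k) * pi + - (n * t)"
      using n_pos by (simp add: field_simps)
    then have "cos (real n * (pi * (real k + 1) / n - t)) = cos (n * t)"
      using assms by (simp only: cos_add cos_npi sin_npi) simp
    then show ?thesis unfolding a_def pf_cis by (simp only:)
  qed
  obtain j where j: "j < n" "edge j ((n * t0) / pi) = a t0" using edge_hits[OF pa[of t0]] .
  define b where "b t = edge j (n * t / pi)" for t :: real
  have pb: "poly p (b t) = of_real (cos (n * t))" for t :: real unfolding b_def poly_edge by simp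
  \<comment> \<open>These paths run inside \<open>seg\<close>, so the covering needed is the one off
    the critical values alone.\<close>
  have cov: "covering_space (- (poly p -` {1, -1})) (poly p) (- {1, -1})"
    by (rule poly_covering[OF deg]) (use crit in auto)
  have cosI: "complex_of_real (cos (n * t)) \<notin> {1, -1}" if "t \<in> I" for t :: real
  proof -
    have "0 < n * t" "n * t < pi" using that n_pos by (auto simp: I_def field_simps)
    then have "sin (n * t) > 0" by (intro sin_gt_zero)
    then have "(cos (n * t))\<^sup>2 \<noteq> 1" by (simp add: cos_squared_eq)
    then have "cos (n * t) \<noteq> 1" "cos (n * t) \<noteq> -1" by auto
    then have "complex_of_real (cos (n * t)) \<noteq> of_real 1" "complex_of_real (cos (n * t)) \<noteq> of_real (-1)"
      unfolding of_real_eq_iff by auto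
    then show ?thesis by simp
  qed
  have "a t = b t" if "t \<in> I" for t :: real
  proof (rule covering_space_lift_unique[OF cov, of a t0 b I "\<lambda>t. of_real (cos (n * t))" t])
    show "continuous_on I a" unfolding a_def
      by (rule continuous_on_compose2[OF cont]) (auto intro!: continuous_intros)
    show "continuous_on I b" unfolding b_def edge_def
      by (rule continuous_on_compose2[OF cont]) (use n_pos in \<open>auto intro!: continuous_intros\<close>)
    show "a t0 = b t0" using j by (simp add: b_def)
    show "a \<in> I \<rightarrow> - (poly p -` {1, -1})" "b \<in> I \<rightarrow> - (poly p -` {1, -1})"
      using cosI by (auto simp: pa pb)
    show "connected I" by (simp add: I_def)
  qed (use that t0 cosI in \<open>auto simp: pa pb intro!: continuous_intros\<close>)
  then have "f ` circ_arc n k = b ` I"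
    unfolding circ_arc_rev I_def[symmetric] image_image by (intro image_cong) (auto simp: a_def)
  also have "\<dots> = f ` circ_arc n (2 * j)"
  proof -
    have "b t = f (cis (pi * real (2 * j) / n + t))" for t :: real
    proof -
      have "pi * (2 * real j + n * t / pi) / n = pi * real (2 * j) / n + t" using n_pos by (simp add: field_simps)
      then show ?thesis unfolding b_def edge_def by (simp only:)
    qed
    then show ?thesis unfolding circ_arc_alt I_def by (simp add: image_image)
  qed
  finally show ?thesis using that j by blast
qed

lemma arc_image_edge: assumes "k < 2 * n" shows "f ` circ_arc n k \<in> tree_edges edges"
proof -
  have "f ` circ_arc n (2 * j) \<in> tree_edges edges" if "j < n" for j
    using that even_arc by (auto simp: tree_edges_def edges_def)
  then show ?thesis using odd_arc assms by (cases "even k") (auto elim!: evenE, metis)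
qed

lemma inj_arc: "inj_on f (circ_arc n k)"
proof (rule inj_onI)
  fix z w assume "z \<in> circ_arc n k" "w \<in> circ_arc n k" and eq: "f z = f w"
  then obtain s t where st: "z = cis (pi * k / n + s)" "w = cis (pi * k / n + t)" "0 < s" "s < pi / n" "0 < t" "t < pi / n"
    unfolding circ_arc_alt by auto
  have "cos (n * (pi * k / n + s)) = cos (n * (pi * k / n + t))" using pf_cis eq st by (metis of_real_eq_iff)
  then have "cos (n * s) = cos (n * t)" unfolding cos_arc by simp
  then have "n * s = n * t" using st n_pos by (rule_tac cos_inj_pi) (simp_all add: field_simps)
  then show "z = w" using n_pos st by simp
qed

text \<open>On arcs of equal parity the sines have equal signs, and \<open>same_side\<close> would
  make the arcs equal. Opposite parity gives \<open>cos (n t) = - cos (n s)\<close>, that is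
  \<open>s = pi / n - t\<close>, the required reflection.\<close>

lemma pairing:
  fixes t :: real
  assumes jk: "j < 2 * n" "k < 2 * n" "j \<noteq> k" "f ` circ_arc n j = f ` circ_arc n k" and t: "0 < t" "t < pi / n"
  shows "f (cis (pi * j / n + t)) = f (cis (pi * (real k + 1) / n - t))"
proof -
  have "f (cis (pi * j / n + t)) \<in> f ` circ_arc n k"
    unfolding jk(4)[symmetric] unfolding circ_arc_alt by (intro imageI) (simp add: t)
  then obtain s where s: "0 < s" "s < pi / n" "f (cis (pi * j / n + t)) = f (cis (pi * k / n + s))"
    unfolding circ_arc_alt by auto
  have "cos (n * (pi * j / n + t)) = cos (n * (pi * k / n + s))" using pf_cis s(3) by (metis of_real_eq_iff)
  then have c: "(-1) ^ j * cos (n * t) = (-1) ^ k * cos (n * s)" unfolding cos_arc .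
  have b: "0 < n * s" "n * s < pi" "0 < n * t" "n * t < pi" using s t n_pos by (auto simp: field_simps)
  have "even j \<longleftrightarrow> odd k"
  proof (rule ccontr)
    assume "\<not> (even j \<longleftrightarrow> odd k)"
    then have par: "(-1::real) ^ j = (-1) ^ k" by (cases "even j"; cases "even k") auto
    then have "cos (n * t) = cos (n * s)" using c by simp
    then have "n * t = n * s" using b by (rule_tac cos_inj_pi) simp_all
    then have ts: "t = s" using n_pos by simp
    have "sin (n * (pi * j / n + t)) * sin (n * (pi * k / n + s)) = ((-1) ^ k * (-1) ^ k) * (sin (n * t) * sin (n * t))"
      unfolding sin_arc par ts by simp
    also have "\<dots> > 0" using sin_gt_zero[OF b(3,4)] by (simp flip: power_mult_distrib)
    finally have "cis (pi * j / n + t) = cis (pi * k / n + s)" using same_side s(3) by blast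
    then obtain m :: int where "pi * j / n + t = pi * k / n + s + 2 * pi * m" unfolding cis_eq_cis by blast
    then have "pi * j = pi * (k + 2 * n * m)" using ts n_pos by (simp add: field_simps)
    then have "real j = real k + 2 * n * m" by simp
    then have "int j = int k + (2 * n) * m"
      by (metis (mono_tags, lifting) of_int_add of_int_of_nat_eq of_int_eq_iff)
    then have "int j mod (2 * n) = int k mod (2 * n)" by simp
    then show False using jk by simp
  qed
  then have "cos (n * t) = - cos (n * s)" using c by (cases "even j"; cases "even k") auto
  also have "\<dots> = cos (pi - n * s)" by simp
  finally have "n * t = pi - n * s" using b by (rule_tac cos_inj_pi) simp_all
  then have "s = pi / n - t" using n_pos by (simp add: field_simps)
  then have "pi * k / n + s = pi * (real k + 1) / n - t" by (simp add: add_divide_distrib algebra_simps)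
  then show ?thesis using s(3) by simp
qed

lemma conformally_balanced_edges: "conformally_balanced edges"
proof -
  have "exterior_riemann_map (tree_set edges) f"
    unfolding exterior_riemann_map_def tree_set_edges using hol bij lim cont by blast
  then show ?thesis
    unfolding conformally_balanced_def Let_def card_edges
    using inj_arc arc_image_edge pairing by (intro exI[of _ f] conjI allI impI) (auto simp: add.commute)
qed

end

theorem shabat_tree:
  assumes "shabat p"
  shows "\<exists>E. finite_plane_tree E \<and> conformally_balanced E \<and> tree_set E = poly p -` seg"
proof -
  interpret shabat p by fact
  obtain g where "shabat_lift p g"
    using lift_exists by (metis assms shabat_lift.intro shabat_lift_axioms.intro)
  then interpret L: shabat_lift p g .
  obtain f where "shabat_map p f"
    using L.riemann_map assms by (metis shabat_map.intro shabat_map_axioms.intro)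
  then interpret M: shabat_map p f .
  show ?thesis using M.finite_plane_tree_edges M.conformally_balanced_edges M.tree_set_edges by blast
qed

subsection \<open>Nonseparating approximations and their exterior maps\<close>

text \<open>Under inversion at \<open>p\<close> the complement of \<open>\<Gamma>\<close>, together
  with infinity, becomes a domain, bounded because \<open>p\<close> is interior. The complement of
  that domain is the image of \<open>\<Gamma> - {p}\<close>, whose connectedness yields simple
  connectivity.\<close>

definition treelike :: "complex \<Rightarrow> complex set \<Rightarrow> bool" where
  "treelike p \<Gamma> \<longleftrightarrow> compact \<Gamma> \<and> p \<in> interior \<Gamma> \<and> connected (\<Gamma> - {p}) \<and> connected (- \<Gamma>)"

lemma treelike_cball: "r > 0 \<Longrightarrow> treelike p (cball p r)"
  unfolding treelike_def
  using connected_complement_bounded_convex[of "cball p r"]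
  by (auto simp: connected_punctured_convex aff_dim_cball)

text \<open>The segment from \<open>x\<close> to its nearest point of \<open>\<Gamma>\<close> meets
  \<open>\<Gamma>\<close> only there, so by Janiszewski's theorem the union does not separate the
  plane. It is no longer than \<open>dist x y\<close>.\<close>

lemma treelike_extend:
  assumes G: "treelike p \<Gamma>" and y: "y \<in> \<Gamma>"
  obtains \<Gamma>' where "treelike p \<Gamma>'" "\<Gamma> \<subseteq> \<Gamma>'" "x \<in> \<Gamma>'" "\<Gamma>' \<subseteq> \<Gamma> \<union> cball x (dist x y)"
proof (cases "x \<in> \<Gamma>")
  case True
  then show ?thesis using that[of \<Gamma>] G by auto
next
  case False
  have cl: "closed \<Gamma>" "\<Gamma> \<noteq> {}" using G y by (auto simp: treelike_def compact_imp_closed)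
  define z where "z = closest_point \<Gamma> x"
  have z: "z \<in> \<Gamma>" "\<And>w. w \<in> \<Gamma> \<Longrightarrow> dist x z \<le> dist x w"
    using closest_point_exists[OF cl, of x] by (auto simp: z_def)
  define S where "S = closed_segment x z"
  have int: "\<Gamma> \<inter> S = {z}"
  proof -
    have "w = z" if "w \<in> \<Gamma>" "w \<in> S" for w
    proof -
      have "dist x z = dist x w + dist w z"
        using that(2) by (simp add: S_def between_mem_segment[symmetric] between)
      then show ?thesis using z(2)[OF that(1)] by simp
    qed
    then show ?thesis using z by (auto simp: S_def)
  qed
  \<comment> \<open>A segment ending at an interior point of \<open>\<Gamma>\<close> would enter
    \<open>\<Gamma>\<close> earlier. Since the segment avoids \<open>p\<close>, it stays attached
    after \<open>p\<close> is removed.\<close>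
  have "z \<noteq> p"
  proof
    assume "z = p"
    then obtain r where r: "r > 0" "ball z r \<subseteq> \<Gamma>" using G mem_interior by (metis treelike_def)
    have "x \<noteq> z" using False z by auto
    have "z \<in> closure (open_segment x z)" using \<open>x \<noteq> z\<close> by simp
    then obtain w where w: "w \<in> open_segment x z" "dist w z < r" using r by (metis closure_approachable)
    then have "w \<in> \<Gamma> \<inter> S" using r segment_open_subset_closed[of x z] by (auto simp: S_def dist_commute)
    then show False using int w by (auto simp: open_segment_def)
  qed
  have "p \<in> \<Gamma>" using G interior_subset unfolding treelike_def by blast
  then have "p \<notin> S" using \<open>z \<noteq> p\<close> int by auto
  define \<Gamma>' where "\<Gamma>' = \<Gamma> \<union> S"
  have "connected (- \<Gamma>')" unfolding \<Gamma>'_def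
  proof (rule Janiszewski_connected)
    show "connected (- S)" using connected_complement_bounded_convex[of S] by (simp add: S_def compact_imp_bounded)
  qed (use G int in \<open>auto simp: treelike_def S_def\<close>)
  moreover have "connected (\<Gamma>' - {p})"
  proof -
    have "\<Gamma>' - {p} = (\<Gamma> - {p}) \<union> S" using \<open>p \<notin> S\<close> by (auto simp: \<Gamma>'_def)
    moreover have "connected ((\<Gamma> - {p}) \<union> S)"
    proof (rule connected_Un)
      show "connected S" by (simp add: S_def)
      have "z \<in> (\<Gamma> - {p}) \<inter> S" using int \<open>z \<noteq> p\<close> by auto
      then show "(\<Gamma> - {p}) \<inter> S \<noteq> {}" by blast
    qed (use G in \<open>simp add: treelike_def\<close>)
    ultimately show ?thesis by simp
  qed
  moreover have "compact \<Gamma>'" using G by (auto simp: treelike_def \<Gamma>'_def S_def)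
  moreover have "p \<in> interior \<Gamma>'" using G interior_mono[of \<Gamma> \<Gamma>'] by (auto simp: treelike_def \<Gamma>'_def)
  ultimately have "treelike p \<Gamma>'" by (simp add: treelike_def)
  moreover have "\<Gamma>' \<subseteq> \<Gamma> \<union> cball x (dist x y)"
  proof -
    have "dist x w \<le> dist x y" if "w \<in> S" for w
      using segment_bound(1)[of w x z] that z(2)[OF y] by (simp add: S_def dist_norm norm_minus_commute)
    then show ?thesis by (auto simp: \<Gamma>'_def)
  qed
  ultimately show ?thesis using that[of \<Gamma>'] by (auto simp: \<Gamma>'_def S_def)
qed

text \<open>Points of a finite net of \<open>K\<close> are attached one by one to a disc. If a
  largest attachable set \<open>S\<close> missed part of the net, connectedness of \<open>K\<close>
  would give a net point outside \<open>S\<close> within \<open>\<delta>\<close> of one in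
  \<open>S\<close>, and what is attached for it stays within \<open>\<delta>\<close> of
  \<open>K\<close>.\<close>

lemma treelike_approx:
  assumes K: "K \<noteq> {}" "compact K" "connected K" and "\<delta> > 0"
  obtains \<Gamma> p where "treelike p \<Gamma>" "\<And>x. x \<in> \<Gamma> \<Longrightarrow> \<exists>k\<in>K. dist x k < \<delta>" "\<And>k. k \<in> K \<Longrightarrow> \<exists>x\<in>\<Gamma>. dist k x < \<delta>"
proof -
  have "K \<subseteq> (\<Union>x\<in>K. ball x (\<delta>/2))" using \<open>\<delta> > 0\<close> by auto
  then obtain N where N: "N \<subseteq> K" "finite N" "K \<subseteq> (\<Union>x\<in>N. ball x (\<delta>/2))"
    using compactE_image[OF K(2), of K "\<lambda>x. ball x (\<delta>/2)"] by auto
  then obtain p where p: "p \<in> N" using K(1) by auto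
  define P where "P S \<longleftrightarrow> S \<subseteq> N \<and> p \<in> S \<and> (\<exists>\<Gamma>. treelike p \<Gamma> \<and> S \<subseteq> \<Gamma> \<and> (\<forall>x\<in>\<Gamma>. \<exists>k\<in>K. dist x k < \<delta>))" for S
  have "P {p}"
  proof -
    have "treelike p (cball p (\<delta>/2))" using \<open>\<delta> > 0\<close> by (simp add: treelike_cball)
    moreover have "\<exists>k\<in>K. dist x k < \<delta>" if "x \<in> cball p (\<delta>/2)" for x
      using that p N(1) \<open>\<delta> > 0\<close> by (intro bexI[of _ p]) (auto simp: dist_commute)
    ultimately show ?thesis unfolding P_def using p \<open>\<delta> > 0\<close>
      by (intro conjI exI[of _ "cball p (\<delta>/2)"]) auto
  qed
  moreover have "\<forall>S. P S \<longrightarrow> card S \<le> card N" using N(2) by (auto simp: P_def intro: card_mono)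
  ultimately obtain S where S: "P S" "\<And>S'. P S' \<Longrightarrow> card S' \<le> card S"
    using ex_has_greatest_nat[of P "{p}" card "Suc (card N)"] by (auto simp: less_Suc_eq_le)
  then obtain \<Gamma> where \<Gamma>: "treelike p \<Gamma>" "S \<subseteq> \<Gamma>" "\<And>x. x \<in> \<Gamma> \<Longrightarrow> \<exists>k\<in>K. dist x k < \<delta>" by (auto simp: P_def)
  have SN: "S \<subseteq> N" "p \<in> S" using S(1) by (auto simp: P_def)
  have "S = N"
  proof (rule ccontr)
    assume "S \<noteq> N"
    then obtain q where q: "q \<in> N" "q \<notin> S" using SN by auto
    define A where "A = (\<Union>x\<in>S. ball x (\<delta>/2))"
    define B where "B = (\<Union>x\<in>N - S. ball x (\<delta>/2))"
    have pA: "p \<in> A" unfolding A_def by (rule UN_I[OF SN(2)]) (simp add: \<open>\<delta> > 0\<close>)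
    have qB: "q \<in> B" unfolding B_def by (rule UN_I[of q]) (use q \<open>\<delta> > 0\<close> in auto)
    have "A \<inter> B \<inter> K \<noteq> {}"
    proof
      assume e: "A \<inter> B \<inter> K = {}"
      have "open A" "open B" by (auto simp: A_def B_def)
      moreover have "K \<subseteq> A \<union> B" using N(3) by (auto simp: A_def B_def)
      ultimately have "A \<inter> K = {} \<or> B \<inter> K = {}" using connectedD[OF K(3)] e by blast
      moreover have "p \<in> A \<inter> K" "q \<in> B \<inter> K" using pA qB p q N(1) by auto
      ultimately show False by blast
    qed
    then obtain u where "u \<in> A" "u \<in> B" by blast
    then obtain y x where u: "y \<in> S" "x \<in> N - S" "dist y u < \<delta>/2" "dist x u < \<delta>/2"
      unfolding A_def B_def UN_iff mem_ball by blast
    then have xy: "dist x y < \<delta>" using dist_triangle2[of x y u] by simp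
    obtain \<Gamma>' where \<Gamma>': "treelike p \<Gamma>'" "\<Gamma> \<subseteq> \<Gamma>'" "x \<in> \<Gamma>'" "\<Gamma>' \<subseteq> \<Gamma> \<union> cball x (dist x y)"
      using treelike_extend[OF \<Gamma>(1)] u(1) \<Gamma>(2) by blast
    have "\<exists>k\<in>K. dist w k < \<delta>" if "w \<in> \<Gamma>'" for w
    proof (cases "w \<in> \<Gamma>")
      case False
      then have "dist w x < \<delta>" using \<Gamma>'(4) that xy by (auto simp: dist_commute)
      then show ?thesis using u N(1) by auto
    qed (use \<Gamma> in auto)
    then have "P (insert x S)" unfolding P_def using \<Gamma>' \<Gamma> SN u by (intro conjI exI[of _ \<Gamma>']) auto
    then have "card (insert x S) \<le> card S" by (rule S(2))
    then show False using u finite_subset[OF SN(1) N(2)] by simp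
  qed
  have "\<exists>x\<in>\<Gamma>. dist k x < \<delta>" if "k \<in> K" for k
  proof -
    obtain x where "x \<in> N" "dist x k < \<delta>/2" using N(3) \<open>k \<in> K\<close> by auto
    then show ?thesis using \<Gamma>(2) \<open>S = N\<close> \<open>\<delta> > 0\<close> by (intro bexI[of _ x]) (auto simp: dist_commute)
  qed
  then show ?thesis using that[OF \<Gamma>(1,3)] by blast
qed

lemma treelike_translate:
  assumes "treelike p \<Gamma>" shows "treelike 0 ((\<lambda>z. z - p) ` \<Gamma>)"
proof -
  have "- ((\<lambda>z. z - p) ` \<Gamma>) = (\<lambda>z. z - p) ` (- \<Gamma>)"
    by (rule bij_image_Compl_eq[symmetric]) (auto simp: bij_def inj_on_def intro!: surjI[of _ "\<lambda>z. z + p"])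
  moreover have "connected ((\<lambda>z. z - p) ` (- \<Gamma>))"
    using assms by (auto simp: treelike_def intro!: connected_continuous_image continuous_intros)
  moreover have "(\<lambda>z. z - p) ` \<Gamma> - {0} = (\<lambda>z. z - p) ` (\<Gamma> - {p})" by auto
  moreover have "connected ((\<lambda>z. z - p) ` (\<Gamma> - {p}))"
    using assms by (auto simp: treelike_def intro!: connected_continuous_image continuous_intros)
  moreover have "compact ((\<lambda>z. z - p) ` \<Gamma>)"
    using assms by (auto simp: treelike_def intro!: compact_continuous_image continuous_intros)
  moreover have "0 \<in> interior ((\<lambda>z. z - p) ` \<Gamma>)"
    using assms interior_translation_subtract[of p \<Gamma>] by (auto simp: treelike_def)
  ultimately show ?thesis by (simp add: treelike_def)
qed

text \<open>\<open>F\<close> is a Riemann map onto the inverted exterior \<open>\<Omega>\<close>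
  with \<open>F 0 = 0\<close>. Writing \<open>F s = s * H s\<close> splits off the zero, and
  \<open>\<Psi> = 1 / H\<close>. So \<open>\<Psi> s / s\<close> is the exterior conformal map in the
  coordinate \<open>s = 1 / w\<close>, with its pole made explicit.\<close>

lemma exterior_map_exists:
  assumes G: "treelike 0 \<Gamma>"
  obtains \<Psi> where "\<Psi> holomorphic_on ball 0 1" "\<And>s. s \<in> ball 0 1 \<Longrightarrow> \<Psi> s \<noteq> 0"
    "bij_betw (\<lambda>s. \<Psi> s / s) (ball 0 1 - {0}) (- \<Gamma>)"
proof -
  define \<Omega> where "\<Omega> = {w. w = 0 \<or> inverse w \<notin> \<Gamma>}"
  have G': "compact \<Gamma>" "0 \<in> interior \<Gamma>" "connected (\<Gamma> - {0})" "connected (- \<Gamma>)" using G by (auto simp: treelike_def)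
  have "0 \<in> \<Gamma>" using G'(2) interior_subset by blast
  obtain B where B: "B > 0" "\<And>z. z \<in> \<Gamma> \<Longrightarrow> norm z \<le> B"
    using compact_imp_bounded[OF G'(1)] bounded_pos by metis
  obtain r where r: "r > 0" "ball 0 r \<subseteq> \<Gamma>" using G'(2) mem_interior by blast
  have ball: "ball 0 (1 / B) \<subseteq> \<Omega>"
  proof
    fix w :: complex assume w: "w \<in> ball 0 (1 / B)"
    show "w \<in> \<Omega>"
    proof (cases "w = 0")
      case False
      then have "norm (inverse w) > B" using w B by (simp add: norm_divide field_simps)
      then have "inverse w \<notin> \<Gamma>" using B(2)[of "inverse w"] by auto
      then show ?thesis by (simp add: \<Omega>_def)
    qed (simp add: \<Omega>_def)
  qed
  have op: "open \<Omega>"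
  proof -
    have "\<Omega> = ball 0 (1 / B) \<union> (- {0} \<inter> inverse -` (- \<Gamma>))" using ball B(1) by (auto simp: \<Omega>_def)
    moreover have "open (- {0} \<inter> inverse -` (- \<Gamma>))"
      using G'(1) by (intro continuous_open_preimage continuous_intros) (auto simp: compact_imp_closed open_Compl)
    ultimately show ?thesis by auto
  qed
  have bd: "bounded \<Omega>"
  proof (rule boundedI)
    fix w assume w: "w \<in> \<Omega>"
    show "norm w \<le> 1 / r"
    proof (cases "w = 0")
      case False
      then have "inverse w \<notin> ball 0 r" using w r by (auto simp: \<Omega>_def)
      then show ?thesis using False r by (simp add: norm_divide field_simps)
    qed (use r in simp)
  qed
  have inv_image: "\<Omega> - {0} = inverse ` (- \<Gamma>)"
    using \<open>0 \<in> \<Gamma>\<close> by (force simp: \<Omega>_def image_iff intro: bexI[of _ "inverse _"])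
  have "connected (\<Omega> - {0})"
    unfolding inv_image using G'(4) \<open>0 \<in> \<Gamma>\<close> by (intro connected_continuous_image continuous_intros) auto
  moreover have "\<Omega> \<subseteq> closure (\<Omega> - {0})"
  proof
    fix w assume "w \<in> \<Omega>"
    moreover have "0 islimpt \<Omega>" using op by (intro interior_limit_point) (auto simp: interior_open \<Omega>_def)
    ultimately show "w \<in> closure (\<Omega> - {0})"
      by (cases "w = 0") (auto simp: closure_def islimpt_punctured[symmetric])
  qed
  ultimately have conn: "connected \<Omega>" using connected_intermediate_closure by (metis Diff_subset)
  have "- \<Omega> = inverse ` (\<Gamma> - {0})"
    by (force simp: \<Omega>_def image_iff intro: bexI[of _ "inverse _"])
  then have "connected (- \<Omega>)"
    using G'(3) by (auto intro!: connected_continuous_image continuous_intros)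
  then have "simply_connected \<Omega>" using simply_connected_iff_simple[OF op bd] conn by simp
  moreover have "\<Omega> \<noteq> {}" "\<Omega> \<noteq> UNIV" using bd not_bounded_UNIV by (auto simp: \<Omega>_def)
  ultimately obtain f g where fg: "f holomorphic_on \<Omega>" "g holomorphic_on ball 0 1"
     "\<And>z. z \<in> \<Omega> \<Longrightarrow> f z \<in> ball 0 1 \<and> g(f z) = z" "\<And>z. z \<in> ball 0 1 \<Longrightarrow> g z \<in> \<Omega> \<and> f(g z) = z"
    using Riemann_mapping_theorem[of \<Omega>] op by metis
  have "0 \<in> \<Omega>" by (simp add: \<Omega>_def)
  then have f0: "f 0 \<in> ball 0 1" using fg by blast
  obtain h k where hk: "h (f 0) = 0" "h holomorphic_on ball 0 1" "h ` ball 0 1 \<subseteq> ball 0 1"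
    "k holomorphic_on ball 0 1" "k ` ball 0 1 \<subseteq> ball 0 1"
    "\<And>z. z \<in> ball 0 1 \<Longrightarrow> h (k z) = z" "\<And>z. z \<in> ball 0 1 \<Longrightarrow> k (h z) = z"
    using ball_biholomorphism_exists[OF f0] by metis
  define F where "F = g \<circ> k"
  have F_hol: "F holomorphic_on ball 0 1"
    unfolding F_def by (rule holomorphic_on_compose_gen[OF hk(4) fg(2) hk(5)])
  have F0: "F 0 = 0" using hk(1,7) f0 fg(3) \<open>0 \<in> \<Omega>\<close> unfolding F_def o_def by metis
  have F_bij: "bij_betw F (ball 0 1) \<Omega>"
  proof (rule bij_betwI[of _ _ _ "h \<circ> f"])
    show "F \<in> ball 0 1 \<rightarrow> \<Omega>" using hk(5) fg(4) by (auto simp: F_def)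
    show "h \<circ> f \<in> \<Omega> \<rightarrow> ball 0 1" using hk(3) fg(3) by fastforce
    show "(h \<circ> f) (F x) = x" if "x \<in> ball 0 1" for x using that hk(5,6) fg(4) by (simp add: F_def image_subset_iff)
    show "F ((h \<circ> f) y) = y" if "y \<in> \<Omega>" for y using that hk(3,7) fg(3) by (simp add: F_def)
  qed
  then have F_inj: "inj_on F (ball 0 1)" by (simp add: bij_betw_def)
  have dF: "deriv F 0 \<noteq> 0" using holomorphic_injective_imp_regular[OF F_hol open_ball F_inj] by simp
  define H where "H s = (if s = 0 then deriv F 0 else (F s - F 0) / (s - 0))" for s
  have H_hol: "H holomorphic_on ball 0 1" unfolding H_def by (rule pole_lemma_open[OF F_hol open_ball])
  have H_nz: "H s \<noteq> 0" if "s \<in> ball 0 1" for s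
  proof (cases "s = 0")
    case False
    then have "F s \<noteq> 0" using F_inj that F0 inj_onD[OF F_inj, of s 0] by auto
    then show ?thesis using False F0 by (simp add: H_def)
  qed (use dF H_def in simp)
  have bij: "bij_betw (\<lambda>s. inverse (F s)) (ball 0 1 - {0}) (- \<Gamma>)"
  proof -
    have "bij_betw F (ball 0 1 - {0}) (\<Omega> - {F 0})"
      using F_bij by (intro bij_betw_DiffI) (use F0 \<open>0 \<in> \<Omega>\<close> in auto)
    moreover have "bij_betw inverse (\<Omega> - {F 0}) (- \<Gamma>)"
      by (rule bij_betwI[of _ _ _ inverse]) (use F0 \<open>0 \<in> \<Gamma>\<close> in \<open>auto simp: \<Omega>_def\<close>)
    ultimately show ?thesis using bij_betw_trans by (fastforce simp: o_def)
  qed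
  show ?thesis
  proof (rule that[of "\<lambda>s. inverse (H s)"])
    show "(\<lambda>s. inverse (H s)) holomorphic_on ball 0 1" using H_nz by (intro holomorphic_intros H_hol) auto
    show "inverse (H s) \<noteq> 0" if "s \<in> ball 0 1" for s using H_nz[OF that] by simp
    show "bij_betw (\<lambda>s. inverse (H s) / s) (ball 0 1 - {0}) (- \<Gamma>)"
      using bij by (rule bij_betw_cong[THEN iffD1, rotated]) (simp add: H_def F0 inverse_eq_divide)
  qed
qed

subsection \<open>Faber polynomials and lemniscates\<close>

text \<open>From \<open>(P - z X) G = U\<close> follows \<open>G = U / P + z X (G / P)\<close>, so
  the coefficient \<open>n\<close> of \<open>G\<close> is a constant plus \<open>z\<close> times a
  combination of earlier ones. For the series of \<open>\<Psi>\<close> and \<open>u\<close> below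
  these are the Faber polynomials.\<close>

lemma fps_quotient_coeff_poly:
  fixes P U :: "complex fps"
  assumes P: "fps_nth P 0 \<noteq> 0"
  shows "\<exists>q. \<forall>z. fps_nth (U * inverse (P - fps_const z * fps_X)) n = poly q z"
proof (induction n rule: less_induct)
  case (less n)
  define G where "G z = U * inverse (P - fps_const z * fps_X)" for z
  have "\<exists>q. \<forall>i<n. \<forall>z. fps_nth (G z) i = poly (q i) z"
    using less by (simp add: G_def) metis
  then obtain q where q: "\<And>i z. i < n \<Longrightarrow> fps_nth (G z) i = poly (q i) z" by blast
  have rec: "G z = U * inverse P + fps_const z * (fps_X * (inverse P * G z))" for z
  proof -
    have "fps_nth (P - fps_const z * fps_X) 0 \<noteq> 0" using P by simp
    then have "(P - fps_const z * fps_X) * inverse (P - fps_const z * fps_X) = 1"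
      by (metis inverse_mult_eq_1')
    then have "(P - fps_const z * fps_X) * G z = U" unfolding G_def by (metis mult.left_commute mult.right_neutral)
    then have "P * G z = U + fps_const z * fps_X * G z" by (simp add: algebra_simps)
    then have "(inverse P * P) * G z = inverse P * (U + fps_const z * fps_X * G z)" by (simp only: mult.assoc)
    moreover have "inverse P * P = 1" using P by (rule inverse_mult_eq_1)
    ultimately have "G z = inverse P * (U + fps_const z * fps_X * G z)" by simp
    also have "\<dots> = U * inverse P + fps_const z * (fps_X * (inverse P * G z))" by (simp only: distrib_left mult_ac)
    finally show ?thesis .
  qed
  show ?case
  proof (cases n)
    case 0
    have "fps_nth (G z) n = poly [:fps_nth (U * inverse P) 0:] z" for z
      by (subst rec) (simp add: 0)
    then show ?thesis unfolding G_def by blast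
  next
    case (Suc m)
    define q' where "q' = [:fps_nth (U * inverse P) n:] + [:0, 1:] * (\<Sum>i=0..m. smult (fps_nth (inverse P) i) (q (m - i)))"
    have "fps_nth (G z) n = poly q' z" for z
    proof -
      have "fps_nth (G z) n = fps_nth (U * inverse P) n + z * fps_nth (inverse P * G z) m"
        by (subst rec) (simp add: Suc del: fps_mult_nth)
      also have "fps_nth (inverse P * G z) m = (\<Sum>i=0..m. fps_nth (inverse P) i * poly (q (m - i)) z)"
        unfolding fps_mult_nth by (intro sum.cong refl) (simp add: q Suc)
      finally show ?thesis by (simp add: q'_def poly_sum)
    qed
    then show ?thesis unfolding G_def by blast
  qed
qed

definition coef :: "(complex \<Rightarrow> complex) \<Rightarrow> nat \<Rightarrow> complex" where
  "coef f n = (deriv ^^ n) f 0 / fact n"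

lemma coef_fps: "f has_fps_expansion F \<Longrightarrow> coef f n = fps_nth F n"
  by (simp add: coef_def fps_nth_fps_expansion)

lemma holomorphic_expansion:
  assumes "f holomorphic_on ball 0 r" "r > 0" shows "f has_fps_expansion Abs_fps (coef f)"
proof -
  have "f analytic_on {0}" using assms by (auto simp: analytic_at intro!: exI[of _ "ball 0 r"])
  then obtain F where F: "f has_fps_expansion F"
    using analytic_at_imp_has_fps_expansion_0 by blast
  then have "F = Abs_fps (coef f)" by (simp add: fps_eq_iff coef_fps)
  then show ?thesis using F by simp
qed

lemma coef_bound:
  assumes "f holomorphic_on ball 0 R" "0 < r" "r < R" "\<And>s. norm s = r \<Longrightarrow> norm (f s) \<le> B"
  shows "norm (coef f n) \<le> B / r ^ n"
proof -
  have "norm ((deriv ^^ n) f 0) \<le> fact n * B / r ^ n"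
  proof (rule Cauchy_inequality)
    show "f holomorphic_on ball 0 r" using assms by (auto elim!: holomorphic_on_subset)
    show "continuous_on (cball 0 r) f" using assms
      by (auto intro!: holomorphic_on_imp_continuous_on elim!: holomorphic_on_subset)
  qed (use assms in auto)
  then show ?thesis by (simp add: coef_def norm_divide field_simps)
qed

lemma coef_geometric:
  assumes "w \<noteq> 0" shows "coef (\<lambda>s. 1 / (1 - s / w)) n = 1 / w ^ n"
proof -
  have "(\<lambda>s. inverse (1 - inverse w * s)) has_fps_expansion inverse (1 - fps_const (inverse w) * fps_X)"
    by (intro fps_expansion_intros) simp
  then have "coef (\<lambda>s. inverse (1 - inverse w * s)) n = fps_nth (inverse (1 - fps_const (inverse w) * fps_X)) n"
    by (rule coef_fps)
  also have "inverse (1 - fps_const (inverse w) * fps_X) = Abs_fps (\<lambda>n. inverse w ^ n)"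
  proof (rule fps_inverse_unique)
    show "(1 - fps_const (inverse w) * fps_X) * Abs_fps (\<lambda>n. inverse w ^ n) = 1"
    proof (rule fps_ext)
      fix n
      show "fps_nth ((1 - fps_const (inverse w) * fps_X) * Abs_fps (\<lambda>n. inverse w ^ n)) n = fps_nth 1 n"
        by (cases n) (simp_all add: left_diff_distrib mult.assoc)
    qed
  qed
  finally show ?thesis by (simp add: field_simps power_inverse)
qed

lemma coef_diff:
  assumes "f holomorphic_on ball 0 r" "g holomorphic_on ball 0 r" "r > 0"
    "\<And>s. s \<in> ball 0 r \<Longrightarrow> h s = f s - g s"
  shows "coef h n = coef f n - coef g n"
proof -
  have "h holomorphic_on ball 0 r" using assms(4)
    by (intro holomorphic_transform[OF holomorphic_on_diff[OF assms(1,2)]]) auto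
  have "(\<lambda>s. f s - g s) has_fps_expansion Abs_fps (coef f) - Abs_fps (coef g)"
    by (intro has_fps_expansion_diff holomorphic_expansion[of _ r] assms)
  moreover have "eventually (\<lambda>s. f s - g s = h s) (nhds 0)"
    using assms by (intro eventually_nhds_in_open[THEN eventually_mono, of "ball 0 r"]) auto
  ultimately have "h has_fps_expansion Abs_fps (coef f) - Abs_fps (coef g)"
    by (metis has_fps_expansion_cong)
  then show ?thesis by (simp add: coef_fps)
qed

locale exterior_map =
  fixes \<Gamma> :: "complex set" and \<Psi> :: "complex \<Rightarrow> complex"
  assumes hol: "\<Psi> holomorphic_on ball 0 1" and nz: "\<And>s. s \<in> ball 0 1 \<Longrightarrow> \<Psi> s \<noteq> 0"
    and bij: "bij_betw (\<lambda>s. \<Psi> s / s) (ball 0 1 - {0}) (- \<Gamma>)" and zero: "0 \<in> \<Gamma>"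
begin

text \<open>With \<open>\<phi> s = \<Psi> s / s\<close> this is \<open>- s^2 \<phi>' s\<close>, so
  \<open>u s / (\<Psi> s - z * s)\<close> equals \<open>- s \<phi>' s / (\<phi> s - z)\<close>, the
  generating function of the Faber polynomials at \<open>z\<close>.\<close>

definition u where "u s = \<Psi> s - s * deriv \<Psi> s"
text \<open>The reciprocal of the exterior map, which is holomorphic and injective across
  \<open>s = 0\<close> as well.\<close>

definition \<theta> where "\<theta> s = s / \<Psi> s"

lemma u_hol: "u holomorphic_on ball 0 1"
  unfolding u_def by (intro holomorphic_intros hol) auto

lemma \<theta>_hol: "\<theta> holomorphic_on ball 0 1"
  unfolding \<theta>_def using nz by (intro holomorphic_intros hol) auto

lemma \<theta>_inj: "inj_on \<theta> (ball 0 1)"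
proof (rule inj_onI)
  fix s t assume st: "s \<in> ball 0 1" "t \<in> ball 0 1" "\<theta> s = \<theta> t"
  show "s = t"
  proof (cases "s = 0 \<or> t = 0")
    case True
    then show ?thesis using st nz by (auto simp: \<theta>_def)
  next
    case False
    then have "\<Psi> s / s = \<Psi> t / t" using st(3) unfolding \<theta>_def by (metis inverse_divide)
    then show ?thesis using bij st False by (auto simp: bij_betw_def dest: inj_onD)
  qed
qed

text \<open>\<open>u / \<Psi>^2\<close> is the derivative of the injective function
  \<open>\<theta>\<close>.\<close>

lemma u_nz: assumes "s \<in> ball 0 1" shows "u s \<noteq> 0"
proof -
  have "deriv \<theta> s \<noteq> 0" using holomorphic_injective_imp_regular[OF \<theta>_hol open_ball \<theta>_inj assms] .
  moreover have "(\<theta> has_field_derivative u s / (\<Psi> s)\<^sup>2) (at s)"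
    unfolding \<theta>_def u_def using nz[OF assms] holomorphic_derivI[OF hol open_ball assms]
    by (auto intro!: derivative_eq_intros simp: power2_eq_square)
  ultimately show ?thesis by (auto dest: DERIV_imp_deriv)
qed

text \<open>The points not reached by \<open>s \<mapsto> \<Psi> s / s\<close> on \<open>0 < |s| < r\<close>: a neighbourhood of \<open>\<Gamma>\<close> shrinking to it as \<open>r \<rightarrow> 1\<close>.\<close>

definition X where "X r = - (\<lambda>s. \<Psi> s / s) ` (ball 0 r - {0})"

lemma X_alt: "r \<le> 1 \<Longrightarrow> X r = {z. z = 0 \<or> inverse z \<notin> \<theta> ` ball 0 r}"
proof -
  assume r: "r \<le> 1"
  have "z \<in> (\<lambda>s. \<Psi> s / s) ` (ball 0 r - {0}) \<longleftrightarrow> z \<noteq> 0 \<and> inverse z \<in> \<theta> ` ball 0 r" for z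
  proof
    assume "z \<in> (\<lambda>s. \<Psi> s / s) ` (ball 0 r - {0})"
    then obtain s where "s \<in> ball 0 r - {0}" and zs: "z = \<Psi> s / s" by (rule imageE)
    then have s: "s \<in> ball 0 r" "s \<noteq> 0" "z = \<Psi> s / s" by auto
    then have "z \<noteq> 0" using nz r by auto
    moreover have "inverse z = \<theta> s" using s by (simp add: \<theta>_def)
    ultimately show "z \<noteq> 0 \<and> inverse z \<in> \<theta> ` ball 0 r" using s by blast
  next
    assume "z \<noteq> 0 \<and> inverse z \<in> \<theta> ` ball 0 r"
    then obtain s where s: "z \<noteq> 0" "s \<in> ball 0 r" "inverse z = \<theta> s" by auto
    then have "z = \<Psi> s / s" unfolding \<theta>_def by (metis inverse_divide inverse_inverse_eq)
    moreover have "s \<noteq> 0" using s by (auto simp: \<theta>_def)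
    ultimately show "z \<in> (\<lambda>s. \<Psi> s / s) ` (ball 0 r - {0})" using s by blast
  qed
  then show ?thesis by (auto simp: X_def)
qed

lemma \<Gamma>_X: "r \<le> 1 \<Longrightarrow> \<Gamma> \<subseteq> X r"
proof -
  assume "r \<le> 1"
  then have "(\<lambda>s. \<Psi> s / s) ` (ball 0 r - {0}) \<subseteq> (\<lambda>s. \<Psi> s / s) ` (ball 0 1 - {0})" by (intro image_mono) auto
  then show ?thesis using bij by (auto simp: X_def bij_betw_def)
qed

lemma open_image: "r \<le> 1 \<Longrightarrow> open ((\<lambda>s. \<Psi> s / s) ` (ball 0 r - {0}))"
proof (rule open_mapping_thm3)
  assume r: "r \<le> 1"
  then have sub: "ball 0 r \<subseteq> (ball 0 1 :: complex set)" by auto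
  show "(\<lambda>s. \<Psi> s / s) holomorphic_on ball 0 r - {0}"
    using sub by (intro holomorphic_intros holomorphic_on_subset[OF hol]) auto
  show "open (ball 0 r - {0::complex})" by (intro open_Diff) auto
  show "inj_on (\<lambda>s. \<Psi> s / s) (ball 0 r - {0})"
    using bij sub by (auto simp: bij_betw_def elim!: inj_on_subset)
qed

text \<open>For boundedness: \<open>\<theta>\<close> is an open map, so the image of the punctured
  disc contains a neighbourhood of infinity.\<close>

lemma X_compact: assumes "0 < r" "r \<le> 1" shows "compact (X r)"
proof -
  have "closed (X r)" using open_image[OF assms(2)] by (simp add: X_def closed_def)
  moreover have "bounded (X r)"
  proof -
    have sub: "ball 0 r \<subseteq> (ball 0 1 :: complex set)" using assms by auto
    have "open (\<theta> ` ball 0 r)"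
      by (rule open_mapping_thm3[OF holomorphic_on_subset[OF \<theta>_hol sub] open_ball inj_on_subset[OF \<theta>_inj sub]])
    moreover have "0 \<in> \<theta> ` ball 0 r" using assms by (auto simp: \<theta>_def image_iff intro!: bexI[of _ 0])
    ultimately obtain e where e: "e > 0" "ball 0 e \<subseteq> \<theta> ` ball 0 r" by (meson open_contains_ball)
    show ?thesis
    proof (rule boundedI)
      fix z assume z: "z \<in> X r"
      show "norm z \<le> 1 / e"
      proof (cases "z = 0")
        case False
        then have "inverse z \<notin> ball 0 e" using z e assms by (auto simp: X_alt)
        then show ?thesis using False e by (simp add: norm_divide field_simps)
      qed (use e in simp)
    qed
  qed
  ultimately show ?thesis by (simp add: compact_eq_bounded_closed)
qed

lemma X_mono: "r \<le> r' \<Longrightarrow> X r' \<subseteq> X r"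
  unfolding X_def by (intro Compl_anti_mono image_mono) auto

text \<open>The open complements of \<open>X (1 - 1 / (k + 2))\<close> increase to the complement of
  \<open>\<Gamma>\<close>, so one of them covers the compact set \<open>X (1/2) - U\<close>.\<close>

lemma X_shrink:
  assumes "open U" "\<Gamma> \<subseteq> U"
  obtains r where "0 < r" "r < 1" "X r \<subseteq> U"
proof -
  define A where "A = X (1/2) - U"
  have cA: "compact A" unfolding A_def using X_compact[of "1/2"] assms by (auto intro: compact_diff)
  have cover: "A \<subseteq> (\<Union>k. - X (1 - 1 / real (k + 2)))"
  proof
    fix z assume "z \<in> A"
    then have "z \<in> - \<Gamma>" using assms by (auto simp: A_def)
    then have "z \<in> (\<lambda>s. \<Psi> s / s) ` (ball 0 1 - {0})" using bij by (simp add: bij_betw_def)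
    then obtain s where "s \<in> ball 0 1 - {0}" and zs: "z = \<Psi> s / s" by (rule imageE)
    then have s: "s \<in> ball 0 1" "s \<noteq> 0" "z = \<Psi> s / s" by auto
    obtain k where "1 / real (Suc k) < 1 - norm s" using s nat_approx_posE[of "1 - norm s"] by auto
    moreover have "1 / real (k + 2) \<le> 1 / real (Suc k)" by (simp add: field_simps)
    ultimately have "s \<in> ball 0 (1 - 1 / real (k + 2))" by auto
    then have "z \<in> - X (1 - 1 / real (k + 2))" using s unfolding X_def by blast
    then show "z \<in> (\<Union>k. - X (1 - 1 / real (k + 2)))" by blast
  qed
  have "open (- X (1 - 1 / real (k + 2)))" for k
    using open_image[of "1 - 1 / real (k + 2)"] by (simp add: X_def)
  then obtain C where C: "finite C" "A \<subseteq> (\<Union>k\<in>C. - X (1 - 1 / real (k + 2)))"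
    using compactE_image[OF cA, of UNIV "\<lambda>k. - X (1 - 1 / real (k + 2))"] cover by auto
  define m where "m = Max (insert 0 C)"
  define r where "r = 1 - 1 / real (m + 2)"
  have "r \<ge> 1/2" "r < 1" by (simp_all add: r_def field_simps)
  moreover have "X r \<subseteq> U"
  proof
    fix z assume z: "z \<in> X r"
    show "z \<in> U"
    proof (rule ccontr)
      assume "z \<notin> U"
      then have "z \<in> A" using z X_mono[OF \<open>r \<ge> 1/2\<close>] by (auto simp: A_def)
      then obtain k where k: "k \<in> C" "z \<notin> X (1 - 1 / real (k + 2))" using C by auto
      then have "k \<le> m" using C by (simp add: m_def)
      then have "1 - 1 / real (k + 2) \<le> r" by (simp add: r_def field_simps)
      then show False using X_mono z k by blast
    qed
  qed
  ultimately show ?thesis using that[of r] by linarith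
qed

text \<open>Only the germ of \<open>f\<close> at \<open>0\<close> matters, while the radius of
  holomorphy depends on \<open>z\<close>. Characterising \<open>f\<close> by an equation on an
  arbitrary disc lets the same \<open>F\<close> serve points near \<open>\<Gamma>\<close> and far
  from it.\<close>

lemma faber_exists:
  obtains F where "\<And>n z r f. \<lbrakk>r > 0; r \<le> 1; f holomorphic_on ball 0 r; \<And>s. s \<in> ball 0 r \<Longrightarrow> f s * (\<Psi> s - z * s) = u s\<rbrakk>
     \<Longrightarrow> coef f n = poly (F n) z"
proof -
  define P where "P = Abs_fps (coef \<Psi>)"
  define U where "U = Abs_fps (coef u)"
  have P: "\<Psi> has_fps_expansion P" unfolding P_def by (rule holomorphic_expansion[OF hol]) simp
  have U: "u has_fps_expansion U" unfolding U_def by (rule holomorphic_expansion[OF u_hol]) simp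
  have P0: "fps_nth P 0 \<noteq> 0" using nz[of 0] by (simp add: P_def coef_def)
  obtain F where F: "\<And>n z. fps_nth (U * inverse (P - fps_const z * fps_X)) n = poly (F n) z"
    using fps_quotient_coeff_poly[OF P0, of U] by metis
  have "coef f n = poly (F n) z"
    if r: "r > 0" "r \<le> 1" and f: "f holomorphic_on ball 0 r" "\<And>s. s \<in> ball 0 r \<Longrightarrow> f s * (\<Psi> s - z * s) = u s" for n z r f
  proof -
    define Ff where "Ff = Abs_fps (coef f)"
    have "f has_fps_expansion Ff" unfolding Ff_def by (rule holomorphic_expansion[OF f(1) r(1)])
    then have "(\<lambda>s. f s * (\<Psi> s - z * s)) has_fps_expansion Ff * (P - fps_const z * fps_X)"
      by (intro fps_expansion_intros P)
    moreover have "eventually (\<lambda>s. f s * (\<Psi> s - z * s) = u s) (nhds 0)"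
      using r f by (intro eventually_nhds_in_open[THEN eventually_mono, of "ball 0 r"]) auto
    ultimately have "u has_fps_expansion Ff * (P - fps_const z * fps_X)"
      by (metis has_fps_expansion_cong)
    then have "U = Ff * (P - fps_const z * fps_X)" using U by (metis coef_fps fps_ext)
    moreover have "(P - fps_const z * fps_X) * inverse (P - fps_const z * fps_X) = 1"
      using P0 by (intro inverse_mult_eq_1') simp
    ultimately have "U * inverse (P - fps_const z * fps_X) = Ff" by (metis mult.assoc mult.right_neutral)
    then show ?thesis using F[of z n] by (simp add: Ff_def)
  qed
  then show ?thesis using that by blast
qed

text \<open>For \<open>z\<close> in \<open>X r'\<close> the denominator has no zero in the disc of
  radius \<open>r'\<close>, and compactness of \<open>X r'\<close> times the circle makes
  \<open>M\<close> uniform. By Cauchy's estimate the Faber polynomials are then at most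
  \<open>M / r ^ n\<close> on \<open>X r'\<close>.\<close>

lemma bound_inside:
  assumes "0 < r" "r < r'" "r' \<le> 1"
  obtains M where "M \<ge> 0" "\<And>z s. z \<in> X r' \<Longrightarrow> norm s = r \<Longrightarrow> norm (u s / (\<Psi> s - z * s)) \<le> M"
    "\<And>z s. z \<in> X r' \<Longrightarrow> s \<in> ball 0 r' \<Longrightarrow> \<Psi> s - z * s \<noteq> 0"
proof -
  have sub: "sphere 0 r \<subseteq> (ball 0 1 :: complex set)" using assms by auto
  have nzero: "\<Psi> s - z * s \<noteq> 0" if "z \<in> X r'" "s \<in> ball 0 r'" for z s
  proof
    assume *: "\<Psi> s - z * s = 0"
    have "s \<in> ball 0 1" using that assms by auto
    then have "s \<noteq> 0" using * nz by auto
    then have "z = \<Psi> s / s" using * by (simp add: field_simps)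
    then show False using that \<open>s \<noteq> 0\<close> by (auto simp: X_def)
  qed
  define g where "g = (\<lambda>(z, s). u s / (\<Psi> s - z * s))"
  have cu: "continuous_on (ball 0 1) u" "continuous_on (ball 0 1) \<Psi>"
    using u_hol hol holomorphic_on_imp_continuous_on by blast+
  have "continuous_on (X r' \<times> sphere (0::complex) r) g"
    unfolding g_def case_prod_unfold
    by (intro continuous_intros continuous_on_compose2[OF cu(1)] continuous_on_compose2[OF cu(2)])
       (use sub nzero assms in auto)
  moreover have "compact (X r' \<times> sphere (0::complex) r)"
    using assms by (intro compact_Times X_compact compact_sphere) auto
  ultimately have "bounded (g ` (X r' \<times> sphere (0::complex) r))"
    using compact_continuous_image compact_imp_bounded by blast
  then obtain M where M: "M > 0" "\<And>x. x \<in> g ` (X r' \<times> sphere (0::complex) r) \<Longrightarrow> norm x \<le> M" using bounded_pos by metis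
  have "norm (u s / (\<Psi> s - z * s)) \<le> M" if "z \<in> X r'" "norm s = r" for z s
    using M(2)[OF imageI[of "(z, s)"]] that by (simp add: g_def)
  then show ?thesis using that[of M] M nzero by auto
qed

text \<open>At \<open>z = \<Psi> s0 / s0\<close> the generating function has its pole at
  \<open>s0\<close>, and the geometric series subtracted has the coefficients
  \<open>s0 ^ (- n)\<close>. In terms of \<open>\<theta>\<close> the difference is continuous even
  at \<open>s0 = 0\<close>, so compactness of the full disc gives a uniform
  \<open>M\<close>.\<close>

lemma bound_outside:
  assumes "0 < r" "r < r'" "r' < 1"
  obtains M where "M \<ge> 0" "\<And>s0 s. \<lbrakk>norm s0 \<le> r; s0 \<noteq> 0; norm s = r'\<rbrakk> \<Longrightarrow> norm (u s / (\<Psi> s - \<Psi> s0 / s0 * s) - 1 / (1 - s / s0)) \<le> M"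
proof -
  define g where "g = (\<lambda>(s0, s). u s * \<theta> s * \<theta> s0 / (s * (\<theta> s0 - \<theta> s)) - s0 / (s0 - s))"
  have cu: "continuous_on (ball 0 1) u" "continuous_on (ball 0 1) \<theta>"
    using u_hol \<theta>_hol holomorphic_on_imp_continuous_on by blast+
  have sub: "cball 0 r \<subseteq> (ball 0 1 :: complex set)" "sphere 0 r' \<subseteq> (ball 0 1 :: complex set)" using assms by auto
  have ne: "\<theta> s0 \<noteq> \<theta> s" "s0 \<noteq> s" if "s0 \<in> cball 0 r" "s \<in> sphere 0 r'" for s0 s
  proof -
    show "s0 \<noteq> s" using that assms by auto
    then show "\<theta> s0 \<noteq> \<theta> s" using that sub inj_onD[OF \<theta>_inj, of s0 s] by blast
  qed
  have "continuous_on (cball 0 r \<times> sphere 0 r') g"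
    unfolding g_def case_prod_unfold
    by (intro continuous_intros continuous_on_compose2[OF cu(1)] continuous_on_compose2[OF cu(2)])
       (use sub ne assms in auto)
  moreover have "compact (cball (0::complex) r \<times> sphere (0::complex) r')"
    by (intro compact_Times compact_sphere compact_cball)
  ultimately have "bounded (g ` (cball 0 r \<times> sphere 0 r'))"
    using compact_continuous_image compact_imp_bounded by blast
  then obtain M where M: "M > 0" "\<And>x. x \<in> g ` (cball 0 r \<times> sphere 0 r') \<Longrightarrow> norm x \<le> M" using bounded_pos by metis
  have "norm (u s / (\<Psi> s - \<Psi> s0 / s0 * s) - 1 / (1 - s / s0)) \<le> M" if s: "norm s0 \<le> r" "s0 \<noteq> 0" "norm s = r'" for s0 s
  proof -
    have in_ball: "s0 \<in> ball 0 1" "s \<in> ball 0 1" "s \<noteq> 0" using s assms by auto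
    have n: "\<theta> s0 \<noteq> 0" "\<theta> s \<noteq> 0" "\<theta> s0 \<noteq> \<theta> s" "s0 \<noteq> s" using ne[of s0 s] s in_ball nz by (auto simp: \<theta>_def)
    have "\<Psi> s = s / \<theta> s" "\<Psi> s0 = s0 / \<theta> s0" using in_ball nz s by (auto simp: \<theta>_def)
    then have "\<Psi> s - \<Psi> s0 / s0 * s = s * (\<theta> s0 - \<theta> s) / (\<theta> s * \<theta> s0)" using n s by (simp add: field_simps)
    moreover have "1 / (1 - s / s0) = s0 / (s0 - s)" using s n by (simp add: field_simps)
    ultimately have "u s / (\<Psi> s - \<Psi> s0 / s0 * s) - 1 / (1 - s / s0) = g (s0, s)"
      by (simp add: g_def mult.assoc)
    then show ?thesis using M(2)[of "g (s0, s)"] s by auto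
  qed
  then show ?thesis using that[of M] M by auto
qed

text \<open>Both terms below have a simple pole at \<open>s0\<close>, with the same principal part.\<close>

lemma difference_extends:
  assumes "s0 \<in> ball 0 1" "s0 \<noteq> 0"
  obtains E where "E holomorphic_on ball 0 1"
    "\<And>s. s \<in> ball 0 1 \<Longrightarrow> s \<noteq> s0 \<Longrightarrow> \<Psi> s - \<Psi> s0 / s0 * s \<noteq> 0"
    "\<And>s. s \<in> ball 0 1 \<Longrightarrow> s \<noteq> s0 \<Longrightarrow> E s = u s / (\<Psi> s - \<Psi> s0 / s0 * s) - 1 / (1 - s / s0)"
proof -
  define z where "z = \<Psi> s0 / s0"
  define D where "D s = \<Psi> s - z * s" for s
  have D_hol: "D holomorphic_on ball 0 1" unfolding D_def by (intro holomorphic_intros hol)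
  have D0: "D s0 = 0" using assms by (simp add: D_def z_def)
  have Dnz: "D s \<noteq> 0" if "s \<in> ball 0 1" "s \<noteq> s0" for s
  proof
    assume "D s = 0"
    then have "\<theta> s = \<theta> s0"
      using assms that nz[of s] nz[of s0] by (auto simp: D_def z_def \<theta>_def field_simps)
    then show False using \<theta>_inj that assms by (auto dest: inj_onD)
  qed
  \<comment> \<open>\<open>D\<close> with its zero at \<open>s0\<close> divided out; as
    \<open>u s0 \<noteq> 0\<close>, the zero is simple and \<open>D1\<close> has none.\<close>
  define D1 where "D1 s = (if s = s0 then deriv D s0 else (D s - D s0) / (s - s0))" for s
  have D1_hol: "D1 holomorphic_on ball 0 1" unfolding D1_def by (rule pole_lemma_open[OF D_hol open_ball])
  have dD: "deriv D s0 = - u s0 / s0"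
  proof -
    have "(D has_field_derivative deriv \<Psi> s0 - z) (at s0)"
      unfolding D_def using holomorphic_derivI[OF hol open_ball assms(1)] by (auto intro!: derivative_eq_intros)
    then have "deriv D s0 = deriv \<Psi> s0 - z" by (rule DERIV_imp_deriv)
    then show ?thesis using assms by (simp add: u_def z_def field_simps)
  qed
  have D1nz: "D1 s \<noteq> 0" if "s \<in> ball 0 1" for s
    using Dnz[OF that] u_nz[OF assms(1)] assms(2) by (auto simp: D1_def D0 dD)
  \<comment> \<open>The numerator over the common denominator \<open>(s - s0) * D1 s\<close>. It
    vanishes at \<open>s0\<close> because \<open>D1 s0 = - u s0 / s0\<close>, so the factor
    \<open>s - s0\<close> cancels.\<close>
  define N where "N s = u s + s0 * D1 s" for s
  have N_hol: "N holomorphic_on ball 0 1" unfolding N_def by (intro holomorphic_intros u_hol D1_hol)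
  have N0: "N s0 = 0" using assms by (simp add: N_def D1_def dD)
  define N1 where "N1 s = (if s = s0 then deriv N s0 else (N s - N s0) / (s - s0))" for s
  have N1_hol: "N1 holomorphic_on ball 0 1" unfolding N1_def by (rule pole_lemma_open[OF N_hol open_ball])
  show ?thesis
  proof (rule that[of "\<lambda>s. N1 s / D1 s"])
    show "(\<lambda>s. N1 s / D1 s) holomorphic_on ball 0 1" by (intro holomorphic_intros N1_hol D1_hol D1nz)
    show "\<Psi> s - \<Psi> s0 / s0 * s \<noteq> 0" if "s \<in> ball 0 1" "s \<noteq> s0" for s using Dnz[OF that] by (simp add: D_def z_def)
    show "N1 s / D1 s = u s / (\<Psi> s - \<Psi> s0 / s0 * s) - 1 / (1 - s / s0)" if "s \<in> ball 0 1" "s \<noteq> s0" for s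
    proof -
      have d: "D s = (s - s0) * D1 s" using that by (simp add: D1_def D0)
      have "N1 s = (u s + s0 * D1 s) / (s - s0)" using that by (simp add: N1_def N0) (simp add: N_def)
      then have "N1 s / D1 s = u s / D s + s0 / (s - s0)"
        using D1nz[OF that(1)] that(2) unfolding d by (simp add: add_divide_distrib)
      also have "s0 / (s - s0) = - (1 / (1 - s / s0))" using that assms by (simp add: field_simps)
      finally show ?thesis by (simp add: D_def z_def)
    qed
  qed
qed

end

text \<open>At \<open>\<Psi> s / s\<close> the Faber polynomial is \<open>s ^ (- n)\<close> up to
  \<open>M' / r5 ^ n\<close>, while on \<open>X r3\<close> it is at most \<open>M / r2 ^ n\<close>.
  Scaling by \<open>r1 ^ n\<close> with \<open>r0 < r1 < r2\<close> makes it large off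
  \<open>X r0\<close> and small on \<open>X r3\<close>. Off \<open>X r3\<close> it has no critical
  points: \<open>s ^ (- n)\<close> has none, and the error is too small to create any.\<close>

lemma lemniscate_0:
  assumes G: "treelike 0 \<Gamma>" and U: "open U" "bounded U" "\<Gamma> \<subseteq> U"
  obtains q :: "complex poly" where "degree q > 0" "\<And>z. norm (poly q z) \<le> 1 \<Longrightarrow> z \<in> U"
    "\<And>z. z \<in> \<Gamma> \<Longrightarrow> norm (poly q z) < 1" "\<And>z. poly (pderiv q) z = 0 \<Longrightarrow> norm (poly q z) < 1"
proof -
  have zero: "0 \<in> \<Gamma>" using G interior_subset by (auto simp: treelike_def)
  obtain \<Psi> where \<Psi>: "\<Psi> holomorphic_on ball 0 1" "\<And>s. s \<in> ball 0 1 \<Longrightarrow> \<Psi> s \<noteq> 0"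
    "bij_betw (\<lambda>s. \<Psi> s / s) (ball 0 1 - {0}) (- \<Gamma>)" using exterior_map_exists[OF G] by metis
  interpret exterior_map \<Gamma> \<Psi> using \<Psi> zero by unfold_locales auto
  \<comment> \<open>Roles of the radii: \<open>X r0\<close> lies in \<open>U\<close>;
    \<open>r1\<close> sets the level; \<open>r2\<close> and \<open>r5\<close> are Cauchy circles of
    the inner estimate, valid on \<open>X r3\<close>, and of the outer one, valid for
    \<open>norm s \<le> r4\<close>. The gap between \<open>r3\<close> and \<open>r4\<close> leaves
    room for bounding a derivative.\<close>
  obtain r0 where r0: "0 < r0" "r0 < 1" "X r0 \<subseteq> U" using X_shrink[OF U(1,3)] .
  obtain r1 where r1: "r0 < r1" "r1 < 1" using r0 dense by blast
  obtain r2 where r2: "r1 < r2" "r2 < 1" using r1 dense by blast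
  obtain r3 where r3: "r2 < r3" "r3 < 1" using r2 dense by blast
  obtain r4 where r4: "r3 < r4" "r4 < 1" using r3 dense by blast
  obtain r5 where r5: "r4 < r5" "r5 < 1" using r4 dense by blast
  have pos: "0 < r1" "0 < r2" "0 < r3" "0 < r4" "0 < r5" using r0 r1 r2 r3 r4 r5 by auto
  obtain F where F: "\<And>n z r f. \<lbrakk>r > 0; r \<le> 1; f holomorphic_on ball 0 r; \<And>s. s \<in> ball 0 r \<Longrightarrow> f s * (\<Psi> s - z * s) = u s\<rbrakk>
     \<Longrightarrow> coef f n = poly (F n) z" using faber_exists by blast
  obtain M where M: "M \<ge> 0" "\<And>z s. z \<in> X r3 \<Longrightarrow> norm s = r2 \<Longrightarrow> norm (u s / (\<Psi> s - z * s)) \<le> M"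
    "\<And>z s. z \<in> X r3 \<Longrightarrow> s \<in> ball 0 r3 \<Longrightarrow> \<Psi> s - z * s \<noteq> 0"
    using bound_inside[of r2 r3] pos r3 by auto
  have inside: "norm (poly (F n) z) \<le> M / r2 ^ n" if "z \<in> X r3" for n z
  proof -
    have h: "(\<lambda>s. u s / (\<Psi> s - z * s)) holomorphic_on ball 0 r3"
      using M(3)[OF that] r3 by (intro holomorphic_intros holomorphic_on_subset[OF u_hol] holomorphic_on_subset[OF hol]) auto
    have "coef (\<lambda>s. u s / (\<Psi> s - z * s)) n = poly (F n) z"
      by (rule F[OF _ _ h]) (use M(3)[OF that] r3 pos in auto)
    moreover have "norm (coef (\<lambda>s. u s / (\<Psi> s - z * s)) n) \<le> M / r2 ^ n"
      by (rule coef_bound[OF h]) (use r3 pos M(2)[OF that] in auto)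
    ultimately show ?thesis by simp
  qed
  obtain M' where M': "M' \<ge> 0" "\<And>s0 s. \<lbrakk>norm s0 \<le> r4; s0 \<noteq> 0; norm s = r5\<rbrakk> \<Longrightarrow> norm (u s / (\<Psi> s - \<Psi> s0 / s0 * s) - 1 / (1 - s / s0)) \<le> M'"
    using bound_outside[of r4 r5] pos r5 by auto
  have outside: "norm (poly (F n) (\<Psi> s0 / s0) - 1 / s0 ^ n) \<le> M' / r5 ^ n" if s0: "norm s0 \<le> r4" "s0 \<noteq> 0" for n s0
  proof -
    have s0b: "s0 \<in> ball 0 1" using s0 r4 by auto
    obtain E where E: "E holomorphic_on ball 0 1"
      "\<And>s. s \<in> ball 0 1 \<Longrightarrow> s \<noteq> s0 \<Longrightarrow> \<Psi> s - \<Psi> s0 / s0 * s \<noteq> 0"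
      "\<And>s. s \<in> ball 0 1 \<Longrightarrow> s \<noteq> s0 \<Longrightarrow> E s = u s / (\<Psi> s - \<Psi> s0 / s0 * s) - 1 / (1 - s / s0)"
      using difference_extends[OF s0b s0(2)] by blast
    define r where "r = norm s0"
    have r: "r > 0" "r \<le> 1" using s0 r4 by (auto simp: r_def)
    have inb: "s \<in> ball 0 1 \<and> s \<noteq> s0" if "s \<in> ball 0 r" for s using that r by (auto simp: r_def)
    have h: "(\<lambda>s. u s / (\<Psi> s - \<Psi> s0 / s0 * s)) holomorphic_on ball 0 r"
      using E(2) inb r by (intro holomorphic_intros holomorphic_on_subset[OF u_hol] holomorphic_on_subset[OF hol]) auto
    have hg: "(\<lambda>s. 1 / (1 - s / s0)) holomorphic_on ball 0 r"
      using s0(2) by (intro holomorphic_intros) (auto simp: r_def)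
    have "coef E n = coef (\<lambda>s. u s / (\<Psi> s - \<Psi> s0 / s0 * s)) n - coef (\<lambda>s. 1 / (1 - s / s0)) n"
      by (rule coef_diff[OF h hg r(1)]) (use E(3) inb in auto)
    moreover have "coef (\<lambda>s. u s / (\<Psi> s - \<Psi> s0 / s0 * s)) n = poly (F n) (\<Psi> s0 / s0)"
      by (rule F[OF r h]) (use E(2) inb in auto)
    moreover have "norm (coef E n) \<le> M' / r5 ^ n"
    proof (rule coef_bound[OF E(1)])
      fix s :: complex assume s: "norm s = r5"
      then have "s \<in> ball 0 1" "s \<noteq> s0" using r5 s0 by auto
      then show "norm (E s) \<le> M'" using E(3) M'(2)[OF s0 s] by simp
    qed (use pos r5 in auto)
    ultimately show ?thesis using coef_geometric[OF s0(2)] by simp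
  qed
  \<comment> \<open>For \<open>norm s < r3\<close> the disc of radius \<open>c * norm s\<close>
    about \<open>s\<close> avoids \<open>0\<close> and stays within \<open>norm w \<le> r4\<close>,
    where the outer estimate holds.\<close>
  define c where "c = min 1 ((r4 - r3) / r3)"
  have c: "0 < c" "c \<le> 1" "r3 * c \<le> r4 - r3" using r4 pos by (auto simp: c_def min_def field_simps)
  have no_crit: "poly (pderiv (F n)) (\<Psi> s / s) \<noteq> 0"
    if n: "2 * (M' / r5 ^ n / c) < n / r3 ^ n" and s: "norm s < r3" "s \<noteq> 0" for n s
  proof
    assume crit: "poly (pderiv (F n)) (\<Psi> s / s) = 0"
    define g where "g w = poly (F n) (\<Psi> w / w) - 1 / w ^ n" for w
    define d where "d = c * norm s"
    have d: "d > 0" using c s by (simp add: d_def)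
    have sb: "s \<in> ball 0 1" using s r3 by auto
    have ball_sub: "norm w \<le> r4 \<and> w \<noteq> 0 \<and> norm w < 1" if "w \<in> ball s d" for w
    proof -
      have "norm w \<le> norm s + norm (w - s)" using norm_triangle_ineq[of s "w - s"] by simp
      also have "\<dots> < norm s + d" using that by (simp add: dist_norm norm_minus_commute)
      also have "\<dots> \<le> r3 + r3 * c" 
      proof -
        have "c * norm s \<le> c * r3" using s c by (intro mult_left_mono) auto
        then show ?thesis using s by (simp add: d_def mult.commute)
      qed
      finally have "norm w < r4" using c by simp
      moreover have "w \<noteq> 0" using that c s by (auto simp: d_def mult_le_cancel_right2 not_less)
      ultimately show ?thesis using r4 by simp
    qed
    have hg: "g holomorphic_on ball s d"
      unfolding g_def using ball_sub
      by (intro holomorphic_intros holomorphic_on_subset[OF hol]) auto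
    have bnd: "norm (deriv g s) \<le> M' / r5 ^ n / (d / 2)" 
    proof -
      have "norm ((deriv ^^ 1) g s) \<le> fact 1 * (M' / r5 ^ n) / (d/2) ^ 1"
      proof (rule Cauchy_inequality)
        show "g holomorphic_on ball s (d/2)" using hg d by (auto elim!: holomorphic_on_subset)
        show "continuous_on (cball s (d/2)) g" using hg d by (auto intro!: holomorphic_on_imp_continuous_on elim!: holomorphic_on_subset)
        fix w assume "norm (s - w) = d/2"
        then have "w \<in> ball s d" using d by (simp add: dist_norm)
        then show "norm (g w) \<le> M' / r5 ^ n" unfolding g_def using ball_sub outside by blast
      qed (use d in simp)
      then show ?thesis by simp
    qed
    \<comment> \<open>At a critical point of \<open>F n\<close> the first term of \<open>g\<close>
      contributes nothing, so the derivative is exactly that of \<open>- 1 / w ^ n\<close>, too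
      large for the estimate \<open>bnd\<close>.\<close>
    have der: "(g has_field_derivative of_nat n / s ^ Suc n) (at s)"
    proof -
      obtain p' where p': "((\<lambda>w. \<Psi> w / w) has_field_derivative p') (at s)"
        using DERIV_divide[OF holomorphic_derivI[OF hol open_ball sb] DERIV_ident s(2)] by blast
      have "((\<lambda>w. poly (F n) (\<Psi> w / w)) has_field_derivative poly (pderiv (F n)) (\<Psi> s / s) * p') (at s)"
        using DERIV_chain2[OF poly_DERIV p'] .
      moreover have "((\<lambda>w. 1 / w ^ n) has_field_derivative - (of_nat n / s ^ Suc n)) (at s)"
      proof -
        have "((\<lambda>w. w ^ n) has_field_derivative of_nat n * s ^ (n - 1)) (at s)"
          using DERIV_power[OF DERIV_ident, of n s] by simp
        from DERIV_inverse'[OF this]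
        have "((\<lambda>w. 1 / w ^ n) has_field_derivative - (inverse (s ^ n) * (of_nat n * s ^ (n - 1)) * inverse (s ^ n))) (at s)"
          using s(2) by (simp add: inverse_eq_divide)
        moreover have "inverse (s ^ n) * (of_nat n * s ^ (n - 1)) * inverse (s ^ n) = of_nat n / s ^ Suc n"
          using s(2) by (cases n) (simp_all add: field_simps)
        ultimately show ?thesis by simp
      qed
      ultimately show ?thesis unfolding g_def using DERIV_diff crit by fastforce
    qed
    then have "norm (deriv g s) = n / norm s ^ Suc n" by (simp add: DERIV_imp_deriv norm_divide norm_mult norm_power)
    then have "n / norm s ^ Suc n \<le> 2 * (M' / r5 ^ n / (c * norm s))" using bnd by (simp add: d_def mult.commute)
    then have "n / norm s ^ n \<le> 2 * (M' / r5 ^ n / c)" using s c by (simp add: field_simps)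
    moreover have "n / r3 ^ n \<le> n / norm s ^ n"
      using s by (intro divide_left_mono power_mono mult_pos_pos) (auto simp: pos)
    ultimately show False using n by simp
  qed
  have lim: "(\<lambda>n. (a / b) ^ n) \<longlonglongrightarrow> 0" if "0 < a" "a < b" for a b :: real
    using that by (intro LIMSEQ_power_zero) simp
  \<comment> \<open>These yield the three requirements on \<open>n\<close>: small on
    \<open>X r3\<close>, large off \<open>X r0\<close>, and no critical points off
    \<open>X r3\<close>.\<close>
  have lims: "(\<lambda>n. M * (r1 / r2) ^ n) \<longlonglongrightarrow> M * 0" "(\<lambda>n. (r0 / r1) ^ n + M' * (r0 / r5) ^ n) \<longlonglongrightarrow> 0 + M' * 0"
    "(\<lambda>n. 2 * M' / c * (r3 / r5) ^ n) \<longlonglongrightarrow> 2 * M' / c * 0"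
    by (intro tendsto_intros lim; use r0 r1 r2 r3 r4 r5 pos in linarith)+
  have "eventually (\<lambda>n. M * (r1 / r2) ^ n < 1 \<and> (r0 / r1) ^ n + M' * (r0 / r5) ^ n < 1
      \<and> 2 * M' / c * (r3 / r5) ^ n < 1 \<and> n \<ge> 1) sequentially"
    using lims by (intro eventually_conj order_tendstoD(2) eventually_ge_at_top) auto
  then obtain n where n: "M * (r1 / r2) ^ n < 1" "(r0 / r1) ^ n + M' * (r0 / r5) ^ n < 1"
    "2 * M' / c * (r3 / r5) ^ n < 1" "n \<ge> 1"
    by (metis (mono_tags, lifting) eventually_happens' trivial_limit_sequentially)
  have pw: "r0 ^ n > 0" "r1 ^ n > 0" "r2 ^ n > 0" "r3 ^ n > 0" "r5 ^ n > 0" using pos r0 by auto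
  have a: "r1 ^ n * (M / r2 ^ n) < 1" using n(1) by (simp add: power_divide mult.commute)
  have b: "1 < r1 ^ n * (1 / r0 ^ n - M' / r5 ^ n)"
  proof -
    have "r0 ^ n / r1 ^ n + M' * r0 ^ n / r5 ^ n < 1" using n(2) by (simp add: power_divide)
    then have "(1 / r1 ^ n + M' / r5 ^ n) * r0 ^ n < 1" by (simp add: distrib_right)
    then have "1 / r1 ^ n + M' / r5 ^ n < 1 / r0 ^ n" using pw by (simp add: pos_less_divide_eq)
    then have "1 / r1 ^ n < 1 / r0 ^ n - M' / r5 ^ n" by simp
    then show ?thesis using pw by (simp add: pos_divide_less_eq mult.commute)
  qed
  have cc: "2 * (M' / r5 ^ n / c) < n / r3 ^ n"
  proof -
    have "2 * M' / c * (r3 ^ n / r5 ^ n) < n" using n(3,4) by (simp add: power_divide)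
    moreover have "2 * M' / c * (r3 ^ n / r5 ^ n) = 2 * (M' / r5 ^ n / c) * r3 ^ n" by simp
    ultimately show ?thesis using pw by (simp add: pos_less_divide_eq mult.commute)
  qed
  define q where "q = smult (of_real (r1 ^ n)) (F n)"
  have nq: "norm (poly q z) = r1 ^ n * norm (poly (F n) z)" for z
    using pos by (simp add: q_def norm_mult norm_power)
  have small: "norm (poly q z) < 1" if "z \<in> X r3" for z
  proof -
    have "r1 ^ n * norm (poly (F n) z) \<le> r1 ^ n * (M / r2 ^ n)"
      using inside[OF that, of n] pw by (intro mult_left_mono) auto
    then show ?thesis using a nq by simp
  qed
  have large: "norm (poly q z) > 1" if "z \<notin> X r0" for z
  proof -
    have "z \<in> (\<lambda>s. \<Psi> s / s) ` (ball 0 r0 - {0})" using that by (simp add: X_def)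
    then obtain s where "z = \<Psi> s / s" "s \<in> ball 0 r0 - {0}" by (rule imageE)
    then have s: "s \<in> ball 0 r0 - {0}" "z = \<Psi> s / s" by auto
    then have s4: "norm s \<le> r4" "s \<noteq> 0" using r1 r2 r3 r4 by auto
    have "1 / r0 ^ n \<le> 1 / norm s ^ n"
      using s s4 pw by (intro divide_left_mono power_mono) auto
    also have "\<dots> = norm (1 / s ^ n)" by (simp add: norm_divide norm_power)
    also have "\<dots> \<le> norm (poly (F n) z) + M' / r5 ^ n"
      using outside[OF s4, of n] norm_triangle_sub[of "1 / s ^ n" "poly (F n) z"] s(2)
      by (simp add: norm_minus_commute)
    finally have "r1 ^ n * (1 / r0 ^ n - M' / r5 ^ n) \<le> r1 ^ n * norm (poly (F n) z)"
      using pw by (intro mult_left_mono) auto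
    then show ?thesis using b nq by simp
  qed
  have gam: "norm (poly q z) < 1" if "z \<in> \<Gamma>" for z
    using small \<Gamma>_X[of r3] that r3 by auto
  have inU: "z \<in> U" if "norm (poly q z) \<le> 1" for z
    using large[of z] that r0(3) by fastforce
  show ?thesis
  proof (rule that[of q])
    \<comment> \<open>A constant \<open>q\<close>, being small on \<open>\<Gamma>\<close>, would be
      small everywhere, against boundedness of \<open>U\<close>.\<close>
    show "degree q > 0"
    proof (rule ccontr)
      assume "\<not> degree q > 0"
      then obtain k where "q = [:k:]" using degree_eq_zeroE by blast
      then have "norm (poly q z) \<le> 1" for z using gam[OF zero] by simp
      then have "U = UNIV" using inU by blast
      then show False using U(2) not_bounded_UNIV by blast
    qed
    show "norm (poly q z) < 1" if "poly (pderiv q) z = 0" for z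
    proof (rule small, rule ccontr)
      assume "z \<notin> X r3"
      then obtain s where s: "s \<in> ball 0 r3 - {0}" "z = \<Psi> s / s" unfolding X_def by blast
      have "poly (pderiv (F n)) z = 0" using that pos by (simp add: q_def pderiv_smult)
      then show False using no_crit[OF cc, of s] s by auto
    qed
  qed (use inU gam in auto)
qed

section \<open>Lemniscates under small perturbations of lower degree\<close>

lemma poly_bound_power:
  fixes h :: "complex poly"
  assumes "degree h \<le> m"
  obtains B where "B > 0" "\<And>z. norm (poly h z) \<le> B * (1 + norm z) ^ m"
proof -
  define B where "B = 1 + (\<Sum>i\<le>degree h. norm (coeff h i))"
  have "norm (poly h z) \<le> B * (1 + norm z) ^ m" for z
  proof -
    have "norm (poly h z) \<le> (\<Sum>i\<le>degree h. norm (coeff h i * z ^ i))"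
      unfolding poly_altdef by (rule norm_sum)
    also have "\<dots> \<le> (\<Sum>i\<le>degree h. norm (coeff h i) * (1 + norm z) ^ m)"
    proof (rule sum_mono)
      fix i assume i: "i \<in> {..degree h}"
      have "norm z ^ i \<le> (1 + norm z) ^ i" by (intro power_mono) auto
      also have "\<dots> \<le> (1 + norm z) ^ m" using i assms by (intro power_increasing) auto
      finally show "norm (coeff h i * z ^ i) \<le> norm (coeff h i) * (1 + norm z) ^ m"
        by (simp add: norm_mult norm_power mult_left_mono)
    qed
    also have "\<dots> = (\<Sum>i\<le>degree h. norm (coeff h i)) * (1 + norm z) ^ m" by (simp add: sum_distrib_right)
    also have "\<dots> \<le> B * (1 + norm z) ^ m" by (intro mult_right_mono) (auto simp: B_def)
    finally show ?thesis .
  qed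
  moreover have "B > 0" unfolding B_def by (intro add_pos_nonneg sum_nonneg) auto
  ultimately show ?thesis using that by blast
qed

text \<open>The weight \<open>(1 + norm z) ^ (degree q - 1)\<close> keeps the perturbation below
  \<open>q\<close> at infinity, where \<open>q\<close> grows by one power more. On the part of a
  large disc outside \<open>U\<close>, compactness makes \<open>norm (poly q z)\<close> exceed
  \<open>1\<close> by some \<open>\<sigma>\<close>.\<close>

lemma sublevel_perturb_subset:
  fixes q :: "complex poly"
  assumes d: "degree q > 0" and U: "open U" "\<And>z. norm (poly q z) \<le> 1 \<Longrightarrow> z \<in> U"
  obtains \<eta> where "\<eta> > 0" "\<And>h z. \<lbrakk>\<And>z. norm (poly h z) \<le> \<eta> * (1 + norm z) ^ (degree q - 1); norm (poly (q + h) z) \<le> 1\<rbrakk> \<Longrightarrow> z \<in> U"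
proof -
  define n where "n = degree q - 1"
  have n: "degree q = Suc n" using d by (simp add: n_def)
  define a where "a = norm (lead_coeff q) / 2"
  have a: "a > 0" using d by (auto simp: a_def)
  have "eventually (\<lambda>z. dist (poly q z / z ^ degree q) (lead_coeff q) < a) at_infinity"
    using poly_over_power_at_infinity a by (rule tendstoD)
  then obtain R0 where R0: "\<And>z. norm z \<ge> R0 \<Longrightarrow> dist (poly q z / z ^ degree q) (lead_coeff q) < a"
    unfolding eventually_at_infinity by blast
  \<comment> \<open>For \<open>norm z \<ge> 1\<close>, \<open>(1 + norm z) ^ n + 2\<close> is at
    most \<open>(2 ^ n + 2) * norm z ^ n\<close>, and beyond \<open>R\<close> this is at most
    \<open>a * norm z ^ Suc n\<close>.\<close>
  define R where "R = max 1 (max R0 ((2 ^ n + 2) / a))"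
  have R: "R \<ge> 1" "R \<ge> R0" "R \<ge> (2 ^ n + 2) / a" by (auto simp: R_def)
  have far: "norm (poly q z) \<ge> (1 + norm z) ^ n + 2" if "norm z \<ge> R" for z
  proof -
    have z: "norm z \<ge> 1" "z \<noteq> 0" using that R by auto
    have "dist (poly q z / z ^ degree q) (lead_coeff q) < a" using R0 that R by simp
    then have "norm (lead_coeff q) - norm (poly q z / z ^ degree q) < a"
      using norm_triangle_ineq3[of "poly q z / z ^ degree q" "lead_coeff q"] by (simp add: dist_norm)
    then have "a < norm (poly q z / z ^ degree q)" by (simp add: a_def)
    then have "a * norm z ^ Suc n < norm (poly q z)" using z by (simp add: norm_divide norm_mult norm_power n pos_less_divide_eq)
    moreover have "(1 + norm z) ^ n + 2 \<le> a * norm z ^ Suc n"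
    proof -
      have "(1 + norm z) ^ n \<le> (2 * norm z) ^ n" using z by (intro power_mono) auto
      then have "(1 + norm z) ^ n + 2 \<le> 2 ^ n * norm z ^ n + 2 * norm z ^ n"
      proof -
        have "1 \<le> norm z ^ n" using z by (intro one_le_power) simp
        then show ?thesis using \<open>(1 + norm z) ^ n \<le> (2 * norm z) ^ n\<close> by (simp add: power_mult_distrib)
      qed
      also have "\<dots> = (2 ^ n + 2) * norm z ^ n" by (simp add: algebra_simps)
      also have "\<dots> \<le> (a * norm z) * norm z ^ n"
        using that R a by (intro mult_right_mono) (auto simp: pos_divide_le_eq mult.commute intro: order_trans)
      finally show ?thesis by (simp add: mult.assoc)
    qed
    ultimately show ?thesis by simp
  qed
  define C where "C = cball 0 R - U"
  have "compact C" unfolding C_def using U(1) by (intro compact_diff) auto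
  have "\<exists>\<sigma>>0. \<forall>z\<in>C. norm (poly q z) \<ge> 1 + \<sigma>"
  proof (cases "C = {}")
    case False
    have "continuous_on C (\<lambda>z. norm (poly q z))" by (intro continuous_intros)
    then obtain w where w: "w \<in> C" "\<And>z. z \<in> C \<Longrightarrow> norm (poly q w) \<le> norm (poly q z)"
      using continuous_attains_inf[OF \<open>compact C\<close> False] by blast
    then have "norm (poly q w) > 1" using U(2) by (force simp: C_def)
    then show ?thesis using w by (intro exI[of _ "norm (poly q w) - 1"]) auto
  qed (auto intro: exI[of _ 1])
  then obtain \<sigma> where \<sigma>: "\<sigma> > 0" "\<And>z. z \<in> C \<Longrightarrow> norm (poly q z) \<ge> 1 + \<sigma>" by blast
  define \<eta> where "\<eta> = min 1 (\<sigma> / (2 * (1 + R) ^ n))"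
  have \<eta>: "\<eta> > 0" "\<eta> \<le> 1" "\<eta> * (1 + R) ^ n < \<sigma>"
  proof -
    have p: "(1 + R) ^ n > 0" using R by simp
    then show "\<eta> > 0" "\<eta> \<le> 1" using \<sigma> by (auto simp: \<eta>_def)
    have "\<eta> * (1 + R) ^ n \<le> \<sigma> / (2 * (1 + R) ^ n) * (1 + R) ^ n"
      using p by (intro mult_right_mono) (auto simp: \<eta>_def)
    also have "\<dots> = \<sigma> / 2" using p R by simp
    finally show "\<eta> * (1 + R) ^ n < \<sigma>" using \<sigma> by simp
  qed
  have "z \<in> U" if h: "\<And>z. norm (poly h z) \<le> \<eta> * (1 + norm z) ^ (degree q - 1)" and z: "norm (poly (q + h) z) \<le> 1" for h z
  proof (rule ccontr)
    assume "z \<notin> U"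
    have hz: "norm (poly h z) \<le> \<eta> * (1 + norm z) ^ n" using h by (simp add: n_def)
    have qz: "norm (poly q z) \<le> 1 + norm (poly h z)"
      using z norm_triangle_ineq4[of "poly (q + h) z" "poly h z"] by simp
    show False
    proof (cases "norm z \<le> R")
      case True
      then have "norm (poly q z) \<ge> 1 + \<sigma>" using \<sigma>(2)[of z] \<open>z \<notin> U\<close> by (simp add: C_def)
      moreover have "\<eta> * (1 + norm z) ^ n \<le> \<eta> * (1 + R) ^ n"
        using True \<eta> by (intro mult_left_mono power_mono) auto
      ultimately show False using qz hz \<eta> by linarith
    next
      case False
      then have "(1 + norm z) ^ n + 2 \<le> norm (poly q z)" using far by simp
      moreover have "\<eta> * (1 + norm z) ^ n \<le> 1 * (1 + norm z) ^ n" using \<eta> by (intro mult_right_mono) auto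
      ultimately show False using qz hz by linarith
    qed
  qed
  then show ?thesis using that \<eta> by blast
qed

lemma sublevel_perturb:
  fixes q :: "complex poly"
  assumes d: "degree q > 0" and U: "open U" "\<And>z. norm (poly q z) \<le> 1 \<Longrightarrow> z \<in> U"
    and \<Gamma>: "compact \<Gamma>" "\<And>z. z \<in> \<Gamma> \<Longrightarrow> norm (poly q z) < 1"
  obtains \<eta> where "\<eta> > 0"
    "\<And>h z. \<lbrakk>\<And>z. norm (poly h z) \<le> \<eta> * (1 + norm z) ^ (degree q - 1); norm (poly (q + h) z) \<le> 1\<rbrakk> \<Longrightarrow> z \<in> U"
    "\<And>h z. \<lbrakk>\<And>z. norm (poly h z) \<le> \<eta> * (1 + norm z) ^ (degree q - 1); z \<in> \<Gamma>\<rbrakk> \<Longrightarrow> norm (poly (q + h) z) < 1"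
proof -
  define n where "n = degree q - 1"
  obtain \<eta>1 where \<eta>1: "\<eta>1 > 0"
    "\<And>h z. \<lbrakk>\<And>z. norm (poly h z) \<le> \<eta>1 * (1 + norm z) ^ n; norm (poly (q + h) z) \<le> 1\<rbrakk> \<Longrightarrow> z \<in> U"
    using sublevel_perturb_subset[OF d U] unfolding n_def by metis
  obtain \<sigma> where \<sigma>: "\<sigma> > 0" "\<And>z. z \<in> \<Gamma> \<Longrightarrow> norm (poly q z) \<le> 1 - \<sigma>"
    using compact_poly_norm_less_one[OF \<Gamma>] by metis
  obtain R where R: "R > 0" "\<And>z. z \<in> \<Gamma> \<Longrightarrow> norm z \<le> R" using compact_imp_bounded[OF \<Gamma>(1)] bounded_pos by metis
  define \<eta> where "\<eta> = min \<eta>1 (\<sigma> / (2 * (1 + R) ^ n))"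
  have \<eta>: "\<eta> > 0" "\<eta> \<le> \<eta>1" "\<eta> \<le> \<sigma> / (2 * (1 + R) ^ n)" using \<eta>1(1) \<sigma>(1) R(1) by (auto simp: \<eta>_def)
  have "norm (poly (q + h) z) < 1" if h: "\<And>z. norm (poly h z) \<le> \<eta> * (1 + norm z) ^ n" and z: "z \<in> \<Gamma>" for h z
  proof -
    have "norm (poly h z) \<le> \<sigma> / (2 * (1 + R) ^ n) * (1 + R) ^ n"
      using R(2)[OF z] \<eta> by (intro order_trans[OF h] mult_mono power_mono) auto
    also have "\<dots> < \<sigma>" using R(1) \<sigma>(1) by simp
    finally show ?thesis using \<sigma>(2)[OF z] norm_triangle_ineq[of "poly q z" "poly h z"] by simp
  qed
  moreover have "z \<in> U" if h: "\<And>z. norm (poly h z) \<le> \<eta> * (1 + norm z) ^ n" "norm (poly (q + h) z) \<le> 1" for h z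
  proof (rule \<eta>1(2)[OF _ h(2)])
    show "norm (poly h z) \<le> \<eta>1 * (1 + norm z) ^ n" for z
      by (rule order_trans[OF h(1) mult_right_mono[OF \<eta>(2)]]) simp
  qed
  ultimately show ?thesis using that[of \<eta>, folded n_def] \<eta>(1) by blast
qed

text \<open>A translation moves the interior point \<open>p\<close> of \<open>\<Gamma>\<close> to
  \<open>0\<close>, the centre of the inversion.\<close>

lemma lemniscate:
  assumes K: "K \<noteq> {}" "compact K" "connected K" and \<delta>: "\<delta> > 0"
  obtains q :: "complex poly" and \<Gamma> where "degree q > 0" "compact \<Gamma>"
    "\<And>z. norm (poly q z) \<le> 1 \<Longrightarrow> \<exists>k\<in>K. dist z k < \<delta>"
    "\<And>z. z \<in> \<Gamma> \<Longrightarrow> norm (poly q z) < 1" "\<And>k. k \<in> K \<Longrightarrow> \<exists>x\<in>\<Gamma>. dist k x < \<delta>"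
    "\<And>z. poly (pderiv q) z = 0 \<Longrightarrow> norm (poly q z) < 1"
proof -
  obtain \<Gamma> p where \<Gamma>: "treelike p \<Gamma>" "\<And>x. x \<in> \<Gamma> \<Longrightarrow> \<exists>k\<in>K. dist x k < \<delta>" "\<And>k. k \<in> K \<Longrightarrow> \<exists>x\<in>\<Gamma>. dist k x < \<delta>"
    by (rule treelike_approx[OF assms]) (blast intro: that)+
  define U where "U = (\<Union>k\<in>K. ball (k - p) \<delta>)"
  have "open U" unfolding U_def by (intro open_UN ballI open_ball)
  moreover have "bounded U"
  proof -
    obtain b where b: "\<And>k. k \<in> K \<Longrightarrow> norm k \<le> b" using compact_imp_bounded[OF K(2)] bounded_iff by metis
    have "norm z \<le> b + norm p + \<delta>" if z: "z \<in> U" for z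
    proof -
      obtain k where "k \<in> K" "z \<in> ball (k - p) \<delta>" using z unfolding U_def by blast
      then have k: "k \<in> K" "norm (z - (k - p)) < \<delta>" by (simp_all add: dist_norm norm_minus_commute)
      then show ?thesis using b[OF k(1)] norm_triangle_ineq[of "z - (k - p)" "k - p"] norm_triangle_ineq4[of k p] by simp
    qed
    then show ?thesis by (rule boundedI)
  qed
  moreover have "(\<lambda>z. z - p) ` \<Gamma> \<subseteq> U"
  proof (clarsimp simp: U_def)
    fix z assume "z \<in> \<Gamma>"
    then obtain k where "k \<in> K" "dist z k < \<delta>" using \<Gamma>(2) by blast
    then show "\<exists>k\<in>K. dist (k - p) (z - p) < \<delta>" by (auto simp: dist_commute dist_norm)
  qed
  ultimately obtain q :: "complex poly" where q: "degree q > 0" "\<And>z. norm (poly q z) \<le> 1 \<Longrightarrow> z \<in> U"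
    "\<And>z. z \<in> (\<lambda>z. z - p) ` \<Gamma> \<Longrightarrow> norm (poly q z) < 1" "\<And>z. poly (pderiv q) z = 0 \<Longrightarrow> norm (poly q z) < 1"
    using lemniscate_0[OF treelike_translate[OF \<Gamma>(1)]] by metis
  define q' where "q' = pcompose q [:-p, 1:]"
  have pq: "poly q' z = poly q (z - p)" for z by (simp add: q'_def poly_pcompose)
  show ?thesis
  proof (rule that[of q' \<Gamma>])
    show "degree q' > 0" using q(1) by (simp add: q'_def degree_pcompose)
    show "compact \<Gamma>" using \<Gamma>(1) by (simp add: treelike_def)
    show "\<exists>k\<in>K. dist z k < \<delta>" if "norm (poly q' z) \<le> 1" for z
    proof -
      have "z - p \<in> U" using q(2) that pq by simp
      then obtain k where "k \<in> K" "dist (k - p) (z - p) < \<delta>" by (auto simp: U_def)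
      then show ?thesis by (auto simp: dist_commute dist_norm intro!: bexI[of _ k])
    qed
    show "norm (poly q' z) < 1" if "poly (pderiv q') z = 0" for z
    proof -
      have "poly (pderiv q) (z - p) = 0" using that by (simp add: q'_def pderiv_pcompose poly_pcompose pderiv_pCons)
      then show ?thesis using q(4) pq by simp
    qed
  qed (use q(3) pq \<Gamma> in auto)
qed

text \<open>Adding \<open>s * z\<close> shifts \<open>q'\<close> by \<open>s\<close>. The roots of
  \<open>q' + s\<close> are simple unless \<open>- s\<close> is a value of \<open>q'\<close> at a
  root of \<open>q''\<close>, which excludes finitely many \<open>s\<close>. For small
  \<open>s\<close> the new critical points are close to the old ones, where the polynomial still has
  norm below \<open>1\<close>.\<close>

lemma lemniscate_simple:
  assumes K: "K \<noteq> {}" "compact K" "connected K" and \<delta>: "\<delta> > 0"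
  obtains q :: "complex poly" and \<Gamma> where "degree q > 0" "compact \<Gamma>"
    "\<And>z. norm (poly q z) \<le> 1 \<Longrightarrow> \<exists>k\<in>K. dist z k < \<delta>"
    "\<And>z. z \<in> \<Gamma> \<Longrightarrow> norm (poly q z) < 1" "\<And>k. k \<in> K \<Longrightarrow> \<exists>x\<in>\<Gamma>. dist k x < \<delta>"
    "\<And>z. poly (pderiv q) z = 0 \<Longrightarrow> norm (poly q z) < 1"
    "\<And>z. poly (pderiv q) z = 0 \<Longrightarrow> poly (pderiv (pderiv q)) z \<noteq> 0"
proof -
  obtain q :: "complex poly" and \<Gamma> where q: "degree q > 0" "compact \<Gamma>"
    "\<And>z. norm (poly q z) \<le> 1 \<Longrightarrow> \<exists>k\<in>K. dist z k < \<delta>"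
    "\<And>z. z \<in> \<Gamma> \<Longrightarrow> norm (poly q z) < 1" "\<And>k. k \<in> K \<Longrightarrow> \<exists>x\<in>\<Gamma>. dist k x < \<delta>"
    "\<And>z. poly (pderiv q) z = 0 \<Longrightarrow> norm (poly q z) < 1"
    using lemniscate[OF assms] by metis
  show ?thesis
  proof (cases "degree q = 1")
    case True
    then have d0: "degree (pderiv q) = 0" by (simp add: degree_pderiv)
    then obtain k where k: "pderiv q = [:k:]" using degree_eq_zeroE by blast
    then have "k \<noteq> 0" using q(1) pderiv_eq_0_iff[of q] by auto
    then show ?thesis using that[OF q] k by simp
  next
    case False
    then have d2: "degree q \<ge> 2" using q(1) by simp
    define U where "U = (\<Union>k\<in>K. ball k \<delta>)"
    have U: "open U" "\<And>z. norm (poly q z) \<le> 1 \<Longrightarrow> z \<in> U"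
      using q(3) by (auto simp: U_def dist_commute)
    define Cr where "Cr = {z. poly (pderiv q) z = 0}"
    have q'0: "pderiv q \<noteq> 0" using q(1) pderiv_eq_0_iff[of q] by auto
    then have fCr: "finite Cr" unfolding Cr_def by (rule poly_roots_finite)
    have dq': "degree (pderiv q) > 0" using d2 by (simp add: degree_pderiv)
    have "open {z. norm (poly q z) < 1}" by (intro open_Collect_less continuous_intros)
    moreover have "Cr \<subseteq> {z. norm (poly q z) < 1}" using q(6) by (auto simp: Cr_def)
    ultimately obtain e where e: "e > 0" "(\<Union>x\<in>Cr. cball x e) \<subseteq> {z. norm (poly q z) < 1}"
      using compact_subset_open_imp_cball_epsilon_subset[OF finite_imp_compact[OF fCr]] by metis
    \<comment> \<open>Discs about the critical points are added so that the same
      \<open>\<eta>\<close> also keeps the new critical values inside the unit disc.\<close>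
    define \<Gamma>' where "\<Gamma>' = \<Gamma> \<union> (\<Union>x\<in>Cr. cball x e)"
    have "compact \<Gamma>'" unfolding \<Gamma>'_def using q(2) fCr by (intro compact_Un compact_UN) auto
    moreover have "norm (poly q z) < 1" if "z \<in> \<Gamma>'" for z using that q(4) e(2) unfolding \<Gamma>'_def by blast
    ultimately obtain \<eta> where \<eta>: "\<eta> > 0"
      "\<And>h z. \<lbrakk>\<And>z. norm (poly h z) \<le> \<eta> * (1 + norm z) ^ (degree q - 1); norm (poly (q + h) z) \<le> 1\<rbrakk> \<Longrightarrow> z \<in> U"
      "\<And>h z. \<lbrakk>\<And>z. norm (poly h z) \<le> \<eta> * (1 + norm z) ^ (degree q - 1); z \<in> \<Gamma>'\<rbrakk> \<Longrightarrow> norm (poly (q + h) z) < 1"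
      using sublevel_perturb[OF q(1) U] by metis
    obtain d where d: "d > 0" "\<And>z y. norm (poly (pderiv q) z - y) < d \<Longrightarrow> \<exists>x. poly (pderiv q) x = y \<and> norm (z - x) < e"
      using poly_root_within[OF dq' e(1)] by metis
    define m where "m = min \<eta> d"
    have m: "m > 0" "m \<le> \<eta>" "m \<le> d" using \<eta>(1) d(1) by (auto simp: m_def)
    define Bad where "Bad = (\<lambda>x. - poly (pderiv q) x) ` {x. poly (pderiv (pderiv q)) x = 0}"
    have "pderiv (pderiv q) \<noteq> 0" using dq' pderiv_eq_0_iff[of "pderiv q"] by auto
    then have "finite Bad" unfolding Bad_def by (intro finite_imageI poly_roots_finite)
    moreover have "infinite (complex_of_real ` {0<..<m})"
      using m(1) by (subst finite_image_iff) (auto simp: inj_on_def infinite_Ioo)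
    ultimately have "\<not> complex_of_real ` {0<..<m} \<subseteq> Bad" using finite_subset by blast
    then obtain x where "x \<in> complex_of_real ` {0<..<m}" "x \<notin> Bad" by blast
    then obtain s where s: "0 < s" "s < m" "complex_of_real s \<notin> Bad" by auto
    define h where "h = [:0, complex_of_real s:]"
    define q1 where "q1 = q + h"
    have hz: "norm (poly h z) \<le> \<eta> * (1 + norm z) ^ (degree q - 1)" for z
    proof -
      have "norm z \<le> (1 + norm z) ^ 1" by simp
      also have "\<dots> \<le> (1 + norm z) ^ (degree q - 1)" using d2 by (intro power_increasing) auto
      finally have "s * norm z \<le> \<eta> * (1 + norm z) ^ (degree q - 1)" using s m \<eta>(1) by (intro mult_mono) auto
      then show ?thesis using s by (simp add: h_def norm_mult mult.commute)
    qed
    have dq1: "pderiv q1 = pderiv q + [:complex_of_real s:]" by (simp add: q1_def h_def pderiv_add pderiv_pCons)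
    show ?thesis
    proof (rule that[of q1 \<Gamma>])
      have "degree h < degree q" using d2 by (simp add: h_def)
      then show "degree q1 > 0" using q(1) by (simp add: q1_def degree_add_eq_left)
      show "compact \<Gamma>" by (rule q(2))
      show "\<exists>x\<in>\<Gamma>. dist k x < \<delta>" if "k \<in> K" for k by (rule q(5)[OF that])
      show "norm (poly q1 z) < 1" if "z \<in> \<Gamma>" for z using \<eta>(3)[OF hz] that by (simp add: q1_def \<Gamma>'_def)
      show "\<exists>k\<in>K. dist z k < \<delta>" if "norm (poly q1 z) \<le> 1" for z
        using \<eta>(2)[OF hz, of z] that by (auto simp: q1_def U_def dist_commute)
      show "norm (poly q1 z) < 1" if "poly (pderiv q1) z = 0" for z
      proof -
        have "poly (pderiv q) z = - of_real s" using that by (simp add: dq1 eq_neg_iff_add_eq_0)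
        then have "norm (poly (pderiv q) z - 0) < d" using s m by simp
        then obtain x where "poly (pderiv q) x = 0" "norm (z - x) < e" using d(2) by blast
        then have "z \<in> \<Gamma>'" by (auto simp: \<Gamma>'_def Cr_def dist_norm norm_minus_commute intro!: exI[of _ x])
        then show ?thesis using \<eta>(3)[OF hz] by (simp add: q1_def)
      qed
      show "poly (pderiv (pderiv q1)) z \<noteq> 0" if "poly (pderiv q1) z = 0" for z
      proof
        assume "poly (pderiv (pderiv q1)) z = 0"
        then have "poly (pderiv (pderiv q)) z = 0" by (simp add: dq1 pderiv_add pderiv_pCons)
        moreover have "of_real s = - poly (pderiv q) z" using that by (simp add: dq1 eq_neg_iff_add_eq_0 add.commute)
        ultimately show False using s(3) by (auto simp: Bad_def)
      qed
    qed
  qed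
qed

text \<open>Banach's theorem for the supremum distance over \<open>I\<close> on a ball of radius
  \<open>r\<close>: with factor \<open>1/2\<close> and a first step of at most \<open>r / 2\<close>,
  the iterates never leave the ball. The common bound \<open>D\<close> replaces a norm on the
  functions.\<close>

lemma approximate_contraction_fixpoint:
  fixes \<Phi> :: "('i \<Rightarrow> complex) \<Rightarrow> 'i \<Rightarrow> complex"
  assumes r: "r > 0"
    and contr: "\<And>y y' D. \<lbrakk>\<And>i. i \<in> I \<Longrightarrow> norm (y i - a i) \<le> r; \<And>i. i \<in> I \<Longrightarrow> norm (y' i - a i) \<le> r;
       D \<ge> 0; \<And>i. i \<in> I \<Longrightarrow> norm (y i - y' i) \<le> D\<rbrakk> \<Longrightarrow> \<forall>i\<in>I. norm (\<Phi> y i - \<Phi> y' i) \<le> D / 2"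
    and start: "\<And>i. i \<in> I \<Longrightarrow> norm (\<Phi> a i - a i) \<le> r / 2"
  obtains y where "\<And>i. i \<in> I \<Longrightarrow> norm (y i - a i) \<le> r" "\<And>i. i \<in> I \<Longrightarrow> \<Phi> y i = y i"
proof -
  define Y where "Y k = (\<Phi> ^^ k) a" for k
  have Y0: "Y 0 = a" and YS: "Y (Suc k) = \<Phi> (Y k)" for k by (simp_all add: Y_def)
  have step: "(\<forall>i\<in>I. norm (Y k i - a i) \<le> r - r / 2 ^ k) \<and> (\<forall>i\<in>I. norm (Y (Suc k) i - Y k i) \<le> r / 2 ^ Suc k)" for k
  proof (induction k)
    case 0
    then show ?case using start r by (simp add: YS Y0)
  next
    case (Suc k)
    have 1: "norm (Y (Suc k) i - a i) \<le> r - r / 2 ^ Suc k" if "i \<in> I" for i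
    proof -
      have "norm (Y (Suc k) i - a i) \<le> norm (Y (Suc k) i - Y k i) + norm (Y k i - a i)"
        using norm_triangle_ineq[of "Y (Suc k) i - Y k i" "Y k i - a i"] by simp
      also have "\<dots> \<le> r / 2 ^ Suc k + (r - r / 2 ^ k)" using Suc that by (intro add_mono) auto
      also have "\<dots> = r - r / 2 ^ Suc k" by (simp add: field_simps)
      finally show ?thesis .
    qed
    have "\<forall>i\<in>I. norm (\<Phi> (Y (Suc k)) i - \<Phi> (Y k) i) \<le> (r / 2 ^ Suc k) / 2"
    proof (rule contr)
      have p: "r / 2 ^ j \<ge> 0" for j :: nat using r by simp
      show "norm (Y (Suc k) i - a i) \<le> r" if "i \<in> I" for i using 1[OF that] p[of "Suc k"] by linarith
      show "norm (Y k i - a i) \<le> r" if "i \<in> I" for i using Suc that p[of k] by force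
    qed (use Suc r in auto)
    then show ?case using 1 by (simp add: YS)
  qed
  have inr: "norm (Y k i - a i) \<le> r" if "i \<in> I" for i k
  proof -
    have "norm (Y k i - a i) \<le> r - r / 2 ^ k" using step[of k] that by blast
    moreover have "r / 2 ^ k \<ge> 0" using r by simp
    ultimately show ?thesis by linarith
  qed
  have tail: "norm (Y (k + j) i - Y k i) \<le> r / 2 ^ k - r / 2 ^ (k + j)" if "i \<in> I" for i k j
  proof (induction j)
    case (Suc j)
    have "norm (Y (k + Suc j) i - Y k i) \<le> norm (Y (Suc (k + j)) i - Y (k + j) i) + norm (Y (k + j) i - Y k i)"
      using norm_triangle_ineq[of "Y (Suc (k + j)) i - Y (k + j) i" "Y (k + j) i - Y k i"] by simp
    also have "\<dots> \<le> r / 2 ^ Suc (k + j) + (r / 2 ^ k - r / 2 ^ (k + j))"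
      using step[of "k + j"] that Suc by (intro add_mono) auto
    also have "\<dots> = r / 2 ^ k - r / 2 ^ (k + Suc j)" by (simp add: field_simps)
    finally show ?case .
  qed simp
  have lim0: "(\<lambda>k. r / 2 ^ k) \<longlonglongrightarrow> 0"
    using LIMSEQ_divide_realpow_zero[of 2 r] by simp
  have "\<exists>l. (\<lambda>k. Y k i) \<longlonglongrightarrow> l" if i: "i \<in> I" for i
  proof -
    have "Cauchy (\<lambda>k. Y k i)"
    proof (rule metric_CauchyI)
      fix e :: real assume "e > 0"
      then have "eventually (\<lambda>k. r / 2 ^ k < e / 2) sequentially" by (intro order_tendstoD(2)[OF lim0]) simp
      then obtain k where k: "r / 2 ^ k < e / 2" by (auto simp: eventually_sequentially)
      have close: "norm (Y m i - Y k i) < e / 2" if m: "m \<ge> k" for m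
      proof -
        obtain j where j: "m = k + j" using m le_Suc_ex by blast
        have "norm (Y m i - Y k i) \<le> r / 2 ^ k - r / 2 ^ (k + j)" unfolding j by (rule tail[OF i])
        moreover have "r / 2 ^ (k + j) \<ge> 0" using r by simp
        ultimately show ?thesis using k by linarith
      qed
      have "dist (Y m i) (Y l i) < e" if "m \<ge> k" "l \<ge> k" for m l
      proof (rule dist_triangle_half_l)
        show "dist (Y m i) (Y k i) < e / 2" "dist (Y l i) (Y k i) < e / 2"
          using close that by (simp_all add: dist_norm)
      qed
      then show "\<exists>k. \<forall>m\<ge>k. \<forall>l\<ge>k. dist (Y m i) (Y l i) < e" by blast
    qed
    then show ?thesis using Cauchy_convergent convergent_def by blast
  qed
  then obtain L where L: "\<And>i. i \<in> I \<Longrightarrow> (\<lambda>k. Y k i) \<longlonglongrightarrow> L i" by metis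
  have near: "norm (L i - Y k i) \<le> r / 2 ^ k" if "i \<in> I" for i k
  proof (rule Lim_bounded)
    show "(\<lambda>j. norm (Y (k + j) i - Y k i)) \<longlonglongrightarrow> norm (L i - Y k i)"
      using L[OF that] LIMSEQ_ignore_initial_segment[OF L[OF that], of k]
      by (intro tendsto_intros) (simp add: add.commute)
    show "\<forall>j\<ge>0. norm (Y (k + j) i - Y k i) \<le> r / 2 ^ k"
    proof (intro allI impI)
      fix j have "r / 2 ^ (k + j) \<ge> 0" using r by simp
      then show "norm (Y (k + j) i - Y k i) \<le> r / 2 ^ k" using tail[OF that, of k j] by linarith
    qed
  qed
  have Lr: "norm (L i - a i) \<le> r" if "i \<in> I" for i
    using near[OF that, of 0] by (simp add: Y0)
  have "\<Phi> L i = L i" if i: "i \<in> I" for i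
  proof -
    have "norm (\<Phi> L i - L i) \<le> r / 2 ^ k" for k
    proof -
      have "\<forall>i\<in>I. norm (\<Phi> L i - \<Phi> (Y k) i) \<le> (r / 2 ^ k) / 2"
        by (rule contr) (use Lr inr near r in auto)
      then have "norm (\<Phi> L i - Y (Suc k) i) \<le> (r / 2 ^ k) / 2" using i by (simp add: YS)
      moreover have "norm (L i - Y (Suc k) i) \<le> (r / 2 ^ k) / 2" using near[OF i, of "Suc k"] by simp
      ultimately show ?thesis
        using norm_triangle_ineq4[of "\<Phi> L i - Y (Suc k) i" "L i - Y (Suc k) i"] by simp
    qed
    then have "norm (\<Phi> L i - L i) \<le> 0" using lim0 by (intro LIMSEQ_le_const) auto
    then show ?thesis by simp
  qed
  then show ?thesis using that Lr by blast
qed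

lemma poly_local_bounds:
  fixes p :: "complex poly"
  obtains B where "B > 0" "\<And>w. norm (w - c) \<le> 1 \<Longrightarrow> norm (poly p w) \<le> B"
    "\<And>w. norm (w - c) \<le> 1 \<Longrightarrow> norm (poly p w - poly p c) \<le> B * norm (w - c)"
proof -
  have bd: "\<exists>B>0. \<forall>w\<in>cball c 1. norm (poly q w) \<le> B" for q :: "complex poly"
  proof -
    have "compact (poly q ` cball c 1)" by (intro compact_continuous_image continuous_intros compact_cball)
    then obtain B where "B > 0" "\<And>x. x \<in> poly q ` cball c 1 \<Longrightarrow> norm x \<le> B"
      using compact_imp_bounded bounded_pos by metis
    then show ?thesis by blast
  qed
  obtain B1 where B1: "B1 > 0" "\<And>w. w \<in> cball c 1 \<Longrightarrow> norm (poly p w) \<le> B1" using bd by metis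
  obtain B2 where B2: "B2 > 0" "\<And>w. w \<in> cball c 1 \<Longrightarrow> norm (poly (pderiv p) w) \<le> B2" using bd by metis
  have lip: "norm (poly p w - poly p c) \<le> B2 * norm (w - c)" if "norm (w - c) \<le> 1" for w
    by (rule field_differentiable_bound[of "cball c 1" _ "poly (pderiv p)"])
       (use B2 that in \<open>auto simp: dist_norm norm_minus_commute intro: DERIV_subset[OF poly_DERIV]\<close>)
  have mono: "B2 * norm (w - c) \<le> (B1 + B2) * norm (w - c)" for w using B1(1) by (intro mult_right_mono) auto
  show ?thesis
  proof (rule that[of "B1 + B2"])
    show "norm (poly p w) \<le> B1 + B2" if "norm (w - c) \<le> 1" for w
      using B1(2)[of w] B2(1) that by (simp add: dist_norm norm_minus_commute)
    show "norm (poly p w - poly p c) \<le> (B1 + B2) * norm (w - c)" if "norm (w - c) \<le> 1" for w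
      using lip[OF that] mono[of w] by linarith
  qed (use B1 B2 in simp)
qed

lemma poly_uniform_bounds:
  fixes I :: "complex set" and P :: "complex poly set"
  assumes "finite I" "finite P"
  obtains B where "B > 0" "\<And>p c w. p \<in> P \<Longrightarrow> c \<in> I \<Longrightarrow> norm (w - c) \<le> 1 \<Longrightarrow> norm (poly p w) \<le> B"
    "\<And>p c w. p \<in> P \<Longrightarrow> c \<in> I \<Longrightarrow> norm (w - c) \<le> 1 \<Longrightarrow> norm (poly p w - poly p c) \<le> B * norm (w - c)"
proof -
  have "\<exists>B>0. \<forall>w. norm (w - c) \<le> 1 \<longrightarrow> norm (poly p w) \<le> B \<and> norm (poly p w - poly p c) \<le> B * norm (w - c)"
    for p :: "complex poly" and c
    by (rule poly_local_bounds[of c p]) blast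
  then have "\<exists>B. \<forall>(p :: complex poly) c. B p c > 0 \<and>
     (\<forall>w. norm (w - c) \<le> 1 \<longrightarrow> norm (poly p w) \<le> B p c \<and> norm (poly p w - poly p c) \<le> B p c * norm (w - c))"
    by (intro choice allI) blast
  then obtain B where B: "\<And>(p :: complex poly) c. B p c > 0"
    "\<And>(p :: complex poly) c w. norm (w - c) \<le> 1 \<Longrightarrow> norm (poly p w) \<le> B p c \<and> norm (poly p w - poly p c) \<le> B p c * norm (w - c)"
    by blast
  define M where "M = Max (insert 1 (case_prod B ` (P \<times> I)))"
  have le: "B p c \<le> M" if "p \<in> P" "c \<in> I" for p c
    unfolding M_def using assms that by (intro Max_ge) auto
  have "M \<ge> 1" unfolding M_def using assms by (intro Max_ge) auto
  moreover have "norm (poly p w - poly p c) \<le> M * norm (w - c)" if "p \<in> P" "c \<in> I" "norm (w - c) \<le> 1" for p c w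
    using B(2)[OF that(3), of p] mult_right_mono[OF le[OF that(1,2)], of "norm (w - c)"] by auto
  moreover have "norm (poly p w) \<le> M" if "p \<in> P" "c \<in> I" "norm (w - c) \<le> 1" for p c w
    using B(2)[OF that(3), of p] le[OF that(1,2)] by auto
  ultimately show ?thesis using that[of M] by auto
qed

subsection \<open>Moving the critical values\<close>

lemma eventually_mult_less_at_right_0: "e > 0 \<Longrightarrow> eventually (\<lambda>r. A * r < e) (at_right 0)" for A e :: real
proof -
  assume "e > 0"
  have "((\<lambda>r. A * r) \<longlongrightarrow> A * 0) (at_right 0)" by (intro tendsto_intros)
  then show ?thesis using \<open>e > 0\<close> by (intro order_tendstoD(2)) auto
qed

lemma pderiv_sum: "pderiv (sum f A) = (\<Sum>a\<in>A. pderiv (f a))"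
  by (induction A rule: infinite_finite_induct) (auto simp: pderiv_add)

definition lagrange_basis :: "complex set \<Rightarrow> complex \<Rightarrow> complex poly" where
  "lagrange_basis I c = (\<Prod>c'\<in>I - {c}. smult (1 / (c - c')) [:-c', 1:])"

lemma poly_lagrange_basis:
  assumes "finite I" "c' \<in> I" shows "poly (lagrange_basis I c) c' = (if c' = c then 1 else 0)"
proof (cases "c' = c")
  case False
  then have "(\<Prod>x\<in>I - {c}. poly (smult (1 / (c - x)) [:-x, 1:]) c') = 0"
    using assms by (intro prod_zero bexI[of _ c']) auto
  then show ?thesis using False by (simp add: lagrange_basis_def poly_prod)
next
  case True
  have "poly (lagrange_basis I c) c = (\<Prod>x\<in>I - {c}. poly (smult (1 / (c - x)) [:-x, 1:]) c)"
    by (simp add: lagrange_basis_def poly_prod)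
  also have "\<dots> = (\<Prod>x\<in>I - {c}. 1)"
    by (intro prod.cong refl) (auto simp: field_simps)
  finally show ?thesis using True by simp
qed

lemma degree_lagrange_basis: "finite I \<Longrightarrow> degree (lagrange_basis I c) \<le> card (I - {c})"
proof -
  assume "finite I"
  then have "degree (lagrange_basis I c) \<le> sum (degree \<circ> (\<lambda>x. smult (1 / (c - x)) [:-x, 1:])) (I - {c})"
    unfolding lagrange_basis_def by (intro degree_prod_sum_le) auto
  also have "\<dots> \<le> (\<Sum>x\<in>I - {c}. 1)" by (intro sum_mono) (auto intro: order_trans[OF degree_smult_le])
  finally show ?thesis by simp
qed

lemma simple_roots_card:
  fixes p :: "complex poly"
  assumes "p \<noteq> 0" "\<And>z. poly p z = 0 \<Longrightarrow> poly (pderiv p) z \<noteq> 0"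
  shows "card {z. poly p z = 0} = degree p"
proof -
  have "rsquarefree p" using assms by (auto simp: rsquarefree_roots)
  then have "smult (lead_coeff p) (\<Prod>z|poly p z = 0. [:-z, 1:]) = p" by (rule complex_poly_decompose_rsquarefree)
  then have "degree p = degree (\<Prod>z|poly p z = 0. [:-z, 1:])"
    using assms(1) by (metis degree_smult_eq leading_coeff_0_iff)
  also have "\<dots> = (\<Sum>z|poly p z = 0. degree [:-z, 1:])"
    by (intro degree_prod_sum_eq) auto
  finally show ?thesis by simp
qed

text \<open>The critical points \<open>x\<close> and the coefficients \<open>t\<close> of the perturbation \<open>\<Sum> t\<^sub>c L\<^sub>c\<close> in the Lagrange
  basis \<open>L\<close> at the critical points \<open>c\<close> of \<open>q\<close> are found together as a fixed point of an approximate
  Newton map. The displacements \<open>x\<^sub>c - c\<close> are rescaled by a large \<open>M\<close>, which makes the off-diagonal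
  block of the derivative small.\<close>

lemma critical_values_perturb:
  fixes q :: "complex poly"
  assumes d: "degree q > 0" and simple: "\<And>z. poly (pderiv q) z = 0 \<Longrightarrow> poly (pderiv (pderiv q)) z \<noteq> 0"
    and \<eta>: "\<eta> > 0"
  defines "I \<equiv> {z. poly (pderiv q) z = 0}"
  obtains \<delta> where "\<delta> > 0"
    "\<And>u. (\<And>c. c \<in> I \<Longrightarrow> norm (u c - poly q c) < \<delta>) \<Longrightarrow>
       \<exists>h. degree h < degree q \<and> (\<forall>z. norm (poly h z) \<le> \<eta> * (1 + norm z) ^ (degree q - 1)) \<and>
           (\<forall>z. poly (pderiv (q + h)) z = 0 \<longrightarrow> (\<exists>c\<in>I. poly (q + h) z = u c))"
proof -
  have q'0: "pderiv q \<noteq> 0" using d pderiv_eq_0_iff[of q] by auto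
  have fin: "finite I" unfolding I_def using q'0 by (rule poly_roots_finite)
  have cardI: "card I = degree q - 1"
    unfolding I_def using simple_roots_card[OF q'0 simple] by (simp add: degree_pderiv)
  define K where "K = real (card I)"
  have K0: "K \<ge> 0" by (simp add: K_def)
  define L where "L = lagrange_basis I"
  define q1 where "q1 = pderiv q"
  define q2 where "q2 = pderiv q1"
  have q1I: "poly q1 c = 0" if "c \<in> I" for c using that by (simp add: I_def q1_def)
  have q2I: "poly q2 c \<noteq> 0" if "c \<in> I" for c using that simple by (simp add: I_def q1_def q2_def)
  obtain B where B: "B > 0"
    "\<And>p c w. p \<in> {q1, q2} \<union> L ` I \<union> (\<lambda>c. pderiv (L c)) ` I \<union> (\<lambda>c. pderiv (pderiv (L c))) ` I \<Longrightarrow>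
       c \<in> I \<Longrightarrow> norm (w - c) \<le> 1 \<Longrightarrow> norm (poly p w) \<le> B"
    "\<And>p c w. p \<in> {q1, q2} \<union> L ` I \<union> (\<lambda>c. pderiv (L c)) ` I \<union> (\<lambda>c. pderiv (pderiv (L c))) ` I \<Longrightarrow>
       c \<in> I \<Longrightarrow> norm (w - c) \<le> 1 \<Longrightarrow> norm (poly p w - poly p c) \<le> B * norm (w - c)"
    by (rule poly_uniform_bounds[of I "{q1, q2} \<union> L ` I \<union> (\<lambda>c. pderiv (L c)) ` I \<union> (\<lambda>c. pderiv (pderiv (L c))) ` I"])
       (use fin in auto)
  obtain s0 where s0: "s0 > 0" "\<And>c. c \<in> I \<Longrightarrow> s0 \<le> norm (poly q2 c)"
    by (rule finite_positive_lower_bound[OF fin, of "\<lambda>c. norm (poly q2 c)"]) (use q2I in auto)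
  obtain sp where sp: "sp > 0" "\<And>c c'. c \<in> I \<Longrightarrow> c' \<in> I \<Longrightarrow> c \<noteq> c' \<Longrightarrow> sp \<le> dist c c'"
    by (rule finite_separated[OF fin]) blast
  have dL: "degree (L c) \<le> degree q - 1" if "c \<in> I" for c
    using degree_lagrange_basis[OF fin, of c] that fin unfolding cardI[symmetric] L_def
    by (meson card_mono Diff_subset order_trans)
  have "\<exists>b>0. \<forall>z. norm (poly (L c) z) \<le> b * (1 + norm z) ^ (degree q - 1)" if "c \<in> I" for c
    using poly_bound_power[OF dL[OF that]] by metis
  then obtain b where b: "\<And>c. c \<in> I \<Longrightarrow> b c > 0" "\<And>c z. c \<in> I \<Longrightarrow> norm (poly (L c) z) \<le> b c * (1 + norm z) ^ (degree q - 1)"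
    by metis
  \<comment> \<open>A change of the coefficients by \<open>D\<close> changes the derivative of
    \<open>P\<close> by at most \<open>K * B * D\<close>; after division by
    \<open>M * poly q2 c\<close> this is at most \<open>D / 4\<close>.\<close>
  define M where "M = 4 * K * B / s0 + 1"
  have M: "M > 0" "4 * K * B \<le> M * s0"
  proof -
    have "4 * K * B / s0 \<ge> 0" using K0 B s0 by simp
    then show "M > 0" by (simp add: M_def)
    have "M * s0 = 4 * K * B + s0" using s0 by (simp add: M_def field_simps)
    then show "4 * K * B \<le> M * s0" using s0 by simp
  qed
  \<comment> \<open>\<open>W * r\<close> bounds, within \<open>M * r\<close> of \<open>c\<close>,
    the derivative of \<open>P\<close> and the deviation of its second derivative from
    \<open>poly q2 c\<close>. \<open>B * M\<close> accounts for the moving point and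
    \<open>K * B\<close> for the coefficients.\<close>
  define W where "W = B * M + K * B"
  \<comment> \<open>In turn: points stay where \<open>B\<close> is valid; three estimates for a
    contraction by \<open>1/2\<close>; the perturbed critical points remain distinct;
    \<open>h\<close> obeys the bound with \<open>\<eta>\<close>.\<close>
  have "eventually (\<lambda>r. M * r < 1 \<and> W * r < s0 / 4 \<and> (W * M) * r < 1 / 4 \<and> (K * B * M) * r < 1 / 4 \<and> (2 * M) * r < sp
      \<and> sum b I * r < \<eta> \<and> r > 0) (at_right 0)"
    by (intro eventually_conj eventually_mult_less_at_right_0 eventually_at_right_less) (use s0 sp \<eta> in auto)
  then obtain r where r: "M * r < 1" "W * r < s0 / 4" "(W * M) * r < 1 / 4" "(K * B * M) * r < 1 / 4" "(2 * M) * r < sp"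
      "sum b I * r < \<eta>" "r > 0"
    by (metis (mono_tags, lifting) eventually_happens' trivial_limit_at_right_real)
  have "\<exists>h. degree h < degree q \<and> (\<forall>z. norm (poly h z) \<le> \<eta> * (1 + norm z) ^ (degree q - 1)) \<and>
           (\<forall>z. poly (pderiv (q + h)) z = 0 \<longrightarrow> (\<exists>c\<in>I. poly (q + h) z = u c))"
    if u: "\<And>c. c \<in> I \<Longrightarrow> norm (u c - poly q c) < r / 2" for u
  proof -
    \<comment> \<open>An argument over the sum type carries the scaled displacements at
      \<open>Inl\<close> and the Lagrange coefficients at \<open>Inr\<close>.\<close>
    define P where "P t = q + (\<Sum>j\<in>I. smult (t (Inr j)) (L j))" for t :: "complex + complex \<Rightarrow> complex"
    have P0: "poly (P t) w = poly q w + (\<Sum>j\<in>I. t (Inr j) * poly (L j) w)" for t w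
      by (simp add: P_def poly_sum)
    have P1: "poly (pderiv (P t)) w = poly q1 w + (\<Sum>j\<in>I. t (Inr j) * poly (pderiv (L j)) w)" for t w
      by (simp add: P_def poly_sum pderiv_add pderiv_sum pderiv_smult q1_def)
    have P2: "poly (pderiv (pderiv (P t))) w = poly q2 w + (\<Sum>j\<in>I. t (Inr j) * poly (pderiv (pderiv (L j))) w)" for t w
      by (simp add: P_def poly_sum pderiv_add pderiv_sum pderiv_smult q1_def q2_def)
    define x where "x y c = c + of_real M * y (Inl c)" for y :: "complex + complex \<Rightarrow> complex" and c
    \<comment> \<open>At the start the derivative of \<open>P' (x_c)\<close> in its own displacement
      is \<open>M * poly q2 c\<close>, and that of \<open>P (x_c)\<close> in its own coefficient is
      \<open>1\<close>; these are the Newton divisors. To first order \<open>P (x_c)\<close> does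
      not feel the displacement, as \<open>q' c = 0\<close>.\<close>
    define \<Phi> where "\<Phi> y i = (case i of Inl c \<Rightarrow> y (Inl c) - poly (pderiv (P y)) (x y c) / (of_real M * poly q2 c)
       | Inr c \<Rightarrow> y (Inr c) - poly (P y) (x y c) + u c)" for y :: "complex + complex \<Rightarrow> complex" and i
    define J where "J = Inl ` I \<union> Inr ` I"
    have sum_le: "norm (\<Sum>j\<in>I. f j * g j) \<le> K * (D * C)"
      if "\<And>j. j \<in> I \<Longrightarrow> norm (f j) \<le> D" "\<And>j. j \<in> I \<Longrightarrow> norm (g j) \<le> C" "D \<ge> 0" for f g :: "complex \<Rightarrow> complex" and D C
    proof -
      have "norm (\<Sum>j\<in>I. f j * g j) \<le> (\<Sum>j\<in>I. D * C)"
        using that by (intro sum_norm_le) (auto simp: norm_mult intro!: mult_mono)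
      then show ?thesis by (simp add: K_def)
    qed
    have xr: "norm (x y c - c) \<le> M * r" if "\<And>i. i \<in> J \<Longrightarrow> norm (y i) \<le> r" "c \<in> I" for y c
      using that M by (auto simp: x_def norm_mult J_def intro!: mult_left_mono)
    obtain y where y: "\<And>i. i \<in> J \<Longrightarrow> norm (y i - 0) \<le> r" "\<And>i. i \<in> J \<Longrightarrow> \<Phi> y i = y i"
    proof (rule approximate_contraction_fixpoint[of r J "\<lambda>_. 0" \<Phi>])
      show "r > 0" by (rule r(7))
      show "norm (\<Phi> (\<lambda>_. 0) i - 0) \<le> r / 2" if "i \<in> J" for i
        using that u r(7) by (auto simp: J_def \<Phi>_def x_def P0 P1 q1I less_imp_le norm_minus_commute)
    next
      fix y y' :: "complex + complex \<Rightarrow> complex" and D :: real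
      assume y0: "\<And>i. i \<in> J \<Longrightarrow> norm (y i - 0) \<le> r" and y'0: "\<And>i. i \<in> J \<Longrightarrow> norm (y' i - 0) \<le> r"
        and D: "D \<ge> 0" and yy: "\<And>i. i \<in> J \<Longrightarrow> norm (y i - y' i) \<le> D"
      have y: "norm (y i) \<le> r" if "i \<in> J" for i using y0[OF that] by simp
      have y': "norm (y' i) \<le> r" if "i \<in> J" for i using y'0[OF that] by simp
      have ty: "norm (y (Inr j)) \<le> r" "norm (y (Inr j) - y' (Inr j)) \<le> D" if "j \<in> I" for j
        using y yy that by (auto simp: J_def)
      have main: "norm (\<Phi> y (Inl c) - \<Phi> y' (Inl c)) \<le> D / 2 \<and> norm (\<Phi> y (Inr c) - \<Phi> y' (Inr c)) \<le> D / 2" if c: "c \<in> I" for c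
      proof -
        define X where "X = x y c"
        define X' where "X' = x y' c"
        have X: "X \<in> cball c (M * r)" "X' \<in> cball c (M * r)"
          using xr[OF y c] xr[OF y' c] by (auto simp: X_def X'_def dist_norm norm_minus_commute)
        have XX: "norm (X - X') \<le> M * D"
        proof -
          have "X - X' = of_real M * (y (Inl c) - y' (Inl c))" by (simp add: X_def X'_def x_def algebra_simps)
          then show ?thesis using M yy[of "Inl c"] c by (simp add: norm_mult J_def)
        qed
        have near: "norm (w - c) \<le> M * r" "norm (w - c) \<le> 1" if "w \<in> cball c (M * r)" for w
          using that r(1) by (auto simp: dist_norm norm_minus_commute)
        have X'1: "norm (X' - c) \<le> M * r" "norm (X' - c) \<le> 1" using near X by auto
        have q2c: "s0 \<le> norm (poly q2 c)" "poly q2 c \<noteq> 0" using s0 c q2I by auto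
        \<comment> \<open>With the linear part \<open>poly q2 c * w\<close> taken out, the remainder
          has a small derivative.\<close>
        have G: "norm ((poly q2 c * X - poly (pderiv (P y)) X) - (poly q2 c * X' - poly (pderiv (P y)) X')) \<le> W * r * norm (X - X')"
        proof (rule field_differentiable_bound[of "cball c (M * r)" _ "\<lambda>w. poly q2 c - poly (pderiv (pderiv (P y))) w"])
          fix w assume w: "w \<in> cball c (M * r)"
          show "((\<lambda>w. poly q2 c * w - poly (pderiv (P y)) w) has_field_derivative poly q2 c - poly (pderiv (pderiv (P y))) w) (at w within cball c (M * r))"
            by (auto intro!: derivative_eq_intros DERIV_subset[OF poly_DERIV])
          have "norm (poly q2 w - poly q2 c) \<le> B * norm (w - c)" using near[OF w] c by (intro B(3)) auto
          also have "\<dots> \<le> B * (M * r)" using near[OF w] B by (intro mult_left_mono) auto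
          finally have 1: "norm (poly q2 w - poly q2 c) \<le> B * (M * r)" .
          have 2: "norm (\<Sum>j\<in>I. y (Inr j) * poly (pderiv (pderiv (L j))) w) \<le> K * (r * B)"
            using ty near[OF w] c r(7) by (intro sum_le B(2)) auto
          have "poly q2 c - poly (pderiv (pderiv (P y))) w = - (poly q2 w - poly q2 c) - (\<Sum>j\<in>I. y (Inr j) * poly (pderiv (pderiv (L j))) w)"
            by (simp add: P2)
          then have "norm (poly q2 c - poly (pderiv (pderiv (P y))) w) \<le> norm (- (poly q2 w - poly q2 c)) + norm (\<Sum>j\<in>I. y (Inr j) * poly (pderiv (pderiv (L j))) w)"
            by (simp only: norm_triangle_ineq4)
          also have "\<dots> \<le> B * (M * r) + K * (r * B)" unfolding norm_minus_cancel using 1 2 by (rule add_mono)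
          also have "\<dots> = W * r" by (simp add: W_def algebra_simps)
          finally show "norm (poly q2 c - poly (pderiv (pderiv (P y))) w) \<le> W * r" .
        qed (use X in auto)
        have H: "norm (poly (P y) X - poly (P y) X') \<le> W * r * norm (X - X')"
        proof (rule field_differentiable_bound[of "cball c (M * r)" _ "poly (pderiv (P y))"])
          fix w assume w: "w \<in> cball c (M * r)"
          show "(poly (P y) has_field_derivative poly (pderiv (P y)) w) (at w within cball c (M * r))"
            by (auto intro!: DERIV_subset[OF poly_DERIV])
          have "norm (poly q1 w - poly q1 c) \<le> B * norm (w - c)" using near[OF w] c by (intro B(3)) auto
          also have "\<dots> \<le> B * (M * r)" using near[OF w] B by (intro mult_left_mono) auto
          finally have 1: "norm (poly q1 w) \<le> B * (M * r)" using q1I[OF c] by simp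
          have 2: "norm (\<Sum>j\<in>I. y (Inr j) * poly (pderiv (L j)) w) \<le> K * (r * B)"
            using ty near[OF w] c r(7) by (intro sum_le B(2)) auto
          have "norm (poly (pderiv (P y)) w) \<le> B * (M * r) + K * (r * B)"
            unfolding P1 using 1 2 norm_triangle_ineq[of "poly q1 w" "\<Sum>j\<in>I. y (Inr j) * poly (pderiv (L j)) w"] by simp
          also have "\<dots> = W * r" by (simp add: W_def algebra_simps)
          finally show "norm (poly (pderiv (P y)) w) \<le> W * r" .
        qed (use X in auto)
        have W0: "W \<ge> 0" unfolding W_def using B M K0 by simp
        have WX: "W * r * norm (X - X') \<le> W * r * (M * D)"
          using XX W0 r(7) by (intro mult_left_mono) auto
        have T1: "norm (poly (pderiv (P y)) X' - poly (pderiv (P y')) X') \<le> K * (D * B)"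
        proof -
          have "poly (pderiv (P y)) X' - poly (pderiv (P y')) X' = (\<Sum>j\<in>I. (y (Inr j) - y' (Inr j)) * poly (pderiv (L j)) X')"
            by (simp add: P1 left_diff_distrib sum_subtractf)
          then show ?thesis using ty X'1 c D by (auto intro!: sum_le B(2))
        qed
        \<comment> \<open>In the Lagrange basis, \<open>y (Inr c)\<close> is the value of the
          perturbation at \<open>c\<close> itself, so only the variation of the basis between
          \<open>c\<close> and \<open>X'\<close> remains.\<close>
        have T2: "norm ((y (Inr c) - y' (Inr c)) - (poly (P y) X' - poly (P y') X')) \<le> K * (D * (B * (M * r)))"
        proof -
          have "y (Inr c) - y' (Inr c) = (\<Sum>j\<in>I. if j = c then y (Inr c) - y' (Inr c) else 0)"
            using fin c by simp
          also have "\<dots> = (\<Sum>j\<in>I. (y (Inr j) - y' (Inr j)) * poly (L j) c)"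
            using c fin by (intro sum.cong refl) (auto simp: L_def poly_lagrange_basis)
          finally have "(y (Inr c) - y' (Inr c)) - (poly (P y) X' - poly (P y') X') =
             (\<Sum>j\<in>I. (y (Inr j) - y' (Inr j)) * (poly (L j) c - poly (L j) X'))"
            by (simp add: P0 algebra_simps sum_subtractf sum.distrib)
          also have "norm \<dots> \<le> K * (D * (B * (M * r)))"
          proof (rule sum_le)
            fix j assume j: "j \<in> I"
            have "norm (poly (L j) X' - poly (L j) c) \<le> B * norm (X' - c)" using j X'1 c by (intro B(3)) auto
            also have "\<dots> \<le> B * (M * r)" using X'1 B by (intro mult_left_mono) auto
            finally show "norm (poly (L j) c - poly (L j) X') \<le> B * (M * r)" by (simp add: norm_minus_commute)
          qed (use ty D in auto)
          finally show ?thesis .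
        qed
        have "norm (\<Phi> y (Inl c) - \<Phi> y' (Inl c)) \<le> D / 2"
        proof -
          define N where "N = (poly q2 c * X - poly (pderiv (P y)) X) - (poly q2 c * X' - poly (pderiv (P y)) X')
             - (poly (pderiv (P y)) X' - poly (pderiv (P y')) X')"
          have X_eq: "X = c + of_real M * y (Inl c)" "X' = c + of_real M * y' (Inl c)" by (simp_all add: X_def X'_def x_def)
          have "\<Phi> y (Inl c) - \<Phi> y' (Inl c) = y (Inl c) - y' (Inl c) - (poly (pderiv (P y)) X - poly (pderiv (P y')) X') / (of_real M * poly q2 c)"
            by (simp add: \<Phi>_def X_def X'_def diff_divide_distrib)
          also have "y (Inl c) - y' (Inl c) = (poly q2 c * (X - X')) / (of_real M * poly q2 c)"
            using M(1) q2c by (simp add: X_eq field_simps)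
          finally have "\<Phi> y (Inl c) - \<Phi> y' (Inl c) = (poly q2 c * (X - X') - (poly (pderiv (P y)) X - poly (pderiv (P y')) X')) / (of_real M * poly q2 c)"
            by (simp only: diff_divide_distrib)
          moreover have "poly q2 c * (X - X') - (poly (pderiv (P y)) X - poly (pderiv (P y')) X') = N"
            by (simp add: N_def algebra_simps)
          ultimately have "\<Phi> y (Inl c) - \<Phi> y' (Inl c) = N / (of_real M * poly q2 c)" by simp
          then have e: "norm (\<Phi> y (Inl c) - \<Phi> y' (Inl c)) = norm N / (M * norm (poly q2 c))"
            using M(1) by (simp add: norm_divide norm_mult)
          have N1: "norm N \<le> W * r * (M * D) + K * (D * B)"
            unfolding N_def using G T1 WX
              norm_triangle_ineq4[of "(poly q2 c * X - poly (pderiv (P y)) X) - (poly q2 c * X' - poly (pderiv (P y)) X')"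
                "poly (pderiv (P y)) X' - poly (pderiv (P y')) X'"] by linarith
          have "W * r * (M * D) \<le> s0 / 4 * (M * D)" using r(2) M D by (intro mult_right_mono) auto
          moreover have "K * (D * B) \<le> M * s0 / 4 * D" using mult_right_mono[OF M(2) D] by (simp add: algebra_simps)
          ultimately have "norm N \<le> D / 2 * (M * s0)" using N1 by (simp add: algebra_simps)
          also have "\<dots> \<le> D / 2 * (M * norm (poly q2 c))" using D M q2c by (intro mult_left_mono) auto
          finally show ?thesis unfolding e using M(1) q2c by (simp add: pos_divide_le_eq)
        qed
        moreover have "norm (\<Phi> y (Inr c) - \<Phi> y' (Inr c)) \<le> D / 2"
        proof -
          have "\<Phi> y (Inr c) - \<Phi> y' (Inr c) = ((y (Inr c) - y' (Inr c)) - (poly (P y) X' - poly (P y') X')) - (poly (P y) X - poly (P y) X')"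
            by (simp add: \<Phi>_def X_def X'_def)
          then have "norm (\<Phi> y (Inr c) - \<Phi> y' (Inr c)) \<le> norm ((y (Inr c) - y' (Inr c)) - (poly (P y) X' - poly (P y') X')) + norm (poly (P y) X - poly (P y) X')"
            by (simp only: norm_triangle_ineq4)
          also have "\<dots> \<le> K * (D * (B * (M * r))) + W * r * (M * D)"
            using T2 H WX by linarith
          also have "\<dots> = (K * B * M * r) * D + (W * M * r) * D" by (simp add: algebra_simps)
          also have "\<dots> \<le> 1 / 4 * D + 1 / 4 * D" using r D by (intro add_mono mult_right_mono) auto
          finally show ?thesis by simp
        qed
        ultimately show ?thesis by blast
      qed
      then show "\<forall>i\<in>J. norm (\<Phi> y i - \<Phi> y' i) \<le> D / 2" by (auto simp: J_def)
    qed auto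
    have yr: "norm (y i) \<le> r" if "i \<in> J" for i using y(1)[OF that] by simp
    define h where "h = (\<Sum>j\<in>I. smult (y (Inr j)) (L j))"
    have Ph: "P y = q + h" by (simp add: P_def h_def)
    have dh: "degree h < degree q"
    proof -
      have "degree h \<le> degree q - 1" unfolding h_def
        by (intro degree_sum_le) (use fin dL in \<open>auto intro: order_trans[OF degree_smult_le]\<close>)
      then show ?thesis using d by simp
    qed
    have hb: "norm (poly h z) \<le> \<eta> * (1 + norm z) ^ (degree q - 1)" for z
    proof -
      have "norm (poly h z) \<le> (\<Sum>j\<in>I. r * (b j * (1 + norm z) ^ (degree q - 1)))"
        unfolding h_def poly_sum
      proof (rule sum_norm_le)
        fix j assume j: "j \<in> I"
        have "norm (y (Inr j)) \<le> r" using yr j by (auto simp: J_def)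
        then show "norm (poly (smult (y (Inr j)) (L j)) z) \<le> r * (b j * (1 + norm z) ^ (degree q - 1))"
          using b(2)[OF j, of z] r(7) by (auto simp: norm_mult intro!: mult_mono)
      qed
      also have "\<dots> = (sum b I * r) * (1 + norm z) ^ (degree q - 1)"
        by (simp add: sum_distrib_left sum_distrib_right mult_ac)
      also have "\<dots> \<le> \<eta> * (1 + norm z) ^ (degree q - 1)" using r(6) by (intro mult_right_mono) auto
      finally show ?thesis .
    qed
    have cr: "poly (pderiv (q + h)) (x y c) = 0" "poly (q + h) (x y c) = u c" if c: "c \<in> I" for c
    proof -
      have "\<Phi> y (Inl c) = y (Inl c)" "\<Phi> y (Inr c) = y (Inr c)" using y(2) c by (auto simp: J_def)
      then have "poly (pderiv (P y)) (x y c) = 0" "poly (P y) (x y c) = u c"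
        using M(1) q2I[OF c] by (auto simp: \<Phi>_def)
      then show "poly (pderiv (q + h)) (x y c) = 0" "poly (q + h) (x y c) = u c" by (simp_all only: Ph)
    qed
    have inj: "inj_on (x y) I"
    proof (rule inj_onI, rule ccontr)
      fix c c' assume c: "c \<in> I" "c' \<in> I" "x y c = x y c'" "c \<noteq> c'"
      have "dist c c' \<le> norm (x y c - c) + norm (x y c' - c')"
        using c(3) norm_triangle_ineq4[of "x y c' - c'" "x y c - c"] by (simp add: dist_norm)
      also have "\<dots> \<le> M * r + M * r" using xr[of y c, OF yr c(1)] xr[of y c', OF yr c(2)] by simp
      finally show False using sp(2)[OF c(1,2,4)] r(5) by simp
    qed
    have dqh: "degree (q + h) = degree q" using dh by (rule degree_add_eq_left)
    then have nz: "pderiv (q + h) \<noteq> 0" using d pderiv_eq_0_iff[of "q + h"] by auto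
    \<comment> \<open>These are \<open>degree q - 1\<close> distinct zeros of
      \<open>pderiv (q + h)\<close>, hence all of them: no critical value escapes the
      prescription.\<close>
    have "x y ` I = {z. poly (pderiv (q + h)) z = 0}"
    proof (rule card_seteq[OF poly_roots_finite[OF nz]])
      show "x y ` I \<subseteq> {z. poly (pderiv (q + h)) z = 0}" using cr by auto
      have "card {z. poly (pderiv (q + h)) z = 0} \<le> degree q - 1"
        using card_poly_roots_bound[OF nz] by (simp add: degree_pderiv dqh)
      then show "card {z. poly (pderiv (q + h)) z = 0} \<le> card (x y ` I)" by (simp add: card_image[OF inj] cardI)
    qed
    then have "\<exists>c\<in>I. poly (q + h) z = u c" if "poly (pderiv (q + h)) z = 0" for z
      using cr(2) that by (metis (mono_tags, lifting) imageE mem_Collect_eq)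
    then show ?thesis using dh hb by blast
  qed
  then show ?thesis using that[of "r / 2"] r(7) by auto
qed

subsection \<open>Stars and Chebyshev polynomials\<close>

fun cheb :: "nat \<Rightarrow> complex poly" where
  "cheb 0 = 1"
| "cheb (Suc 0) = [:0, 1:]"
| "cheb (Suc (Suc m)) = [:0, 2:] * cheb (Suc m) - cheb m"

lemma poly_cheb_cos: "poly (cheb m) (cos z) = cos (of_nat m * z)"
proof (induction m rule: cheb.induct)
  case (3 m)
  have "cos (of_nat (Suc (Suc m)) * z) + cos (of_nat m * z) = 2 * cos z * cos (of_nat (Suc m) * z)"
  proof -
    have "of_nat (Suc (Suc m)) * z = of_nat (Suc m) * z + z" "of_nat m * z = of_nat (Suc m) * z - z"
      by (simp_all add: algebra_simps)
    then show ?thesis by (simp only: cos_add cos_diff) (simp add: algebra_simps)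
  qed
  then show ?case using 3 by (simp add: algebra_simps)
qed auto

lemma complex_cos_surj: obtains w :: complex where "cos w = v"
  using cos_Arccos by metis

text \<open>Differentiating \<open>poly (cheb m) (cos z) = cos (m z)\<close> at a preimage
  \<open>w\<close> of \<open>v\<close> gives \<open>sin (m w) = 0\<close>, whether or not
  \<open>sin w\<close> vanishes.\<close>

lemma cheb_critical:
  assumes "m > 0" "poly (pderiv (cheb m)) v = 0"
  shows "poly (cheb m) v = 1 \<or> poly (cheb m) v = - 1"
proof -
  obtain w where w: "cos w = v" by (rule complex_cos_surj)
  have "((\<lambda>z. poly (cheb m) (cos z)) has_field_derivative poly (pderiv (cheb m)) (cos w) * (- sin w)) (at w)"
    by (rule DERIV_chain2[OF poly_DERIV DERIV_cos])
  moreover have "((\<lambda>z. cos (of_nat m * z)) has_field_derivative - sin (of_nat m * w) * of_nat m) (at w)"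
    by (auto intro!: derivative_eq_intros)
  ultimately have "poly (pderiv (cheb m)) (cos w) * (- sin w) = - sin (of_nat m * w) * of_nat m"
    unfolding poly_cheb_cos by (rule DERIV_unique)
  then have "sin (of_nat m * w) = 0" using assms w by simp
  then have "(cos (of_nat m * w))\<^sup>2 = 1" by (simp add: cos_squared_eq)
  then have "cos (of_nat m * w) = 1 \<or> cos (of_nat m * w) = - 1" by (simp add: power2_eq_1_iff)
  then show ?thesis using poly_cheb_cos[of m w] w by simp
qed

text \<open>If \<open>cos (m w)\<close> lies in \<open>[-1, 1]\<close>, then \<open>m w\<close>, and
  hence \<open>w\<close>, is real.\<close>

lemma cheb_seg:
  assumes "m > 0" shows "poly (cheb m) v \<in> seg \<longleftrightarrow> v \<in> seg"
proof
  assume a: "poly (cheb m) v \<in> seg"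
  obtain w where w: "cos w = v" by (rule complex_cos_surj)
  have "cosh (- \<i> * (of_nat m * w)) = cos (of_nat m * w)" by (simp add: cosh_conv_cos)
  then have "cosh (- \<i> * (of_nat m * w)) \<in> seg" using a poly_cheb_cos[of m w] w by simp
  then have "Re (- \<i> * (of_nat m * w)) = 0" by (rule cosh_in_seg)
  then have "Im w = 0" using assms by simp
  then have "w = of_real (Re w)" by (simp add: complex_eq_iff)
  then have "v = of_real (cos (Re w))" using w by (metis cos_of_real)
  then show "v \<in> seg" by (auto simp: seg_def)
next
  assume "v \<in> seg"
  then obtain t where t: "t \<in> {-1..1}" "v = of_real t" by (auto simp: seg_def)
  then have "v = cos (of_real (arccos t))" by (simp add: cos_of_real)
  then have "poly (cheb m) v = cos (of_nat m * of_real (arccos t))" by (simp only: poly_cheb_cos)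
  also have "\<dots> = of_real (cos (real m * arccos t))" by (simp flip: cos_of_real)
  finally show "poly (cheb m) v \<in> seg" by (auto simp: seg_def)
qed

text \<open>The star of \<open>N\<close> unit segments is the preimage of \<open>[-1, 1]\<close> under \<open>2 w ^ N - 1\<close>.\<close>

definition star_poly :: "nat \<Rightarrow> nat \<Rightarrow> complex poly \<Rightarrow> complex poly" where
  "star_poly m N q = pcompose (cheb m) ([:-1:] + smult 2 (q ^ N))"

lemma poly_star_poly: "poly (star_poly m N q) z = poly (cheb m) (2 * poly q z ^ N - 1)"
  by (simp add: star_poly_def poly_pcompose poly_power)

lemma star_poly_seg:
  assumes "m > 0" shows "poly (star_poly m N q) z \<in> seg \<longleftrightarrow> poly q z ^ N \<in> of_real ` {0..1}"
proof -
  have "2 * x - 1 \<in> seg \<longleftrightarrow> x \<in> of_real ` {0..1}" for x :: complex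
  proof
    assume "2 * x - 1 \<in> seg"
    then obtain t where t: "t \<in> {-1..1}" "2 * x - 1 = of_real t" by (auto simp: seg_def)
    then have "x = of_real ((t + 1) / 2)" by (simp add: field_simps)
    moreover have "(t + 1) / 2 \<in> {0..1}" using t by auto
    ultimately show "x \<in> of_real ` {0..1}" by blast
  next
    assume "x \<in> of_real ` {0..1}"
    then obtain t where t: "t \<in> {0..1}" "x = of_real t" by auto
    then have "2 * x - 1 = of_real (2 * t - 1)" "2 * t - 1 \<in> {-1..1}" by auto
    then show "2 * x - 1 \<in> seg" unfolding seg_def by blast
  qed
  then show ?thesis unfolding poly_star_poly cheb_seg[OF assms] .
qed

lemma cheb_at_angle:
  assumes "m > 0" "v = of_real (cos (pi * real k / real m))"
  shows "poly (cheb m) v = (-1) ^ k"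
proof -
  have "v = cos (of_real (pi * real k / real m))" using assms(2) by (simp only: cos_of_real)
  then have "poly (cheb m) v = cos (of_nat m * of_real (pi * real k / real m))" by (simp only: poly_cheb_cos)
  also have "of_nat m * of_real (pi * real k / real m) = complex_of_real (real k * pi)"
    using assms by simp
  also have "cos \<dots> = of_real (cos (real k * pi))" by (rule cos_of_real)
  finally show ?thesis by simp
qed

text \<open>By the chain rule a critical point comes from \<open>cheb m\<close>, from a zero of
  \<open>q\<close>, where \<open>2 * 0 - 1 = cos pi\<close>, or from a critical point of
  \<open>q\<close>. In the last two cases \<open>cheb m\<close> is evaluated at some
  \<open>cos (pi k / m)\<close>, where it is \<open>1\<close> or \<open>-1\<close>.\<close>

lemma shabat_star_poly:
  assumes m: "m > 0" and N: "N > 0" and q: "degree q > 0"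
    and crit: "\<And>z. poly (pderiv q) z = 0 \<Longrightarrow> \<exists>k. 2 * poly q z ^ N - 1 = of_real (cos (pi * real k / real m))"
  shows "shabat (star_poly m N q)"
proof
  have pm: "x = 1 \<or> x = - 1" if "x = (-1) ^ k" for x :: complex and k
    using that by (cases "even k") auto
  show "poly (star_poly m N q) z = 1 \<or> poly (star_poly m N q) z = - 1"
    if "poly (pderiv (star_poly m N q)) z = 0" for z
  proof -
    have "pderiv (q ^ N) = smult (of_nat N) (q ^ (N - 1) * pderiv q)"
      using N pderiv_power_Suc[of q "N - 1"] by simp
    then have "poly (pderiv (cheb m)) (2 * poly q z ^ N - 1) * (2 * (of_nat N * (poly q z ^ (N - 1) * poly (pderiv q) z))) = 0"
      using that by (auto simp: star_poly_def pderiv_pcompose poly_pcompose pderiv_add pderiv_smult pderiv_pCons poly_power)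
    then consider "poly (pderiv (cheb m)) (2 * poly q z ^ N - 1) = 0" | "poly q z = 0" | "poly (pderiv q) z = 0"
      using N by auto
    then show ?thesis
    proof cases
      case 1
      then show ?thesis unfolding poly_star_poly using cheb_critical[OF m] by blast
    next
      case 2
      then have "2 * poly q z ^ N - 1 = of_real (cos (pi * real m / real m))" using N m by simp
      then have "poly (star_poly m N q) z = (-1) ^ m" unfolding poly_star_poly by (rule cheb_at_angle[OF m])
      then show ?thesis by (rule pm)
    next
      case 3
      then obtain k where "2 * poly q z ^ N - 1 = of_real (cos (pi * real k / real m))" using crit by blast
      then have "poly (star_poly m N q) z = (-1) ^ k" unfolding poly_star_poly by (rule cheb_at_angle[OF m])
      then show ?thesis by (rule pm)
    qed
  qed
  show "degree (star_poly m N q) > 0"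
  proof (rule ccontr)
    assume "\<not> degree (star_poly m N q) > 0"
    then obtain c where c: "star_poly m N q = [:c:]" using degree_eq_zeroE by blast
    \<comment> \<open>The inner polynomial is onto and reaches every \<open>cos (pi k / m)\<close>,
      so a constant would equal both \<open>1\<close> and \<open>-1\<close>.\<close>
    have val: "c = (-1) ^ k" for k
    proof -
      define x where "x = (of_real (cos (pi * real k / real m)) + 1 :: complex) / 2"
      obtain y where y: "y ^ N = x" using N exists_complex_root[of N x] by auto
      obtain z where z: "poly q z = y" using poly_root_near[OF q] by metis
      have "2 * poly q z ^ N - 1 = of_real (cos (pi * real k / real m))" by (simp add: z y x_def field_simps)
      then have "poly (star_poly m N q) z = (-1) ^ k" unfolding poly_star_poly by (rule cheb_at_angle[OF m])
      then show ?thesis by (simp add: c)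
    qed
    show False using val[of 0] val[of 1] by simp
  qed
qed

section \<open>Approximation by admissible points on the radii of the star\<close>

lemma norm_cis_diff_le: "norm (cis a - cis b) \<le> \<bar>a - b\<bar>"
proof -
  have "norm (exp (\<i> * a) - exp (\<i> * b)) \<le> 1 * norm (\<i> * a - \<i> * b)"
    by (rule field_differentiable_bound[of "{z. Re z \<le> 0}" exp exp])
       (auto simp: convex_halfspace_Re_le norm_exp_eq_Re intro!: derivative_eq_intros)
  also have "\<i> * a - \<i> * b = \<i> * of_real (a - b)" by (simp add: algebra_simps)
  finally show ?thesis by (simp add: cis_conv_exp norm_mult flip: of_real_diff)
qed

lemma near_grid:
  fixes x h :: real assumes "h > 0" "x \<ge> 0"
  obtains k :: nat where "\<bar>x - real k * h\<bar> \<le> h"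
proof -
  define k where "k = nat \<lfloor>x / h\<rfloor>"
  have "x / h \<ge> 0" using assms by simp
  then have "real k \<le> x / h" "x / h < real k + 1" unfolding k_def by linarith+
  then have "real k * h \<le> x" "x < (real k + 1) * h" using assms by (simp_all add: pos_le_divide_eq pos_divide_less_eq)
  then show ?thesis using that[of k] by (simp add: algebra_simps)
qed

text \<open>The argument of \<open>w\<close> is rounded to a multiple of
  \<open>2 pi / N\<close>.\<close>

lemma near_star:
  fixes w :: complex
  assumes "N > 0" obtains u where "u ^ N = 1" "norm u = 1" "norm (w - of_real (norm w) * u) \<le> norm w * (2 * pi / N)"
proof -
  define a where "a = Arg2pi w"
  have w: "w = of_real (norm w) * cis a" unfolding a_def by (metis Arg2pi_eq cis_conv_exp)
  have h: "2 * pi / N > 0" "a \<ge> 0" using assms Arg2pi[of w] by (auto simp: a_def)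
  obtain k :: nat where k: "\<bar>a - real k * (2 * pi / N)\<bar> \<le> 2 * pi / N" using near_grid[OF h] .
  define u where "u = cis (real k * (2 * pi / N))"
  have "u ^ N = cis (real N * (real k * (2 * pi / N)))" unfolding u_def by (rule Complex.DeMoivre)
  also have "real N * (real k * (2 * pi / N)) = 2 * pi * real k" using assms by simp
  also have "cis \<dots> = 1" by (rule cis_multiple_2pi) simp
  finally have "u ^ N = 1" .
  moreover have "norm (w - of_real (norm w) * u) \<le> norm w * (2 * pi / N)"
  proof -
    have "w - of_real (norm w) * u = of_real (norm w) * (cis a - u)" using w by (simp add: algebra_simps)
    then have "norm (w - of_real (norm w) * u) = norm w * norm (cis a - u)" by (simp add: norm_mult)
    also have "\<dots> \<le> norm w * (2 * pi / N)"
      unfolding u_def using order_trans[OF norm_cis_diff_le k] by (rule mult_left_mono) simp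
    finally show ?thesis .
  qed
  moreover have "norm u = 1" by (simp add: u_def)
  ultimately show ?thesis using that by blast
qed

text \<open>On the radius through \<open>u\<close> the points \<open>v = f s * u\<close> satisfy
  \<open>2 v ^ N - 1 = cos s\<close>. As \<open>f\<close> is continuous with
  \<open>f s0 = \<rho>\<close>, an angle \<open>pi k / m\<close> close to \<open>s0\<close>
  suffices. It exists for every large \<open>m\<close>, so one \<open>m\<close> can serve several
  points.\<close>

lemma near_star_vertex:
  fixes u :: complex
  assumes N: "N > 0" and u: "u ^ N = 1" "norm u = 1" and \<rho>: "0 \<le> \<rho>" "\<rho> \<le> 1" and e: "e > 0"
  shows "eventually (\<lambda>m. \<exists>k v. norm (v - of_real \<rho> * u) < e \<and> 2 * v ^ N - 1 = of_real (cos (pi * real k / real m))) sequentially"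
proof -
  define f where "f s = root N ((1 + cos s) / 2)" for s
  define s0 where "s0 = arccos (2 * \<rho> ^ N - 1)"
  have r: "0 \<le> \<rho> ^ N" "\<rho> ^ N \<le> 1" using \<rho> by (auto simp: power_le_one)
  have f0: "f s0 = \<rho>" using r \<rho> N by (simp add: f_def s0_def cos_arccos real_root_power_cancel)
  have s0: "s0 \<ge> 0" unfolding s0_def using r by (intro arccos_lbound) auto
  have "isCont f s0" unfolding f_def by (intro continuous_intros) simp
  then obtain d where d: "d > 0" "\<And>s. \<bar>s - s0\<bar> < d \<Longrightarrow> \<bar>f s - f s0\<bar> < e"
    using e unfolding continuous_at_eps_delta dist_real_def by blast
  have "eventually (\<lambda>m. pi / real m < d) sequentially"
  proof -
    have "(\<lambda>m. pi * inverse (real m)) \<longlonglongrightarrow> pi * 0" by (intro tendsto_intros lim_inverse_n)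
    then show ?thesis using d(1) by (intro order_tendstoD(2)) (simp_all add: divide_inverse)
  qed
  then show ?thesis using eventually_gt_at_top[of 0]
  proof eventually_elim
    case (elim m)
    obtain k :: nat where k: "\<bar>s0 - real k * (pi / m)\<bar> \<le> pi / m" using near_grid[of "pi / m" s0] elim s0 by auto
    define s where "s = pi * real k / real m"
    have "\<bar>s - s0\<bar> < d" using k elim by (simp add: s_def abs_minus_commute mult.commute)
    then have fs: "\<bar>f s - \<rho>\<bar> < e" using d f0 by simp
    define v where "v = of_real (f s) * u"
    have "v - of_real \<rho> * u = of_real (f s - \<rho>) * u" by (simp add: v_def algebra_simps)
    then have "norm (v - of_real \<rho> * u) < e" using fs u by (simp add: norm_mult del: of_real_diff)
    moreover have "2 * v ^ N - 1 = of_real (cos s)"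
    proof -
      have "0 \<le> 1 + cos s" using cos_ge_minus_one[of s] by linarith
      then have "0 \<le> (1 + cos s) / 2" by simp
      then have "f s ^ N = (1 + cos s) / 2" unfolding f_def using N by (simp add: real_root_pow_pos2)
      moreover have "v ^ N = of_real (f s ^ N)" using u by (simp add: v_def power_mult_distrib)
      ultimately have "v ^ N = of_real ((1 + cos s) / 2)" by (simp only:)
      then show ?thesis by (simp add: field_simps)
    qed
    ultimately show ?case unfolding s_def by blast
  qed
qed

theorem theorem1p2:
  fixes K :: "complex set" and \<epsilon> :: real
  assumes "K \<noteq> {}" and "compact K" and "connected K" and "\<epsilon> > 0"
  shows "\<exists>E. finite_plane_tree E \<and> conformally_balanced E \<and>
             hausdorff_distance K (tree_set E) < \<epsilon>"
proof -
  \<comment> \<open>A point of \<open>K\<close> moves into \<open>\<Gamma>\<close> and then into the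
    tree, each time by less than \<open>\<delta>\<close>; the resulting bound
    \<open>2 * \<delta>\<close> is below \<open>\<epsilon>\<close>.\<close>
  define \<delta> where "\<delta> = \<epsilon> / 3"
  have \<delta>: "\<delta> > 0" using assms(4) by (simp add: \<delta>_def)
  obtain q :: "complex poly" and \<Gamma> where q: "degree q > 0" "compact \<Gamma>"
    "\<And>z. norm (poly q z) \<le> 1 \<Longrightarrow> \<exists>k\<in>K. dist z k < \<delta>"
    "\<And>z. z \<in> \<Gamma> \<Longrightarrow> norm (poly q z) < 1" "\<And>k. k \<in> K \<Longrightarrow> \<exists>x\<in>\<Gamma>. dist k x < \<delta>"
    "\<And>z. poly (pderiv q) z = 0 \<Longrightarrow> norm (poly q z) < 1"
    "\<And>z. poly (pderiv q) z = 0 \<Longrightarrow> poly (pderiv (pderiv q)) z \<noteq> 0"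
    using lemniscate_simple[OF assms(1-3) \<delta>] by metis
  define d where "d = degree q"
  define U where "U = (\<Union>k\<in>K. ball k \<delta>)"
  have "open U" unfolding U_def by (intro open_UN ballI open_ball)
  moreover have "z \<in> U" if "norm (poly q z) \<le> 1" for z using q(3)[OF that] by (auto simp: U_def dist_commute)
  ultimately obtain \<eta> where \<eta>: "\<eta> > 0"
    "\<And>h z. \<lbrakk>\<And>z. norm (poly h z) \<le> \<eta> * (1 + norm z) ^ (d - 1); norm (poly (q + h) z) \<le> 1\<rbrakk> \<Longrightarrow> z \<in> U"
    "\<And>h z. \<lbrakk>\<And>z. norm (poly h z) \<le> \<eta> * (1 + norm z) ^ (d - 1); z \<in> \<Gamma>\<rbrakk> \<Longrightarrow> norm (poly (q + h) z) < 1"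
    unfolding d_def using sublevel_perturb[OF q(1) _ _ q(2,4)] by metis
  define I where "I = {z. poly (pderiv q) z = 0}"
  have "pderiv q \<noteq> 0" using q(1) pderiv_eq_0_iff[of q] by auto
  then have finI: "finite I" unfolding I_def by (rule poly_roots_finite)
  obtain \<delta>' where \<delta>': "\<delta>' > 0"
    "\<And>u. (\<And>c. c \<in> I \<Longrightarrow> norm (u c - poly q c) < \<delta>') \<Longrightarrow>
       \<exists>h. degree h < d \<and> (\<forall>z. norm (poly h z) \<le> \<eta> * (1 + norm z) ^ (d - 1)) \<and>
           (\<forall>z. poly (pderiv (q + h)) z = 0 \<longrightarrow> (\<exists>c\<in>I. poly (q + h) z = u c))"
    unfolding I_def d_def using critical_values_perturb[OF q(1,7) \<eta>(1)] by metis
  \<comment> \<open>Rotating a value in the unit disc onto a nearby radius moves it by less than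
    \<open>e'\<close>. The first term leaves half of \<open>\<delta>'\<close> for a move along the
    radius; by \<open>poly_root_near\<close> the second moves a preimage by less than
    \<open>\<delta>\<close>.\<close>
  define e' where "e' = min (\<delta>' / 2) (norm (lead_coeff q) * \<delta> ^ d)"
  have "lead_coeff q \<noteq> 0" using q(1) by auto
  then have e': "e' > 0" using \<delta>'(1) \<delta> by (simp add: e'_def)
  obtain N :: nat where N: "N > 0" "2 * pi / N < e'"
  proof -
    obtain k :: nat where "2 * pi / e' < real k" using reals_Archimedean2 by blast
    moreover have "2 * pi / e' > 0" using e' by simp
    ultimately have "real k > 0" by linarith
    moreover have "2 * pi < real k * e'" using e' \<open>2 * pi / e' < real k\<close> by (simp add: pos_divide_less_eq)
    ultimately show ?thesis using that[of k] by (simp add: pos_divide_less_eq mult.commute)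
  qed
  have "\<exists>u. u ^ N = 1 \<and> norm u = 1 \<and> norm (poly q c - of_real (norm (poly q c)) * u) < \<delta>' / 2" if "c \<in> I" for c
  proof -
    obtain u where u: "u ^ N = 1" "norm u = 1" "norm (poly q c - of_real (norm (poly q c)) * u) \<le> norm (poly q c) * (2 * pi / N)"
      using near_star[OF N(1)] by metis
    have "norm (poly q c) * (2 * pi / N) \<le> 1 * (2 * pi / N)"
      using q(6)[of c] that N by (intro mult_right_mono) (auto simp: I_def)
    also have "\<dots> < \<delta>' / 2" using N(2) by (simp add: e'_def)
    finally show ?thesis using u by auto
  qed
  then obtain u where u: "\<And>c. c \<in> I \<Longrightarrow> u c ^ N = 1" "\<And>c. c \<in> I \<Longrightarrow> norm (u c) = 1"
    "\<And>c. c \<in> I \<Longrightarrow> norm (poly q c - of_real (norm (poly q c)) * u c) < \<delta>' / 2" by metis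
  \<comment> \<open>The other half of \<open>\<delta>'\<close> is spent along the radius, with a
    common \<open>m\<close> for the finitely many critical points.\<close>
  have "eventually (\<lambda>m. \<forall>c\<in>I. \<exists>k v. norm (v - of_real (norm (poly q c)) * u c) < \<delta>' / 2 \<and>
      2 * v ^ N - 1 = of_real (cos (pi * real k / real m))) sequentially"
    using finI q(6) \<delta>'(1) u(1,2)
    by (intro eventually_ball_finite ballI near_star_vertex N(1)) (auto simp: I_def less_imp_le)
  then have "eventually (\<lambda>m. m > 0 \<and> (\<forall>c\<in>I. \<exists>k v. norm (v - of_real (norm (poly q c)) * u c) < \<delta>' / 2 \<and>
      2 * v ^ N - 1 = of_real (cos (pi * real k / real m)))) sequentially"
    using eventually_gt_at_top[of 0] by eventually_elim auto
  from eventually_happens'[OF sequentially_bot this]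
  obtain m :: nat where m: "m > 0" "\<And>c. c \<in> I \<Longrightarrow> \<exists>k v. norm (v - of_real (norm (poly q c)) * u c) < \<delta>' / 2 \<and>
      2 * v ^ N - 1 = of_real (cos (pi * real k / real m))"
    by blast
  then obtain v where v: "\<And>c. c \<in> I \<Longrightarrow> norm (v c - of_real (norm (poly q c)) * u c) < \<delta>' / 2"
    "\<And>c. c \<in> I \<Longrightarrow> \<exists>k. 2 * v c ^ N - 1 = of_real (cos (pi * real k / real m))" by metis
  have "norm (v c - poly q c) < \<delta>'" if "c \<in> I" for c
    using norm_triangle_ineq4[of "v c - of_real (norm (poly q c)) * u c" "poly q c - of_real (norm (poly q c)) * u c"]
      v(1)[OF that] u(3)[OF that] by simp
  then obtain h where h: "degree h < d" "\<And>z. norm (poly h z) \<le> \<eta> * (1 + norm z) ^ (d - 1)"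
    "\<And>z. poly (pderiv (q + h)) z = 0 \<Longrightarrow> \<exists>c\<in>I. poly (q + h) z = v c"
    using \<delta>'(2)[of v] by blast
  define p where "p = q + h"
  have dp: "degree p = d" unfolding p_def d_def using h(1) by (intro degree_add_eq_left) (simp add: d_def)
  \<comment> \<open>The leading term is that of \<open>q\<close>, so \<open>e'\<close>, fixed before
    \<open>h\<close> was known, still controls the roots of \<open>p\<close>.\<close>
  have lp: "lead_coeff p = lead_coeff q" unfolding dp unfolding p_def d_def using h(1) by (simp add: d_def coeff_eq_0)
  have "shabat (star_poly m N p)"
  proof (rule shabat_star_poly[OF m(1) N(1)])
    show "degree p > 0" using dp q(1) by (simp add: d_def)
    show "\<exists>k. 2 * poly p z ^ N - 1 = of_real (cos (pi * real k / real m))" if "poly (pderiv p) z = 0" for z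
      using h(3)[of z] that v(2) unfolding p_def by metis
  qed
  then obtain E where E: "finite_plane_tree E" "conformally_balanced E" "tree_set E = poly (star_poly m N p) -` seg"
    using shabat_tree by blast
  have T: "z \<in> tree_set E \<longleftrightarrow> poly p z ^ N \<in> of_real ` {0..1}" for z
    using star_poly_seg[OF m(1)] E(3) by simp
  have "K \<subseteq> nbhd (2 * \<delta>) (tree_set E)"
  proof
    fix k assume "k \<in> K"
    then obtain x where x: "x \<in> \<Gamma>" "dist k x < \<delta>" using q(5) by blast
    have "norm (poly p x) \<le> 1" using \<eta>(3)[OF h(2) x(1)] by (simp add: p_def)
    obtain s where s: "s ^ N = 1" "norm s = 1" "norm (poly p x - of_real (norm (poly p x)) * s) \<le> norm (poly p x) * (2 * pi / N)"
      using near_star[OF N(1)] by metis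
    have "norm (poly p x) * (2 * pi / N) \<le> 1 * (2 * pi / N)"
      using \<open>norm (poly p x) \<le> 1\<close> N by (intro mult_right_mono) auto
    also have "\<dots> < norm (lead_coeff q) * \<delta> ^ d" using N(2) by (simp add: e'_def)
    finally have close: "norm (poly p x - of_real (norm (poly p x)) * s) < norm (lead_coeff q) * \<delta> ^ d" using s(3) by linarith
    have "degree p > 0" using dp q(1) by (simp add: d_def)
    \<comment> \<open>A preimage of the rotated value lies in the tree, as that value is on a radius
      of the star.\<close>
    then obtain z where z: "poly p z = of_real (norm (poly p x)) * s"
      "norm (lead_coeff p) * norm (x - z) ^ degree p \<le> norm (poly p x - of_real (norm (poly p x)) * s)"
      by (rule poly_root_near)
    then have "norm (lead_coeff q) * norm (x - z) ^ d < norm (lead_coeff q) * \<delta> ^ d" using close lp dp by simp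
    then have "norm (x - z) ^ d < \<delta> ^ d" by (rule mult_left_less_imp_less) simp
    then have "norm (x - z) < \<delta>" using \<delta> by (metis less_imp_le power_less_imp_less_base)
    then have "dist k z < 2 * \<delta>" using x(2) dist_triangle[of k z x] by (simp add: dist_norm)
    moreover have "poly p z ^ N = of_real (norm (poly p x) ^ N)" using s z by (simp add: power_mult_distrib)
    then have "z \<in> tree_set E" unfolding T using \<open>norm (poly p x) \<le> 1\<close> by (intro image_eqI[of _ _ "norm (poly p x) ^ N"]) (auto simp: power_le_one)
    ultimately show "k \<in> nbhd (2 * \<delta>) (tree_set E)" by (auto simp: nbhd_def)
  qed
  moreover have "tree_set E \<subseteq> nbhd (2 * \<delta>) K"
  proof
    fix z assume "z \<in> tree_set E"
    then obtain t where t: "t \<in> {0..1}" "poly p z ^ N = of_real t" unfolding T by auto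
    then have "norm (poly p z) ^ N \<le> 1" by (metis atLeastAtMost_iff norm_power norm_of_real abs_of_nonneg)
    then have "norm (poly p z) \<le> 1" using N(1) by (metis not_le one_less_power)
    then have "z \<in> U" using \<eta>(2)[OF h(2)] by (simp add: p_def)
    then obtain k where "k \<in> K" "z \<in> ball k \<delta>" unfolding U_def by blast
    then show "z \<in> nbhd (2 * \<delta>) K" using \<delta> by (auto simp: nbhd_def dist_commute intro!: bexI[of _ k])
  qed
  ultimately have "hausdorff_distance K (tree_set E) \<le> 2 * \<delta>"
    unfolding hausdorff_distance_def using \<delta> by (intro cInf_lower bdd_belowI[of _ 0]) auto
  also have "2 * \<delta> < \<epsilon>" using assms(4) by (simp add: \<delta>_def)
  finally show ?thesis using E by blast
qed

end
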